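(* Let $\Omega\subset\mathbb{R}^d$ be a bounded Lipschitz domain, $0<T<\infty$ and $y_0\in H^1(\Omega)$. Let $A\in C^1(\mathbb{R}^d)$ be such that, for constants $C_A,\overline{C}_A>0$, $(A'(p)-A'(q),p-q)\ge C_A|p-q|^2$ and $|A'(p)|\le\overline{C}_A|p|$ for all $p,q\in\mathbb{R}^d$. Let $\psi\in C^1(\mathbb{R})$ be bounded from below with $\psi(y_0)\in L^1(\Omega)$, and suppose there are constants $c,C_\psi\ge0$, $C_n\ge0$ $(n\in\mathbb{N})$ and functions $f_n\in C^2(\mathbb{R})$ with $f_n\to\psi$ in $C^1_{\mathrm{loc}}(\mathbb{R})$, $-c\le f_n\le c(\psi+1)$, $f_n''\ge-C_\psi$ and $|f_n''|\le C_n$ on $\mathbb{R}$. If $\tau=\max_j\tau_j<1/C_\psi$, then for every $u_\tau\in U_\tau$ the time-discretized state equation $$(y_j,\varphi)+\tau_j(A'(\nabla y_j),\nabla\varphi)+\tau_j(\psi'(y_j),\varphi)=\tau_j(u_j,\varphi)+(y_{j-1},\varphi)\qquad\forall\varphi\in H^1(\Omega),\ j=1,\dots,N,$$ with $y_\tau(0,\cdot)=y_0$, has a unique solution $y_\tau\in Y_\tau$. Furthermore, for every $\bar c\geq 0$ there exists a constant $C_{A,\psi,y_0}(\bar c)$, independent of $\tau$, such that whenever $0<\tau<1/C_\psi$ and $\|u_\tau\|_{L^2(0,T;L^2(\Omega))}\le\bar c$, the corresponding solution satisfies $$\|\partial_t^{-\tau}y_\tau\|_{L^2(0,T;L^2(\Omega))}+\|y_\tau\|_{L^\infty(0,T;H^1(\Omega))}+\|\psi'(y_\tau)\|_{L^2(0,T;L^2(\Omega))}\le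 C_{A,\psi,y_0}(\bar c).$$
   Context: $A'$ denotes the gradient of $A$; $(\cdot,\cdot)$ is the $L^2(\Omega)$ (or Euclidean) scalar product. Convention: $\tfrac1{C_\psi}:=\infty$ if $C_\psi=0$. Time discretization: for $0=t_0<t_1<\dots<t_N=T$ put $I_j=(t_{j-1},t_j]$, $\tau_j=t_j-t_{j-1}$, $\tau=\max_j\tau_j$. With $Q=[0,T]\times\Omega$, $Y_\tau$ is the set of $y_\tau:Q\to\mathbb{R}$ with $y_\tau(t,\cdot)\in H^1(\Omega)$ for all $t$ and $y_\tau(\cdot,x)$ constant on each $I_j$ (for a.e. $x$); $U_\tau$ is the set of $u_\tau:Q\to\mathbb{R}$ with $u_\tau(t,\cdot)\in L^2(\Omega)$ for all $t$ and $u_\tau(\cdot,x)$ constant on each $I_j$ (for a.e. $x$). One writes $y_j:=y_{\tau|I_j}$, $u_j:=u_{\tau|I_j}$, and $y_0=y_\tau(0,\cdot)$. The backward difference quotient is $\partial_t^{-\tau}y_{\tau|I_j}:=\tfrac1{\tau_j}(y_j-y_{j-1})$ for $j=1,\dots,N$. *)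

theory Defs
  imports "HOL-Analysis.Analysis" "HOL-Probability.Essential_Supremum"
begin

section \<open>Lipschitz domains\<close>

text \<open>
  Near each boundary point the domain is, after a rotation, the strict epigraph of a Lipschitz
  function.  The rotation is encoded by the unit vector \<open>e\<close> playing the role of the last coordinate
  axis; the Lipschitz function \<open>\<gamma>\<close> lives on the hyperplane orthogonal to \<open>e\<close>.
\<close>

definition bounded_lipschitz_domain :: "'a::euclidean_space set \<Rightarrow> bool" where
  "bounded_lipschitz_domain \<Omega> \<longleftrightarrow>
     open \<Omega> \<and> connected \<Omega> \<and> \<Omega> \<noteq> {} \<and> bounded \<Omega> \<and>
     (\<forall>x0\<in>frontier \<Omega>. \<exists>r>0. \<exists>e \<gamma> L. norm e = 1 \<and> L-lipschitz_on {v. v \<bullet> e = 0} \<gamma> \<and>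
        \<Omega> \<inter> ball x0 r = {z \<in> ball x0 r. z \<bullet> e > \<gamma> (z - (z \<bullet> e) *\<^sub>R e)})"

section \<open>Lebesgue and Sobolev spaces on a domain\<close>

text \<open>
  Elements of function spaces are represented by total functions; only their values almost
  everywhere on \<open>\<Omega>\<close> matter, and equality of elements is equality almost everywhere on \<open>\<Omega>\<close>.
\<close>

definition L2_space :: "'a::euclidean_space set \<Rightarrow> ('a \<Rightarrow> 'b::euclidean_space) set" where
  "L2_space \<Omega> = {v. v \<in> borel_measurable (lebesgue_on \<Omega>) \<and>
                     integrable (lebesgue_on \<Omega>) (\<lambda>x. (norm (v x))\<^sup>2)}"

definition L2_inner ::
    "'a::euclidean_space set \<Rightarrow> ('a \<Rightarrow> 'b::euclidean_space) \<Rightarrow> ('a \<Rightarrow> 'b) \<Rightarrow> real" where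
  "L2_inner \<Omega> v w = (\<integral>x. v x \<bullet> w x \<partial>lebesgue_on \<Omega>)"

definition L2_norm :: "'a::euclidean_space set \<Rightarrow> ('a \<Rightarrow> 'b::euclidean_space) \<Rightarrow> real" where
  "L2_norm \<Omega> v = sqrt (L2_inner \<Omega> v v)"

fun Ck_function :: "nat \<Rightarrow> ('a::euclidean_space \<Rightarrow> real) \<Rightarrow> bool" where
  "Ck_function 0 f \<longleftrightarrow> continuous_on UNIV f"
| "Ck_function (Suc k) f \<longleftrightarrow>
     (\<forall>x. f differentiable (at x)) \<and>
     (\<forall>b\<in>Basis. Ck_function k (\<lambda>x. frechet_derivative f (at x) b))"

definition test_functions :: "'a::euclidean_space set \<Rightarrow> ('a \<Rightarrow> real) set" where
  "test_functions \<Omega> = {\<phi>. (\<forall>k. Ck_function k \<phi>) \<and>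
     compact (closure {x. \<phi> x \<noteq> 0}) \<and> closure {x. \<phi> x \<noteq> 0} \<subseteq> \<Omega>}"

definition has_weak_gradient ::
    "'a::euclidean_space set \<Rightarrow> ('a \<Rightarrow> real) \<Rightarrow> ('a \<Rightarrow> 'a) \<Rightarrow> bool" where
  "has_weak_gradient \<Omega> v g \<longleftrightarrow>
     (\<forall>\<phi>\<in>test_functions \<Omega>. \<forall>b\<in>Basis.
        (\<integral>x. v x * frechet_derivative \<phi> (at x) b \<partial>lebesgue_on \<Omega>)
          = - (\<integral>x. (g x \<bullet> b) * \<phi> x \<partial>lebesgue_on \<Omega>))"

definition H1_space :: "'a::euclidean_space set \<Rightarrow> ('a \<Rightarrow> real) set" where
  "H1_space \<Omega> = {v. v \<in> L2_space \<Omega> \<and> (\<exists>g\<in>L2_space \<Omega>. has_weak_gradient \<Omega> v g)}"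

text \<open>The weak gradient is determined only almost everywhere; some representative is chosen.\<close>

definition weak_gradient :: "'a::euclidean_space set \<Rightarrow> ('a \<Rightarrow> real) \<Rightarrow> 'a \<Rightarrow> 'a" where
  "weak_gradient \<Omega> v = (SOME g. g \<in> L2_space \<Omega> \<and> has_weak_gradient \<Omega> v g)"

definition H1_norm :: "'a::euclidean_space set \<Rightarrow> ('a \<Rightarrow> real) \<Rightarrow> real" where
  "H1_norm \<Omega> v =
     sqrt (L2_inner \<Omega> v v + L2_inner \<Omega> (weak_gradient \<Omega> v) (weak_gradient \<Omega> v))"

section \<open>Bochner spaces on the interval from 0 to T\<close>

text \<open>
  The target space is given by its set \<open>X\<close> of representatives and its norm \<open>nrm\<close>.  Strong
  measurability is almost everywhere approximability by simple functions with values in \<open>X\<close>.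
\<close>

definition bochner_simple ::
    "real \<Rightarrow> ('a \<Rightarrow> real) set \<Rightarrow> (real \<Rightarrow> 'a \<Rightarrow> real) \<Rightarrow> bool" where
  "bochner_simple T X s \<longleftrightarrow>
     (\<exists>(m::nat) E v. (\<forall>i<m. E i \<in> sets (lebesgue_on {0<..<T}) \<and> v i \<in> X) \<and>
        s = (\<lambda>t x. \<Sum>i<m. indicat_real (E i) t * v i x))"

definition strongly_measurable ::
    "real \<Rightarrow> ('a \<Rightarrow> real) set \<Rightarrow> (('a \<Rightarrow> real) \<Rightarrow> real) \<Rightarrow> (real \<Rightarrow> 'a \<Rightarrow> real) \<Rightarrow> bool" where
  "strongly_measurable T X nrm w \<longleftrightarrow>
     (AE t in lebesgue_on {0<..<T}. w t \<in> X) \<and>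
     (\<exists>s. (\<forall>n. bochner_simple T X (s n)) \<and>
        (AE t in lebesgue_on {0<..<T}. (\<lambda>n. nrm (\<lambda>x. s n t x - w t x)) \<longlonglongrightarrow> 0))"

definition bochner_L2 ::
    "real \<Rightarrow> ('a \<Rightarrow> real) set \<Rightarrow> (('a \<Rightarrow> real) \<Rightarrow> real) \<Rightarrow> (real \<Rightarrow> 'a \<Rightarrow> real) set" where
  "bochner_L2 T X nrm = {w. strongly_measurable T X nrm w \<and>
     integrable (lebesgue_on {0<..<T}) (\<lambda>t. (nrm (w t))\<^sup>2)}"

definition bochner_L2_norm ::
    "real \<Rightarrow> (('a \<Rightarrow> real) \<Rightarrow> real) \<Rightarrow> (real \<Rightarrow> 'a \<Rightarrow> real) \<Rightarrow> real" where
  "bochner_L2_norm T nrm w = sqrt (\<integral>t. (nrm (w t))\<^sup>2 \<partial>lebesgue_on {0<..<T})"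

definition bochner_Linf ::
    "real \<Rightarrow> ('a \<Rightarrow> real) set \<Rightarrow> (('a \<Rightarrow> real) \<Rightarrow> real) \<Rightarrow> (real \<Rightarrow> 'a \<Rightarrow> real) set" where
  "bochner_Linf T X nrm = {w. strongly_measurable T X nrm w \<and>
     esssup (lebesgue_on {0<..<T}) (\<lambda>t. ereal (nrm (w t))) < \<infinity>}"

definition bochner_Linf_norm ::
    "real \<Rightarrow> (('a \<Rightarrow> real) \<Rightarrow> real) \<Rightarrow> (real \<Rightarrow> 'a \<Rightarrow> real) \<Rightarrow> real" where
  "bochner_Linf_norm T nrm w =
     real_of_ereal (esssup (lebesgue_on {0<..<T}) (\<lambda>t. ereal (nrm (w t))))"

section \<open>Time discretization\<close>

definition time_grid :: "real \<Rightarrow> nat \<Rightarrow> (nat \<Rightarrow> real) \<Rightarrow> bool" where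
  "time_grid T N t \<longleftrightarrow> N \<ge> 1 \<and> t 0 = 0 \<and> t N = T \<and> (\<forall>j\<in>{1..N}. t (j - 1) < t j)"

definition grid_interval :: "(nat \<Rightarrow> real) \<Rightarrow> nat \<Rightarrow> real set" where
  "grid_interval t j = {t (j - 1)<..t j}"

definition step_size :: "(nat \<Rightarrow> real) \<Rightarrow> nat \<Rightarrow> real" where
  "step_size t j = t j - t (j - 1)"

definition mesh_size :: "nat \<Rightarrow> (nat \<Rightarrow> real) \<Rightarrow> real" where
  "mesh_size N t = Max (step_size t ` {1..N})"

text \<open>The strict bound \<open>\<tau> < 1 / C\<close> with the convention that \<open>1 / 0\<close> is infinite.\<close>

definition less_reciprocal :: "real \<Rightarrow> real \<Rightarrow> bool" where
  "less_reciprocal \<tau> C \<longleftrightarrow> (if C = 0 then True else \<tau> < 1 / C)"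

definition step_functions ::
    "real \<Rightarrow> 'a::euclidean_space set \<Rightarrow> nat \<Rightarrow> (nat \<Rightarrow> real) \<Rightarrow> ('a \<Rightarrow> real) set
      \<Rightarrow> (real \<Rightarrow> 'a \<Rightarrow> real) set" where
  "step_functions T \<Omega> N t X = {w. (\<forall>s\<in>{0..T}. w s \<in> X) \<and>
     (AE x in lebesgue_on \<Omega>. \<forall>j\<in>{1..N}. (\<lambda>s. w s x) constant_on grid_interval t j)}"

definition Y_tau ::
    "real \<Rightarrow> 'a::euclidean_space set \<Rightarrow> nat \<Rightarrow> (nat \<Rightarrow> real) \<Rightarrow> (real \<Rightarrow> 'a \<Rightarrow> real) set" where
  "Y_tau T \<Omega> N t = step_functions T \<Omega> N t (H1_space \<Omega>)"

definition U_tau ::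
    "real \<Rightarrow> 'a::euclidean_space set \<Rightarrow> nat \<Rightarrow> (nat \<Rightarrow> real) \<Rightarrow> (real \<Rightarrow> 'a \<Rightarrow> real) set" where
  "U_tau T \<Omega> N t = step_functions T \<Omega> N t (L2_space \<Omega>)"

text \<open>
  For a step function \<open>y\<close> the value on the \<open>j\<close>-th interval is represented by \<open>y (t j)\<close>; for
  \<open>j = 0\<close> this is the value at time \<open>0\<close>.
\<close>

definition backward_difference ::
    "nat \<Rightarrow> (nat \<Rightarrow> real) \<Rightarrow> (real \<Rightarrow> 'a \<Rightarrow> real) \<Rightarrow> real \<Rightarrow> 'a \<Rightarrow> real" where
  "backward_difference N t y s x =
     (\<Sum>j=1..N. indicat_real (grid_interval t j) s *
        ((y (t j) x - y (t (j - 1)) x) / step_size t j))"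

text \<open>
  Integrability of \<open>\<psi>'(y\<^sub>j) \<phi>\<close> has to be demanded explicitly, since the Bochner integral of a
  non-integrable function is \<open>0\<close> by convention.
\<close>

definition discrete_state_solution ::
    "real \<Rightarrow> 'a::euclidean_space set \<Rightarrow> ('a \<Rightarrow> 'a) \<Rightarrow> (real \<Rightarrow> real) \<Rightarrow> ('a \<Rightarrow> real)
      \<Rightarrow> nat \<Rightarrow> (nat \<Rightarrow> real) \<Rightarrow> (real \<Rightarrow> 'a \<Rightarrow> real) \<Rightarrow> (real \<Rightarrow> 'a \<Rightarrow> real) \<Rightarrow> bool" where
  "discrete_state_solution T \<Omega> A' \<psi>' y0 N t u y \<longleftrightarrow>
     y \<in> Y_tau T \<Omega> N t \<and>
     (AE x in lebesgue_on \<Omega>. y 0 x = y0 x) \<and>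
     (\<forall>j\<in>{1..N}. \<forall>\<phi>\<in>H1_space \<Omega>.
        integrable (lebesgue_on \<Omega>) (\<lambda>x. \<psi>' (y (t j) x) * \<phi> x) \<and>
        L2_inner \<Omega> (y (t j)) \<phi>
          + step_size t j *
              L2_inner \<Omega> (\<lambda>x. A' (weak_gradient \<Omega> (y (t j)) x)) (weak_gradient \<Omega> \<phi>)
          + step_size t j * L2_inner \<Omega> (\<lambda>x. \<psi>' (y (t j) x)) \<phi>
        = step_size t j * L2_inner \<Omega> (u (t j)) \<phi> + L2_inner \<Omega> (y (t (j - 1))) \<phi>)"

end

theory Submission
  imports Defs "HOL-Computational_Algebra.Polynomial"
begin

text \<open>
  One time step is the Euler--Lagrange equation of a functional which is strongly convex on \<open>H\<^sup>1\<close>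
  because \<open>\<tau> C < 1\<close>, so minimising sequences are Cauchy sequences and no compact embedding is needed.
  The hypotheses on \<open>f n\<close> make \<open>\<psi>'\<close> plus \<open>C\<close> times the identity nondecreasing; up to a
  constant this is \<open>\<beta>\<close>. The growth of \<open>\<beta>\<close> is handled by truncating its
  values: the truncated energies increase with the truncation level, hence the minimisers converge
  strongly. Testing the equation with \<open>\<beta>(y)\<close>, which is monotone in \<open>y\<close>, has a good sign on the
  elliptic part and bounds \<open>\<beta>(y)\<close> in \<open>L\<^sup>2\<close>; this needs the chain rule for weak gradients, obtained
  here from difference quotients. The estimate uniform in the time grid comes from testing with
  \<open>y\<^sub>j - y\<^sub>j\<^sub>-\<^sub>1\<close>: the condition \<open>\<tau> C < 1\<close> absorbs the nonconvexity of \<open>\<psi>\<close> into half of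
  \<open>\<parallel>y\<^sub>j - y\<^sub>j\<^sub>-\<^sub>1\<parallel>\<^sup>2 / \<tau>\<^sub>j\<close>, and the remaining energy differences telescope.
\<close>

subsection \<open>Square integrable functions on a bounded open set\<close>

text \<open>The obstacle is that \<open>\<psi>'\<close> has no growth bound: for v in H^1 the
  function \<open>\<psi>'(v)\<close> need not be integrable against test functions, so the full
  energy cannot be differentiated in every direction. Truncating the values of
  \<open>\<beta>\<close> leaves a gradient of at most linear growth in the pair of value and weak
  gradient, and each truncated problem becomes an integral functional on a closed subspace of L^2.
  Moving \<open>C\<psi>\<close> times the identity from \<open>\<psi>'\<close> to the mass term
  leaves the factor 1 - \<tau> \<open>C\<psi>\<close> in front of y_j; this is where the step size
  condition provides the convexity modulus. The truncated \<open>\<beta>(y)\<close> is bounded in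
  L^2 by data that do not see the truncation level, and boundedness in L^2 together with convergence
  almost everywhere gives weak convergence, which suffices because the test function enters
  linearly. The same test, applied to an arbitrary solution, yields the term with
  \<open>\<psi>'(y_\<tau>)\<close> in the final estimate: there the time derivative is treated as
  part of the right-hand side.\<close>

text \<open>Fatou's lemma. The finite bound on the integrals is what makes the limit integrable, so
  its integrability is a conclusion.\<close>

lemma Fatou_bound:
  fixes f :: "nat \<Rightarrow> 'a \<Rightarrow> real"
  assumes int: "\<And>n. integrable M (f n)" and nonneg: "\<And>n x. 0 \<le> f n x"
    and bound: "\<And>n. (\<integral>x. f n x \<partial>M) \<le> C"
    and lim: "AE x in M. (\<lambda>n. f n x) \<longlonglongrightarrow> g x"
    and meas: "g \<in> borel_measurable M"
  shows "integrable M g" "(\<integral>x. g x \<partial>M) \<le> C"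
proof -
  have C0: "0 \<le> C"
    using bound[of 0] Bochner_Integration.integral_nonneg[of M "f 0"] nonneg by (meson order_trans)
  have g0: "AE x in M. 0 \<le> g x"
    using lim by eventually_elim (rule LIMSEQ_le_const, auto simp: nonneg)
  have "(\<integral>\<^sup>+x. ennreal (g x) \<partial>M) = (\<integral>\<^sup>+x. liminf (\<lambda>n. ennreal (f n x)) \<partial>M)"
  proof (rule nn_integral_cong_AE)
    show "AE x in M. ennreal (g x) = liminf (\<lambda>n. ennreal (f n x))"
      using lim
    proof eventually_elim
      case (elim x)
      have "(\<lambda>n. ennreal (f n x)) \<longlonglongrightarrow> ennreal (g x)"
        by (intro tendsto_ennrealI elim)
      then show ?case by (simp add: lim_imp_Liminf)
    qed
  qed
  also have "\<dots> \<le> liminf (\<lambda>n. \<integral>\<^sup>+x. ennreal (f n x) \<partial>M)"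
    using int by (intro nn_integral_liminf) auto
  also have "\<dots> \<le> liminf (\<lambda>n::nat. ennreal C)"
    by (intro Liminf_mono always_eventually allI)
      (simp add: nn_integral_eq_integral int nonneg bound ennreal_leI)
  finally have le: "(\<integral>\<^sup>+x. ennreal (g x) \<partial>M) \<le> ennreal C" by (simp add: Liminf_const)
  then show i: "integrable M g"
    using g0 meas by (intro integrableI_nonneg) (auto simp: le_less_trans)
  have "ennreal (\<integral>x. g x \<partial>M) \<le> ennreal C"
    using le nn_integral_eq_integral[OF i g0] by simp
  then show "(\<integral>x. g x \<partial>M) \<le> C" using C0 by (simp add: ennreal_le_iff)
qed

text \<open>In the extended nonnegative reals the integral of the sum is the sum of the integrals,
  hence finite, and so the sum is finite almost everywhere. Serves the Riesz-Fischer argument in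
  \<open>L2_complete\<close>.\<close>

lemma AE_summable_if_integral_summable:
  fixes d :: "nat \<Rightarrow> 'a \<Rightarrow> real"
  assumes int: "\<And>n. integrable M (d n)" and nonneg: "\<And>n x. 0 \<le> d n x"
    and sum: "summable (\<lambda>n. \<integral>x. d n x \<partial>M)"
  shows "AE x in M. summable (\<lambda>n. d n x)"
proof -
  have "(\<integral>\<^sup>+x. (\<Sum>n. ennreal (d n x)) \<partial>M) = (\<Sum>n. \<integral>\<^sup>+x. ennreal (d n x) \<partial>M)"
    using int by (intro nn_integral_suminf) auto
  also have "\<dots> = (\<Sum>n. ennreal (\<integral>x. d n x \<partial>M))"
    by (simp add: nn_integral_eq_integral int nonneg)
  also have "\<dots> < \<infinity>"
    using sum by (simp add: suminf_ennreal_eq[OF _ summable_sums] nonneg)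
  finally have "(\<integral>\<^sup>+x. (\<Sum>n. ennreal (d n x)) \<partial>M) \<noteq> \<infinity>" by simp
  then have "AE x in M. (\<Sum>n. ennreal (d n x)) \<noteq> \<infinity>"
    using int by (intro nn_integral_PInf_AE) auto
  then show ?thesis
    by eventually_elim (auto intro!: summable_suminf_not_top nonneg)
qed

lemma young: "(a::real) * b \<le> e * a\<^sup>2 + b\<^sup>2 / (4 * e)" if "e > 0"
proof -
  have "0 \<le> (2 * e * a - b)\<^sup>2 / (4 * e)" using that by simp
  also have "\<dots> = e * a\<^sup>2 + b\<^sup>2 / (4 * e) - a * b"
    using that by (simp add: field_simps power2_eq_square)
  finally show ?thesis by simp
qed

lemma norm_add_squared_le: "(norm (a + b))\<^sup>2 \<le> 2 * (norm a)\<^sup>2 + 2 * (norm (b::'b::real_normed_vector))\<^sup>2"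
proof -
  have "(norm (a + b))\<^sup>2 \<le> (norm a + norm b)\<^sup>2"
    by (intro power_mono norm_triangle_ineq) auto
  also have "\<dots> \<le> 2 * (norm a)\<^sup>2 + 2 * (norm b)\<^sup>2"
    using sum_squares_bound[of "norm a" "norm b"] by (simp add: power2_sum)
  finally show ?thesis .
qed

lemma norm_diff_squared_le: "(norm (a - b))\<^sup>2 \<le> 2 * (norm a)\<^sup>2 + 2 * (norm (b::'b::real_normed_vector))\<^sup>2"
  using norm_add_squared_le[of a "-b"] by simp

locale bounded_open =
  fixes \<Omega> :: "'a::euclidean_space set"
  assumes open_dom: "open \<Omega>" and bounded_dom: "bounded \<Omega>"
begin

abbreviation "M \<equiv> lebesgue_on \<Omega>"

lemma dom_sets [measurable]: "\<Omega> \<in> sets lebesgue"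
  using open_dom by simp

lemma dom_lmeasurable: "\<Omega> \<in> lmeasurable"
  using open_dom bounded_dom by (simp add: bounded_set_imp_lmeasurable)

lemma finite_measure_M: "finite_measure M"
  using dom_lmeasurable by (auto intro!: finite_measureI simp: emeasure_restrict_space fmeasurable_def)

lemma integrable_const_M [simp, intro]: "integrable M (\<lambda>x. k :: 'b::euclidean_space)"
  by (rule finite_measure.integrable_const[OF finite_measure_M])

lemma L2_measurable: "v \<in> L2_space \<Omega> \<Longrightarrow> v \<in> borel_measurable M"
  by (simp add: L2_space_def)

lemma L2_integrable_sq: "v \<in> L2_space \<Omega> \<Longrightarrow> integrable M (\<lambda>x. (norm (v x))\<^sup>2)"
  by (simp add: L2_space_def)

lemma L2_I: "v \<in> borel_measurable M \<Longrightarrow> integrable M (\<lambda>x. (norm (v x))\<^sup>2) \<Longrightarrow> v \<in> L2_space \<Omega>"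
  by (simp add: L2_space_def)

lemma L2_bound_sq:
  assumes "v \<in> borel_measurable M" "integrable M g" "AE x in M. (norm (v x))\<^sup>2 \<le> g x"
  shows "v \<in> L2_space \<Omega>"
proof (rule L2_I[OF assms(1)])
  have [measurable]: "v \<in> borel_measurable M" by fact
  show "integrable M (\<lambda>x. (norm (v x))\<^sup>2)"
    by (rule Bochner_Integration.integrable_bound[OF assms(2)]) (use assms(3) in auto)
qed

text \<open>Measurability transfers along equality almost everywhere as well, because Lebesgue
  measure is complete.\<close>

lemma L2_cong_AE:
  assumes "v \<in> L2_space \<Omega>" "AE x in M. v x = w x"
  shows "w \<in> L2_space \<Omega>"
proof -
  have v[measurable]: "v \<in> borel_measurable M" using assms L2_measurable by blast
  have "w \<in> borel_measurable M"
  proof -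
    have "AE x in lebesgue. (if x \<in> \<Omega> then v x else 0) = (if x \<in> \<Omega> then w x else 0)"
      using assms(2) by (auto simp: AE_restrict_space_iff)
    moreover have "(\<lambda>x. if x \<in> \<Omega> then v x else 0) \<in> borel_measurable lebesgue"
      using v by (rule borel_measurable_if_I) (rule dom_sets)
    ultimately have "(\<lambda>x. if x \<in> \<Omega> then w x else 0) \<in> borel_measurable lebesgue"
      by (rule borel_measurable_AE[rotated])
    then show ?thesis by (rule borel_measurable_if_D)
  qed
  then show ?thesis
    by (rule L2_bound_sq[OF _ L2_integrable_sq[OF assms(1)]]) (use assms(2) in auto)
qed

lemma L2_dominated:
  assumes "v \<in> borel_measurable M" "w \<in> L2_space \<Omega>" "\<And>x. norm (v x) \<le> norm (w x)"
  shows "v \<in> L2_space \<Omega>"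
  by (rule L2_bound_sq[OF assms(1) L2_integrable_sq[OF assms(2)]]) (intro AE_I2 power_mono assms norm_ge_zero)

lemma L2_bounded:
  assumes "v \<in> borel_measurable M" "\<And>x. norm (v x) \<le> C"
  shows "v \<in> L2_space \<Omega>"
  by (rule L2_bound_sq[where g="\<lambda>_. C\<^sup>2"]) (use assms in \<open>auto intro!: AE_I2 power_mono\<close>)

lemma L2_const: "(\<lambda>x. k) \<in> L2_space \<Omega>"
  by (rule L2_bounded[where C="norm k"]) auto

lemma L2_add:
  assumes "v \<in> L2_space \<Omega>" "w \<in> L2_space \<Omega>"
  shows "(\<lambda>x. v x + w x) \<in> L2_space \<Omega>"
  using assms borel_measurable_add[OF L2_measurable[OF assms(1)] L2_measurable[OF assms(2)]]
  by (intro L2_bound_sq[where g="\<lambda>x. 2 * (norm (v x))\<^sup>2 + 2 * (norm (w x))\<^sup>2"])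
    (auto intro!: AE_I2 L2_integrable_sq norm_add_squared_le simp: L2_measurable)

lemma L2_scaleR:
  assumes "v \<in> L2_space \<Omega>"
  shows "(\<lambda>x. k *\<^sub>R v x) \<in> L2_space \<Omega>"
  using assms borel_measurable_scaleR[OF borel_measurable_const L2_measurable[OF assms(1)]]
  by (intro L2_bound_sq[where g="\<lambda>x. k\<^sup>2 * (norm (v x))\<^sup>2"])
    (auto intro!: AE_I2 L2_integrable_sq simp: L2_measurable power_mult_distrib)

lemma L2_mult: "v \<in> L2_space \<Omega> \<Longrightarrow> (\<lambda>x. k * v x) \<in> L2_space \<Omega>" for v :: "'a \<Rightarrow> real"
  using L2_scaleR[of v k] by simp

lemma L2_divide: "v \<in> L2_space \<Omega> \<Longrightarrow> (\<lambda>x. v x / k) \<in> L2_space \<Omega>" for v :: "'a \<Rightarrow> real"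
  using L2_scaleR[of v "1/k"] by simp

lemma L2_diff:
  "v \<in> L2_space \<Omega> \<Longrightarrow> w \<in> L2_space \<Omega> \<Longrightarrow> (\<lambda>x. v x - w x) \<in> L2_space \<Omega>"
  using L2_add[of v "\<lambda>x. (-1) *\<^sub>R w x"] L2_scaleR[of w "-1"] by simp

lemma L2_inner_const: "v \<in> L2_space \<Omega> \<Longrightarrow> (\<lambda>x. v x \<bullet> b) \<in> L2_space \<Omega>"
proof (rule L2_bound_sq[where g="\<lambda>x. (norm (v x))\<^sup>2 * (norm b)\<^sup>2"])
  assume v: "v \<in> L2_space \<Omega>"
  then show "(\<lambda>x. v x \<bullet> b) \<in> borel_measurable M"
    using L2_measurable[OF v] by measurable
  show "integrable M (\<lambda>x. (norm (v x))\<^sup>2 * (norm b)\<^sup>2)"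
    using L2_integrable_sq[OF v] by simp
  show "AE x in M. (norm (v x \<bullet> b))\<^sup>2 \<le> (norm (v x))\<^sup>2 * (norm b)\<^sup>2"
    by (intro AE_I2) (use Cauchy_Schwarz_ineq2[of "v _" b] in
      \<open>simp add: power_mult_distrib[symmetric] abs_le_square_iff[symmetric] abs_mult\<close>)
qed

lemma L2_Pair:
  assumes "v \<in> L2_space \<Omega>" "g \<in> L2_space \<Omega>"
  shows "(\<lambda>x. (v x, g x)) \<in> L2_space \<Omega>"
  using assms
  by (intro L2_bound_sq[where g="\<lambda>x. (norm (v x))\<^sup>2 + (norm (g x))\<^sup>2"])
    (auto intro!: AE_I2 L2_integrable_sq borel_measurable_Pair simp: L2_measurable norm_Pair)

lemma L2_fst: "z \<in> L2_space \<Omega> \<Longrightarrow> (\<lambda>x. fst (z x)) \<in> L2_space \<Omega>"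
proof (rule L2_bound_sq[where g="\<lambda>x. (norm (z x))\<^sup>2"])
  assume z: "z \<in> L2_space \<Omega>"
  show "(\<lambda>x. fst (z x)) \<in> borel_measurable M"
    using L2_measurable[OF z] by (simp add: borel_prod[symmetric])
  show "AE x in M. (norm (fst (z x)))\<^sup>2 \<le> (norm (z x))\<^sup>2"
    by (intro AE_I2 power_mono) (metis norm_fst_le prod.collapse, simp)
qed (auto intro: L2_integrable_sq)

lemma L2_snd: "z \<in> L2_space \<Omega> \<Longrightarrow> (\<lambda>x. snd (z x)) \<in> L2_space \<Omega>"
proof (rule L2_bound_sq[where g="\<lambda>x. (norm (z x))\<^sup>2"])
  assume z: "z \<in> L2_space \<Omega>"
  show "(\<lambda>x. snd (z x)) \<in> borel_measurable M"
    using L2_measurable[OF z] by (simp add: borel_prod[symmetric])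
  show "AE x in M. (norm (snd (z x)))\<^sup>2 \<le> (norm (z x))\<^sup>2"
    by (intro AE_I2 power_mono) (metis norm_snd_le prod.collapse, simp)
qed (auto intro: L2_integrable_sq)

lemma L2_inner_integrable:
  assumes "v \<in> L2_space \<Omega>" "w \<in> L2_space \<Omega>"
  shows "integrable M (\<lambda>x. v x \<bullet> w x)"
proof (rule Bochner_Integration.integrable_bound)
  show "integrable M (\<lambda>x. (norm (v x))\<^sup>2 + (norm (w x))\<^sup>2)"
    using assms by (auto intro: L2_integrable_sq)
  show "(\<lambda>x. v x \<bullet> w x) \<in> borel_measurable M"
    using assms[THEN L2_measurable] by measurable
  show "AE x in M. norm (v x \<bullet> w x) \<le> norm ((norm (v x))\<^sup>2 + (norm (w x))\<^sup>2)"
  proof (intro AE_I2)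
    fix x
    have "norm (v x \<bullet> w x) \<le> norm (v x) * norm (w x)" using Cauchy_Schwarz_ineq2 by auto
    also have "\<dots> \<le> (norm (v x))\<^sup>2 + (norm (w x))\<^sup>2"
      using sum_squares_bound[of "norm (v x)" "norm (w x)"] mult_nonneg_nonneg[of "norm (v x)" "norm (w x)"] norm_ge_zero[of "v x"] norm_ge_zero[of "w x"] by linarith
    finally show "norm (v x \<bullet> w x) \<le> norm ((norm (v x))\<^sup>2 + (norm (w x))\<^sup>2)" by simp
  qed
qed

lemma L2_mult_integrable:
  "v \<in> L2_space \<Omega> \<Longrightarrow> w \<in> L2_space \<Omega> \<Longrightarrow> integrable M (\<lambda>x. v x * w x)" for v w :: "'a \<Rightarrow> real"
  using L2_inner_integrable[of v w] by simp

lemma L2_integrable: "v \<in> L2_space \<Omega> \<Longrightarrow> integrable M v" for v :: "'a \<Rightarrow> real"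
  using L2_mult_integrable[of v "\<lambda>_. 1"] L2_const[of "1::real"] by simp

lemma L2_norm_space: "v \<in> L2_space \<Omega> \<Longrightarrow> (\<lambda>x. norm (v x)) \<in> L2_space \<Omega>"
  by (auto simp: L2_space_def intro: borel_measurable_norm)

lemma L2_norm_sq: "(L2_norm \<Omega> v)\<^sup>2 = (\<integral>x. (norm (v x))\<^sup>2 \<partial>M)"
  by (simp add: L2_norm_def L2_inner_def power2_norm_eq_inner)

text \<open>With \<open>d n\<close> the distance of \<open>b n\<close> to the limit and
  \<open>f\<close> the norm of the test function, the product of \<open>d n\<close> and
  \<open>f\<close> is at most \<open>e\<close> times the square of \<open>d n\<close>, whose
  integral is bounded by Fatou, plus an excess \<open>q n\<close>. By Young's inequality the excess
  is dominated by a fixed integrable function, so dominated convergence removes it.\<close>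

lemma L2_weak_limit:
  fixes b :: "nat \<Rightarrow> 'a \<Rightarrow> 'b::euclidean_space"
  assumes b: "\<And>n. b n \<in> L2_space \<Omega>" and bound: "\<And>n. (\<integral>x. (norm (b n x))\<^sup>2 \<partial>M) \<le> C"
    and meas: "b' \<in> borel_measurable M"
    and lim: "AE x in M. (\<lambda>n. b n x) \<longlonglongrightarrow> b' x" and \<phi>: "\<phi> \<in> L2_space \<Omega>"
  shows "b' \<in> L2_space \<Omega>" "(\<integral>x. (norm (b' x))\<^sup>2 \<partial>M) \<le> C"
    and "(\<lambda>n. L2_inner \<Omega> (b n) \<phi>) \<longlonglongrightarrow> L2_inner \<Omega> b' \<phi>"
proof -
  have limsq: "AE x in M. (\<lambda>n. (norm (b n x))\<^sup>2) \<longlonglongrightarrow> (norm (b' x))\<^sup>2"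
    using lim by eventually_elim (intro tendsto_intros)
  have F: "integrable M (\<lambda>x. (norm (b' x))\<^sup>2)" "(\<integral>x. (norm (b' x))\<^sup>2 \<partial>M) \<le> C"
    using Fatou_bound[OF L2_integrable_sq[OF b] _ bound limsq] meas by auto
  show b': "b' \<in> L2_space \<Omega>" using F meas by (intro L2_I)
  show "(\<integral>x. (norm (b' x))\<^sup>2 \<partial>M) \<le> C" by fact
  define d where "d n x = norm (b n x - b' x)" for n x
  have dL: "d n \<in> L2_space \<Omega>" for n
    unfolding d_def by (intro L2_norm_space L2_diff b b')
  have dC: "(\<integral>x. (d n x)\<^sup>2 \<partial>M) \<le> 4 * C" for n
  proof -
    have "(\<integral>x. (d n x)\<^sup>2 \<partial>M) \<le> (\<integral>x. 2 * (norm (b n x))\<^sup>2 + 2 * (norm (b' x))\<^sup>2 \<partial>M)"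
      using L2_integrable_sq[OF dL[of n]] L2_integrable_sq[OF b] F(1)
      by (intro integral_mono) (auto simp: d_def norm_diff_squared_le)
    also have "\<dots> \<le> 4 * C"
      using bound[of n] F L2_integrable_sq[OF b] by simp
    finally show ?thesis .
  qed
  have C0: "0 \<le> C" by (rule order_trans[OF _ bound[of 0]]) simp
  define f where "f x = norm (\<phi> x)" for x
  have fL: "f \<in> L2_space \<Omega>" unfolding f_def by (intro L2_norm_space \<phi>)
  have [measurable]: "d n \<in> borel_measurable M" "f \<in> borel_measurable M" for n
    using dL fL L2_measurable by auto
  have key: "(\<lambda>n. \<integral>x. d n x * f x \<partial>M) \<longlonglongrightarrow> 0"
  proof (rule LIMSEQ_I)
    fix r :: real assume r: "r > 0"
    \<comment> \<open>The integral of the square of \<open>d n\<close> is at most 4 C, so this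
      weight costs at most r / 2; the summand 1 covers C = 0.\<close>
    define e where "e = r / (8 * (C + 1))"
    have e: "e > 0" using r C0 by (simp add: e_def)
    define q where "q n x = max 0 (d n x * f x - e * (d n x)\<^sup>2)" for n x
    have qle: "q n x \<le> (f x)\<^sup>2 / (4 * e)" for n x
      using young[OF e, of "d n x" "f x"] e by (simp add: q_def)
    have "(\<lambda>n. \<integral>x. q n x \<partial>M) \<longlonglongrightarrow> (\<integral>x. 0 \<partial>M)"
    proof (rule integral_dominated_convergence[where w="\<lambda>x. (f x)\<^sup>2 / (4 * e)"])
      show "q n \<in> borel_measurable M" for n unfolding q_def by measurable
      show "integrable M (\<lambda>x. (f x)\<^sup>2 / (4 * e))" using L2_integrable_sq[OF fL] by simp
      show "AE x in M. norm (q n x) \<le> (f x)\<^sup>2 / (4 * e)" for n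
        using qle by (intro AE_I2) (simp add: q_def)
      show "AE x in M. (\<lambda>n. q n x) \<longlonglongrightarrow> 0"
        using lim
      proof eventually_elim
        case (elim x)
        then have d0: "(\<lambda>n. d n x) \<longlonglongrightarrow> 0"
          unfolding d_def using LIM_zero tendsto_norm_zero by blast
        have "(\<lambda>n. q n x) \<longlonglongrightarrow> max 0 (0 * f x - e * 0\<^sup>2)"
          unfolding q_def by (intro tendsto_intros d0)
        then show ?case by simp
      qed
    qed auto
    then have "(\<lambda>n. \<integral>x. q n x \<partial>M) \<longlonglongrightarrow> 0" by simp
    from LIMSEQ_D[OF this, of "r/2"] r obtain N where N: "\<And>n. n \<ge> N \<Longrightarrow> \<bar>\<integral>x. q n x \<partial>M\<bar> < r/2" by auto
    show "\<exists>no. \<forall>n\<ge>no. norm ((\<integral>x. d n x * f x \<partial>M) - 0) < r"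
    proof (intro exI allI impI)
      fix n assume n: "n \<ge> N"
      have qi: "integrable M (q n)"
        unfolding q_def using L2_mult_integrable[OF dL fL] L2_integrable_sq[OF dL[of n]] by auto
      have "(\<integral>x. d n x * f x \<partial>M) \<le> (\<integral>x. q n x + e * (d n x)\<^sup>2 \<partial>M)"
        using L2_mult_integrable[OF dL fL] L2_integrable_sq[OF dL[of n]] qi
        by (intro integral_mono) (auto simp: q_def)
      also have "\<dots> = (\<integral>x. q n x \<partial>M) + e * (\<integral>x. (d n x)\<^sup>2 \<partial>M)"
        using L2_integrable_sq[OF dL[of n]] qi by simp
      also have "\<dots> \<le> (\<integral>x. q n x \<partial>M) + e * (4 * C)"
        using dC[of n] e by simp
      also have "e * (4 * C) \<le> r / 2"
        using C0 r by (simp add: e_def field_simps)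
      finally have "(\<integral>x. d n x * f x \<partial>M) < r" using N[OF n] by linarith
      moreover have "0 \<le> (\<integral>x. d n x * f x \<partial>M)" by (simp add: d_def f_def)
      ultimately show "norm ((\<integral>x. d n x * f x \<partial>M) - 0) < r" by simp
    qed
  qed
  have "(\<lambda>n. L2_inner \<Omega> (b n) \<phi> - L2_inner \<Omega> b' \<phi>) \<longlonglongrightarrow> 0"
  proof (rule Lim_null_comparison[OF _ key], intro always_eventually allI)
    fix n
    have "L2_inner \<Omega> (b n) \<phi> - L2_inner \<Omega> b' \<phi> = (\<integral>x. (b n x - b' x) \<bullet> \<phi> x \<partial>M)"
      unfolding L2_inner_def using L2_inner_integrable[OF b \<phi>] L2_inner_integrable[OF b' \<phi>]
      by (simp add: inner_diff_left)
    also have "norm \<dots> \<le> (\<integral>x. norm ((b n x - b' x) \<bullet> \<phi> x) \<partial>M)"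
      by (rule integral_norm_bound)
    also have "\<dots> \<le> (\<integral>x. d n x * f x \<partial>M)"
      using L2_inner_integrable[OF L2_diff[OF b b'] \<phi>] L2_mult_integrable[OF dL fL]
      by (intro integral_mono) (auto simp: d_def f_def Cauchy_Schwarz_ineq2)
    finally show "norm (L2_inner \<Omega> (b n) \<phi> - L2_inner \<Omega> b' \<phi>) \<le> (\<integral>x. d n x * f x \<partial>M)" .
  qed
  then show "(\<lambda>n. L2_inner \<Omega> (b n) \<phi>) \<longlonglongrightarrow> L2_inner \<Omega> b' \<phi>"
    by (simp add: LIM_zero_iff)
qed

text \<open>Riesz-Fischer. Along \<open>r\<close> the squared distances fall below (1/4)^n; Young's
  inequality with weight 2^n and the finiteness of the measure turn this into integrals of order
  (1/2)^n for the unsquared increments, which therefore sum up almost everywhere. Fatou identifies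
  the pointwise limit as the L^2 limit. The almost everywhere convergent subsequence is kept in the
  conclusion because nonlinear terms need pointwise limits.\<close>

lemma L2_complete:
  fixes z :: "nat \<Rightarrow> 'a \<Rightarrow> 'b::euclidean_space"
  assumes z: "\<And>n. z n \<in> L2_space \<Omega>"
    and cauchy: "\<And>e. e > 0 \<Longrightarrow> \<exists>n0. \<forall>m\<ge>n0. \<forall>n\<ge>n0. (\<integral>x. (norm (z m x - z n x))\<^sup>2 \<partial>M) \<le> e"
  obtains l r where "l \<in> L2_space \<Omega>" "(\<lambda>n. \<integral>x. (norm (z n x - l x))\<^sup>2 \<partial>M) \<longlonglongrightarrow> 0"
    "strict_mono r" "AE x in M. (\<lambda>n. z (r n) x) \<longlonglongrightarrow> l x"
proof -
  have "\<exists>r. strict_mono r \<and> (\<forall>n. \<forall>m\<ge>r n. (\<integral>x. (norm (z m x - z (r n) x))\<^sup>2 \<partial>M) \<le> (1/4)^n)"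
  proof -
    have "\<exists>r. \<forall>n. (\<forall>m\<ge>r n. (\<integral>x. (norm (z m x - z (r n) x))\<^sup>2 \<partial>M) \<le> (1/4)^n) \<and> r n < r (Suc n)"
    proof (rule dependent_nat_choice)
      show "\<exists>k. \<forall>m\<ge>k. (\<integral>x. (norm (z m x - z k x))\<^sup>2 \<partial>M) \<le> (1/4)^0"
        using cauchy[of 1] by auto
      fix k n
      obtain n0 where "\<forall>m\<ge>n0. \<forall>n'\<ge>n0. (\<integral>x. (norm (z m x - z n' x))\<^sup>2 \<partial>M) \<le> (1/4)^Suc n"
        using cauchy[of "(1/4)^Suc n"] by auto
      then show "\<exists>y. (\<forall>m\<ge>y. (\<integral>x. (norm (z m x - z y x))\<^sup>2 \<partial>M) \<le> (1/4)^Suc n) \<and> k < y"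
        by (intro exI[of _ "max n0 (Suc k)"]) auto
    qed
    then show ?thesis by (auto simp: strict_mono_Suc_iff)
  qed
  then obtain r where r: "strict_mono r"
    and rb: "\<And>n m. m \<ge> r n \<Longrightarrow> (\<integral>x. (norm (z m x - z (r n) x))\<^sup>2 \<partial>M) \<le> (1/4)^n" by blast
  define d where "d n x = norm (z (r (Suc n)) x - z (r n) x)" for n x
  have dL: "d n \<in> L2_space \<Omega>" for n
    unfolding d_def by (intro L2_norm_space L2_diff z)
  have "AE x in M. summable (\<lambda>n. d n x)"
  proof (rule AE_summable_if_integral_summable)
    show "integrable M (d n)" for n by (rule L2_integrable[OF dL])
    show "summable (\<lambda>n. \<integral>x. d n x \<partial>M)"
    proof (rule summable_comparison_test'[where N=0])
      show "summable (\<lambda>n. (1 + measure M (space M)) * (1/2)^n)"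
        by (intro summable_mult summable_geometric) simp
      fix n :: nat
      have "(\<integral>x. d n x \<partial>M) \<le> (\<integral>x. 2^n * (d n x)\<^sup>2 + (1/2)^n \<partial>M)"
      proof (intro integral_mono)
        fix x
        have "d n x * 1 \<le> 2^n * (d n x)\<^sup>2 + 1\<^sup>2 / (4 * 2^n)" by (rule young) simp
        also have "1\<^sup>2 / (4 * 2^n) \<le> (1/2::real)^n" by (simp add: power_one_over field_simps)
        finally show "d n x \<le> 2^n * (d n x)\<^sup>2 + (1/2)^n" by simp
      qed (use L2_integrable[OF dL[of n]] L2_integrable_sq[OF dL[of n]] in auto)
      also have "\<dots> = 2^n * (\<integral>x. (d n x)\<^sup>2 \<partial>M) + (1/2)^n * measure M (space M)"
        using L2_integrable_sq[OF dL[of n]] by (simp add: mult.commute)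
      also have "\<dots> \<le> 2^n * (1/4)^n + (1/2)^n * measure M (space M)"
        using rb[of n "r (Suc n)"] r by (simp add: d_def strict_mono_less_eq)
      also have "2^n * (1/4)^n = (1/2::real)^n" by (simp add: power_mult_distrib[symmetric])
      finally show "norm (\<integral>x. d n x \<partial>M) \<le> (1 + measure M (space M)) * (1/2)^n"
        by (simp add: d_def algebra_simps)
    qed
  qed (simp add: d_def)
  then have conv: "AE x in M. convergent (\<lambda>n. z (r n) x)"
  proof eventually_elim
    case (elim x)
    then have "summable (\<lambda>n. z (r (Suc n)) x - z (r n) x)"
      unfolding d_def by (rule summable_norm_cancel)
    then have "convergent (\<lambda>n. \<Sum>i<n. z (r (Suc i)) x - z (r i) x)"
      by (simp add: summable_iff_convergent)
    then have "convergent (\<lambda>n. z (r n) x - z (r 0) x)"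
      using sum_lessThan_telescope[of "\<lambda>i. z (r i) x"] by simp
    then have "convergent (\<lambda>n. (z (r n) x - z (r 0) x) + z (r 0) x)"
      by (intro convergent_add convergent_const)
    then show ?case by simp
  qed
  define l where "l x = lim (\<lambda>n. z (r n) x)" for x
  have lim: "AE x in M. (\<lambda>n. z (r n) x) \<longlonglongrightarrow> l x"
    using conv by eventually_elim (simp add: l_def convergent_LIMSEQ_iff)
  have [measurable]: "z n \<in> borel_measurable M" for n using z L2_measurable by blast
  have [measurable]: "l \<in> borel_measurable M"
    unfolding l_def by (rule borel_measurable_lim_metric) auto
  have est: "integrable M (\<lambda>x. (norm (z m x - l x))\<^sup>2) \<and> (\<integral>x. (norm (z m x - l x))\<^sup>2 \<partial>M) \<le> e"
    if e: "\<forall>m\<ge>n0. \<forall>n\<ge>n0. (\<integral>x. (norm (z m x - z n x))\<^sup>2 \<partial>M) \<le> e" and m: "m \<ge> n0" for m n0 e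
  proof -
    \<comment> \<open>The shift by \<open>n0\<close> puts the whole subsequence into the range of
      the Cauchy estimate, as Fatou's lemma asks for the bound at every index.\<close>
    have ge: "r (n + n0) \<ge> n0" for n
      using seq_suble[OF r, of "n + n0"] by simp
    have "AE x in M. (\<lambda>n. (norm (z m x - z (r (n + n0)) x))\<^sup>2) \<longlonglongrightarrow> (norm (z m x - l x))\<^sup>2"
      using lim by eventually_elim (intro tendsto_intros LIMSEQ_ignore_initial_segment)
    from Fatou_bound[OF _ _ _ this, of e] show ?thesis
      using e m ge L2_integrable_sq[OF L2_diff[OF z z]] by auto
  qed
  have lL: "l \<in> L2_space \<Omega>"
  proof -
    obtain n0 where n0: "\<forall>m\<ge>n0. \<forall>n\<ge>n0. (\<integral>x. (norm (z m x - z n x))\<^sup>2 \<partial>M) \<le> 1"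
      using cauchy[of 1] by auto
    have "(\<lambda>x. z n0 x - l x) \<in> L2_space \<Omega>"
      using est[OF n0 order_refl] by (intro L2_I) auto
    from L2_diff[OF z[of n0] this] show ?thesis by simp
  qed
  have "(\<lambda>n. \<integral>x. (norm (z n x - l x))\<^sup>2 \<partial>M) \<longlonglongrightarrow> 0"
  proof (rule LIMSEQ_I)
    fix e :: real assume "e > 0"
    then obtain n0 where n0: "\<forall>m\<ge>n0. \<forall>n\<ge>n0. (\<integral>x. (norm (z m x - z n x))\<^sup>2 \<partial>M) \<le> e / 2"
      using cauchy[of "e/2"] by auto
    show "\<exists>no. \<forall>n\<ge>no. norm ((\<integral>x. (norm (z n x - l x))\<^sup>2 \<partial>M) - 0) < e"
    proof (intro exI allI impI)
      fix n assume "n \<ge> n0"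
      from est[OF n0 this] \<open>e > 0\<close>
      show "norm ((\<integral>x. (norm (z n x - l x))\<^sup>2 \<partial>M) - 0) < e" by simp
    qed
  qed
  with lL r lim show ?thesis by (intro that)
qed

end

subsection \<open>Smooth functions\<close>

lemma Ck_function_SucI:
  assumes D: "\<And>x. (f has_derivative D x) (at x)"
    and C: "\<And>b. b \<in> Basis \<Longrightarrow> Ck_function k (\<lambda>x. D x b)"
  shows "Ck_function (Suc k) f"
proof -
  have "frechet_derivative f (at x) = D x" for x
    using frechet_derivative_at[OF D] by simp
  then show ?thesis
    using C D by (auto simp: differentiable_def)
qed

lemma Ck_function_SucD: "Ck_function (Suc k) f \<Longrightarrow> Ck_function k f"
proof (induction k arbitrary: f)
  case 0
  then show ?case
    by (auto simp: continuous_on_eq_continuous_within intro!: differentiable_imp_continuous_within)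
next
  case (Suc k)
  then show ?case by (auto simp del: Ck_function.simps(1))
qed

lemma Ck_function_const: "Ck_function k (\<lambda>x. c)"
  by (induction k arbitrary: c) auto

lemma Ck_function_add:
  "Ck_function k f \<Longrightarrow> Ck_function k g \<Longrightarrow> Ck_function k (\<lambda>x. f x + g x)"
proof (induction k arbitrary: f g)
  case 0
  then show ?case by (auto intro: continuous_intros)
next
  case (Suc k)
  show ?case
  proof (rule Ck_function_SucI)
    show "((\<lambda>x. f x + g x) has_derivative
      (\<lambda>b. frechet_derivative f (at x) b + frechet_derivative g (at x) b)) (at x)" for x
      using Suc.prems by (intro has_derivative_add) (auto simp: frechet_derivative_works)
  qed (use Suc in auto)
qed

lemma Ck_function_mult:
  "Ck_function k f \<Longrightarrow> Ck_function k g \<Longrightarrow> Ck_function k (\<lambda>x. f x * g x)"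
proof (induction k arbitrary: f g)
  case 0
  then show ?case by (auto intro: continuous_intros)
next
  case (Suc k)
  show ?case
  proof (rule Ck_function_SucI)
    show "((\<lambda>x. f x * g x) has_derivative
      (\<lambda>b. f x * frechet_derivative g (at x) b + frechet_derivative f (at x) b * g x)) (at x)" for x
      using Suc.prems by (intro has_derivative_mult) (auto simp: frechet_derivative_works)
    show "Ck_function k (\<lambda>x. f x * frechet_derivative g (at x) b + frechet_derivative f (at x) b * g x)"
      if "b \<in> Basis" for b
      using that Suc.prems Suc.prems[THEN Ck_function_SucD]
      by (intro Ck_function_add Suc.IH) auto
  qed
qed

lemma Ck_function_prod:
  "(\<And>i. i \<in> I \<Longrightarrow> Ck_function k (f i)) \<Longrightarrow> Ck_function k (\<lambda>x. \<Prod>i\<in>I. f i x)"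
  by (induction I rule: infinite_finite_induct) (auto simp: Ck_function_const Ck_function_mult)

text \<open>The functions \<open>P(1/t) exp(-1/t)\<close>, extended by zero to \<open>t \<le> 0\<close>, are closed under
  differentiation, hence smooth.\<close>

definition flat :: "real poly \<Rightarrow> real \<Rightarrow> real" where
  "flat p t = (if t > 0 then poly p (1 / t) * exp (- 1 / t) else 0)"

text \<open>The substitution x = 1 / t reduces this to the decay of a polynomial times exp(-x) at
  infinity.\<close>

lemma flat_limit: "(flat p \<longlongrightarrow> 0) (at_right 0)"
proof -
  have "((\<lambda>x. \<Sum>i\<le>degree p. coeff p i * (x ^ i / exp x)) \<longlongrightarrow> (\<Sum>i\<le>degree p. coeff p i * 0)) at_top"
    by (intro tendsto_intros tendsto_power_div_exp_0)
  then have "((\<lambda>x. poly p x * exp (- x)) \<longlongrightarrow> 0) at_top"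
    by (simp add: poly_altdef sum_distrib_right exp_minus divide_inverse mult.assoc)
  from filterlim_compose[OF this filterlim_inverse_at_top_right]
  have "((\<lambda>t. poly p (1 / t) * exp (- 1 / t)) \<longlongrightarrow> 0) (at_right 0)"
    by (simp add: inverse_eq_divide)
  moreover have "\<forall>\<^sub>F t in at_right 0. poly p (1 / t) * exp (- 1 / t) = flat p t"
    by (auto simp: eventually_at_filter flat_def)
  ultimately show ?thesis by (simp cong: filterlim_cong)
qed

text \<open>With x = 1 / t the inner derivative is - x^2, so differentiating P(x) exp(- x) gives x^2
  (P(x) - P'(x)) exp(- x); the two \<open>pCons 0\<close> are the factor x^2.\<close>

definition flat_deriv :: "real poly \<Rightarrow> real poly" where
  "flat_deriv p = pCons 0 (pCons 0 (p - pderiv p))"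

lemma has_real_derivative_flat: "(flat p has_real_derivative flat (flat_deriv p) t) (at t)"
proof -
  consider "t > 0" | "t < 0" | "t = 0" by linarith
  then show ?thesis
  proof cases
    case 1
    have "((\<lambda>t. poly p (1 / t) * exp (- 1 / t)) has_real_derivative flat (flat_deriv p) t) (at t)"
      using 1 by (auto intro!: derivative_eq_intros simp: flat_def flat_deriv_def field_simps power2_eq_square)
    then show ?thesis
      by (rule DERIV_cong_ev[OF refl _ refl, THEN iffD1, rotated])
        (use 1 in \<open>auto intro!: eventually_mono[OF eventually_nhds_in_open[of "{0<..}"]] simp: flat_def\<close>)
  next
    case 2
    have "((\<lambda>t. 0) has_real_derivative flat (flat_deriv p) t) (at t)"
      using 2 by (simp add: flat_def)
    then show ?thesis
      by (rule DERIV_cong_ev[OF refl _ refl, THEN iffD1, rotated])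
        (use 2 in \<open>auto intro!: eventually_mono[OF eventually_nhds_in_open[of "{..<0}"]] simp: flat_def\<close>)
  next
    case 3
    have "((\<lambda>h. (flat p (0 + h) - flat p 0) / h) \<longlongrightarrow> 0) (at 0)"
      unfolding filterlim_at_split
    proof
      have "((\<lambda>h. 0::real) \<longlongrightarrow> 0) (at_left 0)" by simp
      then show "((\<lambda>h. (flat p (0 + h) - flat p 0) / h) \<longlongrightarrow> 0) (at_left 0)"
        by (rule filterlim_cong[OF refl refl, THEN iffD1, rotated])
          (auto simp: flat_def eventually_at_filter)
      \<comment> \<open>The division by h is one more factor 1 / h in the polynomial, so the
        quotient is again a flat function.\<close>
      show "((\<lambda>h. (flat p (0 + h) - flat p 0) / h) \<longlongrightarrow> 0) (at_right 0)"
        using flat_limit[of "pCons 0 p"]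
        by (rule filterlim_cong[OF refl refl, THEN iffD1, rotated])
          (auto simp: flat_def eventually_at_filter)
    qed
    then show ?thesis using 3 by (simp add: DERIV_def flat_def)
  qed
qed

text \<open>Stated for compositions with affine functions and for all \<open>p\<close> at once, so
  that the induction closes: a directional derivative is a function of the same form times a
  constant.\<close>

lemma Ck_function_flat: "Ck_function k (\<lambda>x. flat p (x \<bullet> w + a))"
proof (induction k arbitrary: p)
  case 0
  have "continuous_on UNIV (flat p)"
    using has_real_derivative_flat DERIV_isCont continuous_at_imp_continuous_on by blast
  then show ?case
    by (auto intro!: continuous_on_compose2[of UNIV "flat p"] continuous_intros)
next
  case (Suc k)
  show ?case
  proof (rule Ck_function_SucI)
    fix x :: 'a
    have "(flat p has_derivative (*) (flat (flat_deriv p) (x \<bullet> w + a))) (at (x \<bullet> w + a))"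
      using has_real_derivative_flat by (simp add: has_field_derivative_def)
    moreover have "((\<lambda>x. x \<bullet> w + a) has_derivative (\<lambda>h. h \<bullet> w)) (at x)"
      by (auto intro!: derivative_eq_intros)
    ultimately show "((\<lambda>x. flat p (x \<bullet> w + a)) has_derivative
        (\<lambda>h. flat (flat_deriv p) (x \<bullet> w + a) * (h \<bullet> w))) (at x)"
      using has_derivative_compose by blast
    show "Ck_function k (\<lambda>x. flat (flat_deriv p) (x \<bullet> w + a) * (b \<bullet> w))" for b
      by (rule Ck_function_mult[OF Suc Ck_function_const])
  qed
qed

text \<open>Each factor is exp(-1 / ((n+1) s)) for the distance s to one face of the box and zero
  beyond that face. For growing \<open>n\<close> the product approaches the indicator of the open
  box from below, while its support stays in the closed box.\<close>

definition bump :: "nat \<Rightarrow> 'a::euclidean_space \<Rightarrow> 'a \<Rightarrow> 'a \<Rightarrow> real" where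
  "bump n l u x = (\<Prod>i\<in>Basis. flat 1 (Suc n * (x \<bullet> i - l \<bullet> i)) * flat 1 (Suc n * (u \<bullet> i - x \<bullet> i)))"

lemma flat_1_bounds: "0 \<le> flat 1 t" "flat 1 t \<le> 1"
  by (auto simp: flat_def)

lemma bump_bounds: "0 \<le> bump n l u x" "bump n l u x \<le> 1"
  unfolding bump_def using flat_1_bounds
  by (auto intro!: prod_nonneg prod_le_1 mult_le_one)

lemma bump_support: "{x. bump n l u x \<noteq> 0} \<subseteq> box l u"
proof
  fix x assume "x \<in> {x. bump n l u x \<noteq> 0}"
  then have "\<And>i. i \<in> Basis \<Longrightarrow> flat 1 (Suc n * (x \<bullet> i - l \<bullet> i)) \<noteq> 0 \<and> flat 1 (Suc n * (u \<bullet> i - x \<bullet> i)) \<noteq> 0"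
    by (auto simp: bump_def)
  then have "\<And>i. i \<in> Basis \<Longrightarrow> l \<bullet> i < x \<bullet> i \<and> x \<bullet> i < u \<bullet> i"
    by (force simp: flat_def zero_less_mult_iff split: if_splits)
  then show "x \<in> box l u" by (auto simp: box_def)
qed

lemma bump_limit: "(\<lambda>n. bump n l u x) \<longlonglongrightarrow> indicator (box l u) x"
proof (cases "x \<in> box l u")
  case True
  have *: "(\<lambda>n. flat 1 (Suc n * s)) \<longlonglongrightarrow> 1" if "s > 0" for s :: real
  proof -
    have "(\<lambda>n. exp (- (1 / s) * inverse (Suc n))) \<longlonglongrightarrow> exp (- (1 / s) * 0)"
      by (intro tendsto_intros LIMSEQ_inverse_real_of_nat)
    then show ?thesis using that by (simp add: flat_def divide_simps mult.commute)
  qed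
  have "(\<lambda>n. bump n l u x) \<longlonglongrightarrow> (\<Prod>i\<in>(Basis::'a set). 1 * 1)"
    unfolding bump_def using True by (intro tendsto_prod tendsto_mult *) (auto simp: box_def)
  then show ?thesis using True by simp
next
  case False
  then have "bump n l u x = 0" for n using bump_support by blast
  then show ?thesis using False by simp
qed

lemma bump_test_function:
  assumes "cbox l u \<subseteq> \<Omega>"
  shows "bump n l u \<in> test_functions \<Omega>"
proof -
  have cl: "closure {x. bump n l u x \<noteq> 0} \<subseteq> cbox l u"
    using bump_support[of n l u] box_subset_cbox[of l u] by (intro closure_minimal) auto
  have "Ck_function k (bump n l u)" for k
  proof -
    have e: "bump n l u = (\<lambda>x. \<Prod>i\<in>Basis. flat 1 (x \<bullet> (Suc n *\<^sub>R i) + (- Suc n * (l \<bullet> i)))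
        * flat 1 (x \<bullet> (- Suc n *\<^sub>R i) + (Suc n * (u \<bullet> i))))"
      by (simp add: fun_eq_iff bump_def algebra_simps)
    show ?thesis unfolding e by (intro Ck_function_prod Ck_function_mult Ck_function_flat)
  qed
  moreover have "compact (closure {x. bump n l u x \<noteq> 0})"
    using cl by (meson bounded_cbox bounded_subset closed_closure compact_eq_bounded_closed)
  ultimately show ?thesis using cl assms by (auto simp: test_functions_def)
qed

subsection \<open>Test functions and the fundamental lemma\<close>

lemma test_function_derivative:
  "\<phi> \<in> test_functions \<Omega> \<Longrightarrow> (\<phi> has_derivative frechet_derivative \<phi> (at x)) (at x)"
  unfolding test_functions_def
  by (drule CollectD, drule conjunct1, drule spec[of _ 1]) (simp add: frechet_derivative_works)

lemma test_function_Ck: "\<phi> \<in> test_functions \<Omega> \<Longrightarrow> Ck_function k \<phi>"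
  by (simp add: test_functions_def)

lemma test_function_continuous: "\<phi> \<in> test_functions \<Omega> \<Longrightarrow> continuous_on UNIV \<phi>"
  using test_function_Ck[of \<phi> \<Omega> 0] by simp

lemma test_function_continuous_deriv:
  "\<phi> \<in> test_functions \<Omega> \<Longrightarrow> b \<in> Basis \<Longrightarrow> continuous_on UNIV (\<lambda>x. frechet_derivative \<phi> (at x) b)"
  using test_function_Ck[of \<phi> \<Omega> 1] by simp

lemma test_function_support:
  assumes "\<phi> \<in> test_functions \<Omega>"
  shows "compact (closure {x. \<phi> x \<noteq> 0})" "closure {x. \<phi> x \<noteq> 0} \<subseteq> \<Omega>"
    and "x \<notin> closure {x. \<phi> x \<noteq> 0} \<Longrightarrow> \<phi> x = 0"
    and "x \<notin> closure {x. \<phi> x \<noteq> 0} \<Longrightarrow> frechet_derivative \<phi> (at x) h = 0"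
proof -
  let ?K = "closure {x. \<phi> x \<noteq> 0}"
  show "compact ?K" "?K \<subseteq> \<Omega>" using assms by (auto simp: test_functions_def)
  show "x \<notin> ?K \<Longrightarrow> \<phi> x = 0" using closure_subset[of "{x. \<phi> x \<noteq> 0}"] by blast
  assume x: "x \<notin> ?K"
  have "((\<lambda>x. 0) has_derivative (\<lambda>h. 0)) (at x)" by simp
  then have "(\<phi> has_derivative (\<lambda>h. 0)) (at x)"
  proof (rule has_derivative_transform_within_open)
    show "open (- ?K)" by (intro open_Compl closed_closure)
    show "x \<in> - ?K" using x by simp
    show "0 = \<phi> y" if "y \<in> - ?K" for y
      using that closure_subset[of "{x. \<phi> x \<noteq> 0}"] by auto
  qed
  then show "frechet_derivative \<phi> (at x) h = 0"
    using frechet_derivative_at by metis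
qed

lemma compact_support_bounded:
  fixes f :: "'a::euclidean_space \<Rightarrow> real"
  assumes "continuous_on UNIV f" "compact K" "\<And>x. x \<notin> K \<Longrightarrow> f x = 0"
  obtains B where "B > 0" "\<And>x. \<bar>f x\<bar> \<le> B"
proof -
  have "bounded (f ` K)"
    using assms by (intro compact_imp_bounded compact_continuous_image continuous_on_subset[OF assms(1)]) auto
  then obtain B where B: "\<And>x. x \<in> K \<Longrightarrow> \<bar>f x\<bar> \<le> B" by (auto simp: bounded_iff)
  show ?thesis
  proof (rule that[of "\<bar>B\<bar> + 1"])
    show "\<bar>f x\<bar> \<le> \<bar>B\<bar> + 1" for x using B[of x] assms(3)[of x] by (cases "x \<in> K") auto
  qed auto
qed

lemma test_function_bounded:
  assumes "\<phi> \<in> test_functions \<Omega>"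
  obtains B where "B > 0" "\<And>x. \<bar>\<phi> x\<bar> \<le> B"
  using compact_support_bounded[OF test_function_continuous[OF assms] test_function_support(1,3)[OF assms]] that by blast

lemma test_function_bounded_deriv:
  assumes "\<phi> \<in> test_functions \<Omega>" "b \<in> Basis"
  obtains B where "B > 0" "\<And>x. \<bar>frechet_derivative \<phi> (at x) b\<bar> \<le> B"
  using compact_support_bounded[OF test_function_continuous_deriv[OF assms] test_function_support(1,4)[OF assms(1)]] that by blast

text \<open>Open boxes form an intersection-stable generator of the Borel sets, and the Borel sets
  on which G has integral zero form a Dynkin system. So all Borel sets qualify, in particular those
  where G is positive or negative.\<close>

lemma AE_zero_if_integral_boxes_zero:
  fixes G :: "'a::euclidean_space \<Rightarrow> real"
  assumes G: "integrable lborel G"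
    and z: "\<And>l u. (\<integral>x. indicator (box l u) x * G x \<partial>lborel) = 0"
  shows "AE x in lborel. G x = 0"
proof -
  have [measurable]: "G \<in> borel_measurable borel" using G by auto
  have int: "integrable lborel (\<lambda>x. indicator S x * G x)" if "S \<in> sets borel" for S
    using G that by (simp add: integrable_real_mult_indicator mult.commute)
  \<comment> \<open>Closure under complements needs the integral over the whole space, which is
    reached by exhausting it with boxes.\<close>
  have total: "(\<integral>x. G x \<partial>lborel) = 0"
  proof -
    have "(\<lambda>n. \<integral>x. indicator (box (- real n *\<^sub>R One) (real n *\<^sub>R One)) x * G x \<partial>lborel) \<longlonglongrightarrow> (\<integral>x. G x \<partial>lborel)"
    proof (rule integral_dominated_convergence[where w="\<lambda>x. \<bar>G x\<bar>"])
      show "AE x in lborel. (\<lambda>n. indicator (box (- real n *\<^sub>R One) (real n *\<^sub>R One)) x * G x) \<longlonglongrightarrow> G x"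
      proof (intro AE_I2)
        fix x :: 'a
        obtain N :: nat where N: "norm x < N" using reals_Archimedean2 by blast
        have "x \<in> box (- real n *\<^sub>R One) (real n *\<^sub>R One)" if "n \<ge> N" for n
        proof -
          have "\<bar>x \<bullet> i\<bar> < n" if "i \<in> Basis" for i
            using Basis_le_norm[OF that, of x] N \<open>n \<ge> N\<close> by linarith
          then show ?thesis by (force simp: box_def abs_less_iff)
        qed
        then have "\<forall>\<^sub>F n in sequentially. indicator (box (- real n *\<^sub>R One) (real n *\<^sub>R One)) x * G x = G x"
          unfolding eventually_sequentially by (intro exI[of _ N]) auto
        then show "(\<lambda>n. indicator (box (- real n *\<^sub>R One) (real n *\<^sub>R One)) x * G x) \<longlonglongrightarrow> G x"
          by (rule tendsto_eventually)
      qed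
      show "AE x in lborel. norm (indicator (box (- real n *\<^sub>R One) (real n *\<^sub>R One)) x * G x) \<le> \<bar>G x\<bar>" for n
        by (intro AE_I2) (auto simp: indicator_def)
    qed (use G in auto)
    then show ?thesis by (simp add: z LIMSEQ_const_iff)
  qed
  have all: "(\<integral>x. indicator S x * G x \<partial>lborel) = 0" if "S \<in> sets borel" for S
  proof -
    have "Int_stable (range (\<lambda>(l, u). box l u :: 'a set))"
      by (auto simp: Int_stable_def box_Int_box)
    moreover have "range (\<lambda>(l, u). box l u :: 'a set) \<subseteq> Pow UNIV" by simp
    moreover have b: "sets borel = sigma_sets UNIV (range (\<lambda>(l, u). box l u :: 'a set))"
      by (simp add: borel_eq_box)
    then have "S \<in> sigma_sets UNIV (range (\<lambda>(l, u). box l u :: 'a set))" using that by simp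
    ultimately show ?thesis
    proof (induction rule: sigma_sets_induct_disjoint)
      case (basic A)
      then show ?case using z by auto
    next
      case empty
      then show ?case by simp
    next
      case (compl A)
      then have A: "A \<in> sets borel" using b by simp
      have "(\<integral>x. indicator (UNIV - A) x * G x \<partial>lborel) = (\<integral>x. G x - indicator A x * G x \<partial>lborel)"
        by (intro Bochner_Integration.integral_cong) (auto simp: indicator_def)
      also have "\<dots> = 0" using G int[OF A] compl total by simp
      finally show ?case .
    next
      case (union A)
      then have A: "A i \<in> sets borel" for i using b by auto
      have "(LINT x:(\<Union>i. A i)|lborel. G x) = (\<Sum>i. (LINT x:(A i)|lborel. G x))"
      proof (rule lebesgue_integral_countable_add)
        show "set_integrable lborel (\<Union>i. A i) G"
          using A int[of "\<Union>i. A i"] by (auto simp: set_integrable_def)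
      qed (use A union(1) in \<open>auto simp: disjoint_family_on_def\<close>)
      then show ?case using union(3) by (simp add: set_lebesgue_integral_def)
    qed
  qed
  have sign: "AE x in lborel. indicator S x * (c * G x) = 0"
    if "S \<in> sets borel" "\<And>x. x \<in> S \<Longrightarrow> 0 \<le> c * G x" for S c
  proof -
    have i: "integrable lborel (\<lambda>x. c * (indicator S x * G x))"
      using int[OF that(1)] by simp
    have "(\<integral>x. c * (indicator S x * G x) \<partial>lborel) = 0"
      using all[OF that(1)] by simp
    then have "AE x in lborel. c * (indicator S x * G x) = 0"
      using that(2) by (subst (asm) integral_nonneg_eq_0_iff_AE[OF i]) (auto simp: indicator_def)
    then show ?thesis by eventually_elim auto
  qed
  have pos: "AE x in lborel. indicator {x. G x > 0} x * (1 * G x) = 0"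
    by (rule sign) auto
  have neg: "AE x in lborel. indicator {x. G x < 0} x * (-1 * G x) = 0"
    by (rule sign) auto
  from pos neg show ?thesis
    by eventually_elim (simp add: indicator_def split: if_splits)
qed

text \<open>The bumps pass from test functions to boxes whose closure lies in
  \<open>\<Omega>\<close>. On one such box the function is cut off by the indicator, and since boxes
  intersect in boxes the previous lemma applies to it. By Lindelof countably many of these boxes
  cover \<open>\<Omega>\<close>.\<close>

lemma fundamental_lemma:
  fixes G :: "'a::euclidean_space \<Rightarrow> real"
  assumes "open \<Omega>" and G: "integrable lborel G"
    and z: "\<And>\<phi>. \<phi> \<in> test_functions \<Omega> \<Longrightarrow> (\<integral>x. G x * \<phi> x \<partial>lborel) = 0"
  shows "AE x in lborel. x \<in> \<Omega> \<longrightarrow> G x = 0"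
proof -
  have [measurable]: "G \<in> borel_measurable borel" using G by auto
  have box0: "(\<integral>x. indicator (box l u) x * G x \<partial>lborel) = 0" if lu: "cbox l u \<subseteq> \<Omega>" for l u
  proof -
    have m: "bump n l u \<in> borel_measurable borel" for n
      using test_function_continuous[OF bump_test_function[OF lu]] by (rule borel_measurable_continuous_onI)
    have "(\<lambda>n. \<integral>x. bump n l u x * G x \<partial>lborel) \<longlonglongrightarrow> (\<integral>x. indicator (box l u) x * G x \<partial>lborel)"
    proof (rule integral_dominated_convergence[where w="\<lambda>x. \<bar>G x\<bar>"])
      show "AE x in lborel. (\<lambda>n. bump n l u x * G x) \<longlonglongrightarrow> indicator (box l u) x * G x"
        by (intro AE_I2 tendsto_mult bump_limit tendsto_const)
      show "AE x in lborel. norm (bump n l u x * G x) \<le> \<bar>G x\<bar>" for n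
        using bump_bounds[of n l u] by (intro AE_I2) (auto simp: abs_mult intro!: mult_left_le_one_le)
    qed (use G m in auto)
    moreover have "(\<integral>x. bump n l u x * G x \<partial>lborel) = 0" for n
      using z[OF bump_test_function[OF lu]] by (simp add: mult.commute)
    ultimately show ?thesis by (simp add: LIMSEQ_const_iff)
  qed
  have AEbox: "AE x in lborel. x \<in> box l u \<longrightarrow> G x = 0" if lu: "cbox l u \<subseteq> \<Omega>" for l u
  proof -
    have "AE x in lborel. indicator (box l u) x * G x = 0"
    proof (rule AE_zero_if_integral_boxes_zero)
      show "integrable lborel (\<lambda>x. indicator (box l u) x * G x)"
        using G by (simp add: integrable_real_mult_indicator mult.commute)
      fix l' u'
      define a where "a = (\<Sum>i\<in>Basis. max (l' \<bullet> i) (l \<bullet> i) *\<^sub>R i)"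
      define b where "b = (\<Sum>i\<in>Basis. min (u' \<bullet> i) (u \<bullet> i) *\<^sub>R i)"
      have ab: "box l' u' \<inter> box l u = box a b" "cbox l' u' \<inter> cbox l u = cbox a b"
        by (simp_all add: a_def b_def box_Int_box Int_interval)
      have "(\<integral>x. indicator (box l' u') x * (indicator (box l u) x * G x) \<partial>lborel)
          = (\<integral>x. indicator (box a b) x * G x \<partial>lborel)"
        unfolding ab(1)[symmetric] by (intro Bochner_Integration.integral_cong) (auto simp: indicator_def)
      also have "\<dots> = 0" using lu ab(2) by (intro box0) blast
      finally show "(\<integral>x. indicator (box l' u') x * (indicator (box l u) x * G x) \<partial>lborel) = 0" .
    qed
    then show ?thesis by eventually_elim (auto simp: indicator_def)
  qed
  define F where "F = {box l u |l u. cbox l u \<subseteq> \<Omega>}"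
  obtain F' where F': "F' \<subseteq> F" "countable F'" "\<Union>F' = \<Union>F"
    by (rule Lindelof[of F]) (auto simp: F_def)
  have "\<Omega> \<subseteq> \<Union>F"
  proof
    fix x assume "x \<in> \<Omega>"
    then obtain a b where "cbox a b \<subseteq> \<Omega>" "x \<in> box a b"
      using open_contains_cbox[OF \<open>open \<Omega>\<close>] by metis
    then show "x \<in> \<Union>F" by (auto simp: F_def)
  qed
  moreover have "AE x in lborel. \<forall>B\<in>F'. x \<in> B \<longrightarrow> G x = 0"
    using F' AEbox by (subst AE_ball_countable) (auto simp: F_def)
  ultimately show ?thesis using F'(3) by (auto elim!: eventually_mono)
qed

subsection \<open>Translation in the mean and difference quotients\<close>

lemma integrable_translate:
  fixes f :: "'a::euclidean_space \<Rightarrow> real"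
  assumes "integrable lborel f"
  shows "integrable lborel (\<lambda>x. f (x + h))"
proof -
  have "integrable (distr lborel borel ((+) h)) f"
    using assms by (simp add: lborel_distr_plus)
  then have "integrable lborel (\<lambda>x. f (h + x))"
    by (subst (asm) integrable_distr_eq) (use assms in auto)
  then show ?thesis by (simp add: add.commute)
qed

lemma integral_translate:
  fixes f :: "'a::euclidean_space \<Rightarrow> real"
  assumes "f \<in> borel_measurable borel"
  shows "(\<integral>x. f (x + h) \<partial>lborel) = (\<integral>x. f x \<partial>lborel)"
proof -
  have "(\<integral>x. f x \<partial>lborel) = (\<integral>x. f x \<partial>distr lborel borel ((+) h))"
    by (simp add: lborel_distr_plus)
  also have "\<dots> = (\<integral>x. f (h + x) \<partial>lborel)"
    by (rule integral_distr) (use assms in auto)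
  finally show ?thesis by (simp add: add.commute)
qed

text \<open>For an indicator, A is squeezed between a compact K and an open U with U - K of small
  measure. Shifts too short to move K out of U change the indicator only on U - K or on a translate
  of it. Sums and dominated limits then follow by the triangle inequality and translation
  invariance.\<close>

lemma translation_continuous_L1:
  fixes f :: "'a::euclidean_space \<Rightarrow> real"
  assumes "integrable lborel f" "e > 0"
  shows "\<exists>d>0. \<forall>h. norm h < d \<longrightarrow> (\<integral>x. \<bar>f (x + h) - f x\<bar> \<partial>lborel) \<le> e"
  using assms
proof (induction arbitrary: e rule: integrable_induct)
  case (base A c)
  define k where "k = \<bar>c\<bar> + 1"
  have k: "k > 0" by (simp add: k_def)
  \<comment> \<open>The set \<open>D\<close> below has measure at most 2 r and occurs twice, once
    translated, so the total is k * 4 r = e / 2. The value \<open>k\<close> exceeds the absolute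
    value of \<open>c\<close> by one to stay positive.\<close>
  define r where "r = e / (8 * k)"
  have r: "r > 0" using base k by (simp add: r_def)
  have A: "A \<in> lmeasurable"
    using base by (auto simp: fmeasurable_def)
  obtain U where U: "open U" "A \<subseteq> U" "U - A \<in> lmeasurable" "emeasure lebesgue (U - A) < ennreal r"
    by (rule sets_lebesgue_outer_open[OF fmeasurableD[OF A] r])
  obtain F where F: "closed F" "F \<subseteq> A" "A - F \<in> lmeasurable" "emeasure lebesgue (A - F) < ennreal r"
    by (rule sets_lebesgue_inner_closed[OF fmeasurableD[OF A] r])
  have Fsets: "F \<in> sets lebesgue" using F(1) by (simp add: borel_closed sets_completionI_sets)
  \<comment> \<open>The inner approximation \<open>F\<close> is closed but perhaps unbounded;
    cutting it with large balls makes it compact, and continuity from above of the measure keeps the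
    loss below \<open>r\<close>.\<close>
  have "(\<lambda>n. emeasure lebesgue (A - F \<inter> cball 0 (real n))) \<longlonglongrightarrow> emeasure lebesgue (\<Inter>n::nat. A - F \<inter> cball 0 (real n))"
  proof (rule Lim_emeasure_decseq)
    show "range (\<lambda>n. A - F \<inter> cball 0 (real n)) \<subseteq> sets lebesgue"
      by (intro image_subsetI sets.Diff sets.Int fmeasurableD[OF A] Fsets fmeasurableD[OF lmeasurable_cball])
    show "decseq (\<lambda>n. A - F \<inter> cball 0 (real n))" by (auto simp: decseq_def)
    fix n :: nat
    have "emeasure lebesgue (A - F \<inter> cball 0 (real n)) \<le> emeasure lebesgue A"
      using A by (intro emeasure_mono) auto
    then show "emeasure lebesgue (A - F \<inter> cball 0 (real n)) \<noteq> \<infinity>"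
      using A by (auto simp: fmeasurable_def top_unique)
  qed
  moreover have "(\<Inter>n::nat. A - F \<inter> cball 0 (real n)) = A - F"
    using reals_Archimedean2 by (auto simp: real_arch_simple)
  ultimately have "\<forall>\<^sub>F n in sequentially. emeasure lebesgue (A - F \<inter> cball 0 (real n)) < ennreal r"
    using F(4) by (intro order_tendstoD(2)) auto
  then obtain n :: nat where n: "emeasure lebesgue (A - F \<inter> cball 0 (real n)) < ennreal r"
    by (auto simp: eventually_sequentially)
  define K where "K = F \<inter> cball 0 (real n)"
  have K: "compact K" "K \<subseteq> A" unfolding K_def using F by (auto intro: closed_Int_compact)
  have Kl: "K \<in> lmeasurable" using K(1) by (rule lmeasurable_compact)
  define D where "D = U - K"
  have Db: "D \<in> sets borel" unfolding D_def using U(1) K(1) by (intro sets.Diff) (auto simp: compact_imp_closed)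
  have Deq: "D = (U - A) \<union> (A - K)" unfolding D_def using U(2) K(2) by auto
  have Kc: "A - K \<in> sets lebesgue" using A Kl by auto
  have "emeasure lebesgue D \<le> emeasure lebesgue (U - A) + emeasure lebesgue (A - K)"
    unfolding Deq using U(3) Kc by (intro emeasure_subadditive) auto
  also have "\<dots> \<le> ennreal r + ennreal r"
    using U(4) n by (intro add_mono) (auto simp: K_def)
  also have "\<dots> = ennreal (2 * r)" using r by (simp add: ennreal_plus[symmetric] del: ennreal_plus)
  finally have eD: "emeasure lborel D \<le> ennreal (2 * r)" using Db by simp
  have iD: "integrable lborel (indicator D :: _ \<Rightarrow> real)"
    using Db eD by (intro integrable_real_indicator) (auto simp: le_less_trans)
  have ID: "(\<integral>x. indicator D x \<partial>lborel) \<le> 2 * r"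
    using eD Db r by (simp add: measure_def enn2real_leI)
  obtain d where d: "d > 0" "(\<Union>x\<in>K. ball x d) \<subseteq> U"
    by (rule compact_subset_open_imp_ball_epsilon_subset[OF K(1) U(1)]) (use K U in auto)
  show ?case
  proof (intro exI[of _ d] conjI allI impI)
    fix h :: 'a assume h: "norm h < d"
    have near: "x + h \<in> U" if "x \<in> K" for x
    proof -
      have "x + h \<in> ball x d" using h by (simp add: dist_norm)
      then show ?thesis using d that by blast
    qed
    have near': "x \<in> U" if "x + h \<in> K" for x
    proof -
      have "x \<in> ball (x + h) d" using h by (simp add: dist_norm)
      then show ?thesis using d that by blast
    qed
    have pt: "\<bar>indicator A (x + h) *\<^sub>R c - indicator A x *\<^sub>R c\<bar>
        \<le> k * (indicator D x + indicator D (x + h))" for x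
      using near[of x] near'[of x] K(2) U(2) k
      by (auto simp: indicator_def D_def k_def)
    have i2: "integrable lborel (\<lambda>x. indicator D (x + h) :: real)"
      by (rule integrable_translate[OF iD])
    have "(\<integral>x. \<bar>indicator A (x + h) *\<^sub>R c - indicator A x *\<^sub>R c\<bar> \<partial>lborel)
        \<le> (\<integral>x. k * (indicator D x + indicator D (x + h)) \<partial>lborel)"
    proof (rule integral_mono)
      have iA: "integrable lborel (\<lambda>x. indicator A x *\<^sub>R c)"
        using base by (intro integrable_scaleR_left) auto
      show "integrable lborel (\<lambda>x. \<bar>indicator A (x + h) *\<^sub>R c - indicator A x *\<^sub>R c\<bar>)"
        using integrable_translate[OF iA, of h] iA by (intro integrable_abs Bochner_Integration.integrable_diff)
    qed (use iD i2 pt in auto)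
    also have "\<dots> = k * ((\<integral>x. indicator D x \<partial>lborel) + (\<integral>x. indicator D (x + h) \<partial>lborel))"
      using iD i2 by simp
    also have "(\<integral>x. indicator D (x + h) \<partial>lborel) = (\<integral>x. indicator D x \<partial>lborel :: real)"
      by (rule integral_translate) (use Db in auto)
    also have "k * ((\<integral>x. indicator D x \<partial>lborel) + (\<integral>x. indicator D x \<partial>lborel)) \<le> k * (2 * r + 2 * r)"
      using ID k by (intro mult_left_mono add_mono) auto
    also have "\<dots> \<le> e" using k base by (simp add: r_def)
    finally show "(\<integral>x. \<bar>indicator A (x + h) *\<^sub>R c - indicator A x *\<^sub>R c\<bar> \<partial>lborel) \<le> e" .
  qed (use d in simp)
next
  case (add f g)
  obtain d1 where d1: "d1 > 0" "\<And>h. norm h < d1 \<Longrightarrow> (\<integral>x. \<bar>f (x + h) - f x\<bar> \<partial>lborel) \<le> e / 2"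
    using add(3)[of "e/2"] add(5) by auto
  obtain d2 where d2: "d2 > 0" "\<And>h. norm h < d2 \<Longrightarrow> (\<integral>x. \<bar>g (x + h) - g x\<bar> \<partial>lborel) \<le> e / 2"
    using add(4)[of "e/2"] add(5) by auto
  show ?case
  proof (intro exI[of _ "min d1 d2"] conjI allI impI)
    fix h :: 'a assume h: "norm h < min d1 d2"
    have i: "integrable lborel (\<lambda>x. \<bar>f (x + h) - f x\<bar>)" "integrable lborel (\<lambda>x. \<bar>g (x + h) - g x\<bar>)"
      using integrable_translate[OF add(1)] integrable_translate[OF add(2)] add(1,2) by simp_all
    have "(\<integral>x. \<bar>f (x + h) + g (x + h) - (f x + g x)\<bar> \<partial>lborel)
        \<le> (\<integral>x. \<bar>f (x + h) - f x\<bar> + \<bar>g (x + h) - g x\<bar> \<partial>lborel)"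
      using i add integrable_translate[of f h] integrable_translate[of g h] by (intro integral_mono) auto
    also have "\<dots> \<le> e" using i d1(2)[of h] d2(2)[of h] h by simp
    finally show "(\<integral>x. \<bar>f (x + h) + g (x + h) - (f x + g x)\<bar> \<partial>lborel) \<le> e" .
  qed (use d1 d2 in simp)
next
  case (lim f s)
  have fm [measurable]: "f \<in> borel_measurable borel" "s i \<in> borel_measurable borel" for i
    using lim by auto
  have "(\<lambda>i. \<integral>x. \<bar>s i x - f x\<bar> \<partial>lborel) \<longlonglongrightarrow> (\<integral>x. 0 \<partial>(lborel::'a measure))"
  proof (rule integral_dominated_convergence[where w="\<lambda>x. 3 * \<bar>f x\<bar>"])
    show "AE x in lborel. (\<lambda>i. \<bar>s i x - f x\<bar>) \<longlonglongrightarrow> 0"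
      using lim(2) by (intro AE_I2 tendsto_rabs_zero LIM_zero) auto
    show "AE x in lborel. norm \<bar>s i x - f x\<bar> \<le> 3 * \<bar>f x\<bar>" for i
    proof (intro AE_I2)
      fix x show "norm \<bar>s i x - f x\<bar> \<le> 3 * \<bar>f x\<bar>" using lim(3)[of x i] by simp
    qed
  qed (use lim in auto)
  then obtain i where i: "(\<integral>x. \<bar>s i x - f x\<bar> \<partial>lborel) < e / 4"
    using order_tendstoD(2)[of _ 0 sequentially "e/4"] lim(6) by (auto simp: eventually_sequentially)
  obtain d where d: "d > 0" "\<And>h. norm h < d \<Longrightarrow> (\<integral>x. \<bar>s i (x + h) - s i x\<bar> \<partial>lborel) \<le> e / 4"
    using lim(5)[of "e/4" i] lim(6) by auto
  show ?case
  proof (intro exI[of _ d] conjI allI impI)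
    fix h :: 'a assume h: "norm h < d"
    have tr: "integrable lborel (\<lambda>x. f (x + h))" "integrable lborel (\<lambda>x. s i (x + h))"
      using integrable_translate[OF lim(4)] integrable_translate[OF lim(1)] by simp_all
    have "(\<integral>x. \<bar>f (x + h) - f x\<bar> \<partial>lborel)
      \<le> (\<integral>x. \<bar>s i (x + h) - f (x + h)\<bar> + \<bar>s i x - f x\<bar> + \<bar>s i (x + h) - s i x\<bar> \<partial>lborel)"
      using lim tr by (intro integral_mono) auto
    also have "\<dots> = (\<integral>x. \<bar>s i (x + h) - f (x + h)\<bar> \<partial>lborel) + (\<integral>x. \<bar>s i x - f x\<bar> \<partial>lborel)
        + (\<integral>x. \<bar>s i (x + h) - s i x\<bar> \<partial>lborel)"
      using lim tr by simp
    also have "(\<integral>x. \<bar>s i (x + h) - f (x + h)\<bar> \<partial>lborel) = (\<integral>x. \<bar>s i x - f x\<bar> \<partial>lborel)"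
      by (rule integral_translate[of "\<lambda>x. \<bar>s i x - f x\<bar>"]) simp
    finally show "(\<integral>x. \<bar>f (x + h) - f x\<bar> \<partial>lborel) \<le> e" using i d(2)[OF h] lim(6) by simp
  qed (use d in simp)
qed

text \<open>The uniform bound on the L^1 norms over an interval of finite length is what makes the
  joint function integrable on the product.\<close>

lemma Fubini_interval:
  fixes f :: "real \<Rightarrow> 'a::euclidean_space \<Rightarrow> real"
  assumes m: "case_prod f \<in> borel_measurable borel"
    and i: "\<And>s. s \<in> {0..h} \<Longrightarrow> integrable lborel (f s)"
    and b: "\<And>s. s \<in> {0..h} \<Longrightarrow> (\<integral>x. \<bar>f s x\<bar> \<partial>lborel) \<le> C"
  shows "(\<integral>x. (\<integral>s. indicator {0..h} s * f s x \<partial>lborel) \<partial>lborel)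
      = (\<integral>s. indicator {0..h} s * (\<integral>x. f s x \<partial>lborel) \<partial>lborel)"
    and "integrable lborel (\<lambda>x. \<integral>s. indicator {0..h} s * f s x \<partial>lborel)"
    and "integrable (lborel \<Otimes>\<^sub>M lborel) (\<lambda>(s, x). indicator {0..h} s * f s x)"
proof -
  let ?g = "\<lambda>s x. indicator {0..h} s * f s x"
  have mp [measurable]: "case_prod f \<in> borel_measurable (lborel \<Otimes>\<^sub>M lborel)"
    using m by (simp add: lborel_prod)
  have int: "integrable (lborel \<Otimes>\<^sub>M lborel) (case_prod ?g)"
  proof (rule lborel_pair.Fubini_integrable)
    show "case_prod ?g \<in> borel_measurable (lborel \<Otimes>\<^sub>M lborel)" by measurable
    show "AE s in lborel. integrable lborel (\<lambda>x. case (s, x) of (s, x) \<Rightarrow> ?g s x)"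
    proof (intro AE_I2)
      fix s :: real show "integrable lborel (\<lambda>x. case (s, x) of (s, x) \<Rightarrow> ?g s x)"
        using i[of s] by (cases "s \<in> {0..h}") auto
    qed
    show "integrable lborel (\<lambda>s. \<integral>x. norm (case (s, x) of (s, x) \<Rightarrow> ?g s x) \<partial>lborel)"
    proof (rule Bochner_Integration.integrable_bound)
      show "integrable lborel (\<lambda>s. indicator {0..h} s * C :: real)"
        by (intro integrable_mult_left integrable_real_indicator) (auto simp: emeasure_lborel_Icc_eq)
      show "AE s in lborel. norm (\<integral>x. norm (case (s, x) of (s, x) \<Rightarrow> ?g s x) \<partial>lborel) \<le> norm (indicator {0..h} s * C)"
      proof (intro AE_I2)
        fix s :: real
        show "norm (\<integral>x. norm (case (s, x) of (s, x) \<Rightarrow> ?g s x) \<partial>lborel) \<le> norm (indicator {0..h} s * C)"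
          using b[of s] by (cases "s \<in> {0..h}") auto
      qed
    qed measurable
  qed
  then show "integrable (lborel \<Otimes>\<^sub>M lborel) (case_prod ?g)" .
  show "(\<integral>x. (\<integral>s. ?g s x \<partial>lborel) \<partial>lborel) = (\<integral>s. indicator {0..h} s * (\<integral>x. f s x \<partial>lborel) \<partial>lborel)"
    using lborel_pair.Fubini_integral[OF int] by simp
  show "integrable lborel (\<lambda>x. \<integral>s. ?g s x \<partial>lborel)"
    using lborel_pair.integrable_snd[OF int] by simp
qed

lemma frechet_derivative_translate:
  assumes "\<And>x. (f has_derivative frechet_derivative f (at x)) (at x)"
  shows "frechet_derivative (\<lambda>x. f (x - c)) (at x) = frechet_derivative f (at (x - c))"
proof -
  have "((\<lambda>x. f (x - c)) has_derivative (\<lambda>h. frechet_derivative f (at (x - c)) h)) (at x)"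
    by (rule has_derivative_compose[of "\<lambda>x. x - c" "\<lambda>h. h", OF _ assms]) (auto intro!: derivative_eq_intros)
  from frechet_derivative_at[OF this] show ?thesis by simp
qed

lemma Ck_function_translate: "Ck_function k f \<Longrightarrow> Ck_function k (\<lambda>x. f (x - c))"
proof (induction k arbitrary: f)
  case 0
  then show ?case by (auto intro!: continuous_intros continuous_on_compose2[of UNIV f])
next
  case (Suc k)
  then have d: "(f has_derivative frechet_derivative f (at x)) (at x)" for x
    by (simp add: frechet_derivative_works)
  show ?case
  proof (rule Ck_function_SucI)
    show "((\<lambda>x. f (x - c)) has_derivative (\<lambda>h. frechet_derivative f (at (x - c)) h)) (at x)" for x
      by (rule has_derivative_compose[of "\<lambda>x. x - c" "\<lambda>h. h", OF _ d]) (auto intro!: derivative_eq_intros)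
    show "Ck_function k (\<lambda>x. frechet_derivative f (at (x - c)) b)" if "b \<in> Basis" for b
      using that Suc.prems Suc.IH[of "\<lambda>x. frechet_derivative f (at x) b"] by auto
  qed
qed

lemma test_function_translate:
  assumes "\<phi> \<in> test_functions U" "\<And>x. x \<in> U \<Longrightarrow> x + c \<in> \<Omega>"
  shows "(\<lambda>x. \<phi> (x - c)) \<in> test_functions \<Omega>"
proof -
  have "{x. \<phi> (x - c) \<noteq> 0} = (+) c ` {x. \<phi> x \<noteq> 0}"
    by (force simp: image_iff intro: exI[of _ "_ - c"])
  then have cl: "closure {x. \<phi> (x - c) \<noteq> 0} = (+) c ` closure {x. \<phi> x \<noteq> 0}"
    by (simp add: closure_translation)
  have "compact ((+) c ` closure {x. \<phi> x \<noteq> 0})"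
    using assms(1) by (intro compact_translation) (auto simp: test_functions_def)
  moreover have "(+) c ` closure {x. \<phi> x \<noteq> 0} \<subseteq> \<Omega>"
    using assms by (auto simp: test_functions_def add.commute)
  ultimately show ?thesis
    using assms(1) by (simp add: test_functions_def cl Ck_function_translate del: compact_closure)
qed

lemma has_derivative_along_line:
  assumes "\<And>x. (f has_derivative frechet_derivative f (at x)) (at x)"
  shows "((\<lambda>s. f (x + s *\<^sub>R b)) has_real_derivative frechet_derivative f (at (x + s *\<^sub>R b)) b) (at s)"
proof -
  let ?F = "frechet_derivative f (at (x + s *\<^sub>R b))"
  have l: "linear ?F" using assms by (meson has_derivative_linear)
  have "((\<lambda>s. f (x + s *\<^sub>R b)) has_derivative (\<lambda>h. ?F (h *\<^sub>R b))) (at s)"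
    by (rule has_derivative_compose[of "\<lambda>s. x + s *\<^sub>R b" "\<lambda>h. h *\<^sub>R b", OF _ assms])
      (auto intro!: derivative_eq_intros)
  moreover have "(\<lambda>h. ?F (h *\<^sub>R b)) = (*) (?F b)"
    using linear_scale[OF l] by (auto simp: mult.commute)
  ultimately show ?thesis by (simp add: has_field_derivative_def)
qed

lemma test_function_difference_integral:
  assumes \<phi>: "\<phi> \<in> test_functions U" and b: "b \<in> Basis" and h: "0 \<le> h"
  shows "(\<integral>s. indicator {0..h} s * frechet_derivative \<phi> (at (x - s *\<^sub>R b)) b \<partial>lborel) = \<phi> x - \<phi> (x - h *\<^sub>R b)"
proof -
  let ?d = "\<lambda>s. frechet_derivative \<phi> (at (x - s *\<^sub>R b)) b"
  have "(LBINT s. indicator {0..h} s *\<^sub>R ?d s) = - \<phi> (x - h *\<^sub>R b) - - \<phi> (x - 0 *\<^sub>R b)"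
  proof (rule integral_FTC_atLeastAtMost[OF h])
    fix s
    have "((\<lambda>s. \<phi> (x + s *\<^sub>R (-b))) has_real_derivative frechet_derivative \<phi> (at (x + s *\<^sub>R (-b))) (- b)) (at s)"
      using test_function_derivative[OF \<phi>] by (rule has_derivative_along_line)
    moreover have "frechet_derivative \<phi> (at y) (- b) = - frechet_derivative \<phi> (at y) b" for y
      using linear_neg[OF has_derivative_linear[OF test_function_derivative[OF \<phi>]]] .
    ultimately have "((\<lambda>s. - \<phi> (x - s *\<^sub>R b)) has_real_derivative ?d s) (at s)"
      using DERIV_minus by fastforce
    then show "((\<lambda>s. - \<phi> (x - s *\<^sub>R b)) has_vector_derivative ?d s) (at s within {0..h})"
      by (meson has_field_derivative_at_within has_real_derivative_iff_has_vector_derivative)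
  next
    show "continuous_on {0..h} ?d"
      by (rule continuous_on_compose2[OF test_function_continuous_deriv[OF \<phi> b]]) (auto intro!: continuous_intros)
  qed
  then show ?thesis by simp
qed

lemma test_function_lipschitz:
  assumes \<phi>: "\<phi> \<in> test_functions U" and b: "b \<in> Basis"
  obtains B where "B > 0" "\<And>x h. 0 \<le> h \<Longrightarrow> \<bar>\<phi> (x - h *\<^sub>R b) - \<phi> x\<bar> \<le> B * h"
proof -
  obtain B where B: "B > 0" "\<And>x. \<bar>frechet_derivative \<phi> (at x) b\<bar> \<le> B"
    by (rule test_function_bounded_deriv[OF \<phi> b]) blast
  have "\<bar>\<phi> (x - h *\<^sub>R b) - \<phi> x\<bar> \<le> B * h" if "0 \<le> h" for x h
  proof -
    have "norm (\<phi> (x + (-h) *\<^sub>R b) - \<phi> (x + 0 *\<^sub>R b)) \<le> B * norm (-h - 0)"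
      by (rule field_differentiable_bound[of UNIV, OF _ has_field_derivative_at_within[OF
            has_derivative_along_line[OF test_function_derivative[OF \<phi>]]]]) (use B in auto)
    then show ?thesis using that by simp
  qed
  with B show ?thesis using that by blast
qed

text \<open>Replaces the usual smooth approximation of V by difference quotients. Near the support
  of the test function the quotients of V in direction b are averages of g over short segments,
  hence converge to g in L^1. The quotients of G(V) are these times a bounded factor tending to
  G'(V), and a change of variables moves the quotient of G(V) onto the test function.\<close>

lemma weak_derivative_chain_lborel:
  fixes V g :: "'a::euclidean_space \<Rightarrow> real" and G G' :: "real \<Rightarrow> real"
  assumes \<Omega>: "open \<Omega>" "bounded \<Omega>" and V: "integrable lborel V" and g: "integrable lborel g"
    and b: "b \<in> Basis"
    and weak: "\<And>\<phi>. \<phi> \<in> test_functions \<Omega> \<Longrightarrow>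
        (\<integral>x. V x * frechet_derivative \<phi> (at x) b \<partial>lborel) = - (\<integral>x. g x * \<phi> x \<partial>lborel)"
    and G: "\<And>s. (G has_real_derivative G' s) (at s)" and G'c: "continuous_on UNIV G'"
    and L: "\<And>s. \<bar>G' s\<bar> \<le> L"
    and \<phi>: "\<phi> \<in> test_functions \<Omega>"
  shows "(\<integral>x. G (V x) * frechet_derivative \<phi> (at x) b \<partial>lborel) = - (\<integral>x. G' (V x) * g x * \<phi> x \<partial>lborel)"
proof -
  have [measurable]: "\<Omega> \<in> sets borel" using \<Omega>(1) by simp
  have [measurable]: "V \<in> borel_measurable borel" "g \<in> borel_measurable borel" using V g by auto
  have [measurable]: "G' \<in> borel_measurable borel"
    using G'c by (rule borel_measurable_continuous_onI)
  have "continuous_on UNIV G"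
    using G DERIV_isCont continuous_at_imp_continuous_on by blast
  then have [measurable]: "G \<in> borel_measurable borel" by (rule borel_measurable_continuous_onI)
  have meas_test [measurable]: "\<zeta> \<in> borel_measurable borel" if "\<zeta> \<in> test_functions U" for \<zeta> :: "'a \<Rightarrow> real" and U
    using test_function_continuous[OF that] by (rule borel_measurable_continuous_onI)
  have meas_deriv: "(\<lambda>x. frechet_derivative \<zeta> (at x) b) \<in> borel_measurable borel" if "\<zeta> \<in> test_functions U" for \<zeta> :: "'a \<Rightarrow> real" and U
    using test_function_continuous_deriv[OF that b] by (rule borel_measurable_continuous_onI)
  have L0: "0 \<le> L" using L[of 0] by linarith
  have Glip: "\<bar>G y - G x\<bar> \<le> L * \<bar>y - x\<bar>" for x y
    using field_differentiable_bound[of UNIV G G' L y x] G L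
    by (auto intro: has_field_derivative_at_within)
  define K where "K = closure {x. \<phi> x \<noteq> 0}"
  have K: "compact K" "K \<subseteq> \<Omega>" "\<And>x. x \<notin> K \<Longrightarrow> \<phi> x = 0"
    unfolding K_def by (fact test_function_support[OF \<phi>])+
  obtain r where r: "r > 0" "(\<Union>x\<in>K. ball x r) \<subseteq> \<Omega>"
    by (rule compact_subset_open_imp_ball_epsilon_subset[OF K(1) \<Omega>(1) K(2)])
  \<comment> \<open>Half of the safety distance \<open>r\<close> goes into the neighbourhood
    \<open>U\<close> of the support, the other half into the shifts: a point of \<open>U\<close>
    moved by at most r / 2 stays in \<open>\<Omega>\<close>.\<close>
  define U where "U = (\<Union>x\<in>K. ball x (r / 2))"
  have KU: "K \<subseteq> U" using r by (auto simp: U_def)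
  have openU: "open U" by (auto simp: U_def)
  have nb: "norm b = 1" using b by simp
  have shiftU: "x + s *\<^sub>R b \<in> \<Omega>" if x: "x \<in> U" and s: "0 \<le> s" "s \<le> r / 2" for x s
  proof -
    obtain y where y: "y \<in> K" "dist y x < r / 2" using x by (auto simp: U_def)
    have "dist y (x + s *\<^sub>R b) \<le> dist y x + dist x (x + s *\<^sub>R b)" by (rule dist_triangle)
    also have "dist x (x + s *\<^sub>R b) = s" using s nb by (simp add: dist_norm)
    finally have "x + s *\<^sub>R b \<in> ball y r" using y s by simp
    then show ?thesis using y r by blast
  qed

  \<comment> \<open>Differences of V as integrals of g along segments\<close>
  define I where "I h x = (\<integral>s. indicator {0..h} s * g (x + s *\<^sub>R b) \<partial>lborel)" for h x
  have gt: "integrable lborel (\<lambda>x. g (x + s *\<^sub>R b))" for s using integrable_translate[OF g] .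
  have Vt: "integrable lborel (\<lambda>x. V (x + s *\<^sub>R b))" for s using integrable_translate[OF V] .
  have abs_g: "(\<integral>x. \<bar>g (x + s *\<^sub>R b)\<bar> \<partial>lborel) = (\<integral>x. \<bar>g x\<bar> \<partial>lborel)" for s
    by (rule integral_translate[of "\<lambda>x. \<bar>g x\<bar>"]) simp
  have joint: "(\<lambda>(s, x). w (x + s *\<^sub>R b)) \<in> borel_measurable (borel :: (real \<times> 'a) measure)"
      "(\<lambda>(s, x). w (x - s *\<^sub>R b)) \<in> borel_measurable (borel :: (real \<times> 'a) measure)"
      "(\<lambda>(s, x). w x) \<in> borel_measurable (borel :: (real \<times> 'a) measure)"
    if "w \<in> borel_measurable borel" for w :: "'a \<Rightarrow> real"
    unfolding split_beta
    by (intro measurable_compose[OF _ that] borel_measurable_continuous_onI continuous_intros)+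
  have I_int: "integrable lborel (I h)" for h
    unfolding I_def by (rule Fubini_interval(2)[where C="\<integral>x. \<bar>g x\<bar> \<partial>lborel", OF joint(1) gt])
      (simp_all add: abs_g)
  \<comment> \<open>Tested with \<open>\<zeta>\<close> supported in \<open>U\<close>: every
    translate of \<open>\<zeta>\<close> by s b is a test function on \<open>\<Omega>\<close>, so the
    weak equation holds for each s. Fubini brings the integral over s onto the derivative of
    \<open>\<zeta>\<close>, where the fundamental theorem of calculus evaluates it.\<close>
  have diff_eq: "AE x in lborel. x \<in> U \<longrightarrow> V (x + h *\<^sub>R b) - V x - I h x = 0" if h: "0 \<le> h" "h \<le> r / 2" for h
  proof (rule fundamental_lemma[OF openU])
    show "integrable lborel (\<lambda>x. V (x + h *\<^sub>R b) - V x - I h x)"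
      using Vt V I_int by (intro Bochner_Integration.integrable_diff)
    fix \<zeta> :: "'a \<Rightarrow> real" assume \<zeta>: "\<zeta> \<in> test_functions U"
    note [measurable] = meas_test[OF \<zeta>] meas_deriv[OF \<zeta>]
    obtain B where B: "B > 0" "\<And>x. \<bar>\<zeta> x\<bar> \<le> B" by (rule test_function_bounded[OF \<zeta>]) blast
    obtain B' where B': "B' > 0" "\<And>x. \<bar>frechet_derivative \<zeta> (at x) b\<bar> \<le> B'"
      by (rule test_function_bounded_deriv[OF \<zeta> b]) blast
    have mb: "integrable lborel (\<lambda>x. w x * k x)" if "integrable lborel w" "k \<in> borel_measurable borel" "\<And>x. \<bar>k x\<bar> \<le> C"
      for w k :: "'a \<Rightarrow> real" and C
    proof (rule Bochner_Integration.integrable_bound[of _ "\<lambda>x. C * w x"])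
      show "(\<lambda>x. w x * k x) \<in> borel_measurable lborel" using that by auto
      show "AE x in lborel. norm (w x * k x) \<le> norm (C * w x)"
      proof (intro AE_I2)
        fix x show "norm (w x * k x) \<le> norm (C * w x)"
          using that(3)[of x] by (simp add: abs_mult mult.commute mult_right_mono)
      qed
    qed (use that in simp)
    have shift: "(\<lambda>x. \<zeta> (x - s *\<^sub>R b)) \<in> test_functions \<Omega>" if "s \<in> {0..h}" for s
      using that h by (intro test_function_translate[OF \<zeta>] shiftU) auto
    have fd: "frechet_derivative (\<lambda>x. \<zeta> (x - s *\<^sub>R b)) (at x) = frechet_derivative \<zeta> (at (x - s *\<^sub>R b))" for s x
      by (rule frechet_derivative_translate[OF test_function_derivative[OF \<zeta>]])
    have tr: "(\<integral>x. w (x + s *\<^sub>R b) * \<zeta> x \<partial>lborel) = (\<integral>x. w x * \<zeta> (x - s *\<^sub>R b) \<partial>lborel)"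
      if "w \<in> borel_measurable borel" for w s
      using integral_translate[of "\<lambda>x. w x * \<zeta> (x - s *\<^sub>R b)" "s *\<^sub>R b"] that by simp
    have gz: "integrable lborel (\<lambda>x. g (x + s *\<^sub>R b) * \<zeta> x)" for s
      by (rule mb[OF gt _ B(2)]) simp
    have "(\<integral>x. I h x * \<zeta> x \<partial>lborel) = (\<integral>x. (\<integral>s. indicator {0..h} s * (g (x + s *\<^sub>R b) * \<zeta> x) \<partial>lborel) \<partial>lborel)"
      unfolding I_def by (simp flip: mult.assoc)
    also have "\<dots> = (\<integral>s. indicator {0..h} s * (\<integral>x. g (x + s *\<^sub>R b) * \<zeta> x \<partial>lborel) \<partial>lborel)"
    proof (rule Fubini_interval(1))
      show "(\<lambda>(s, x). g (x + s *\<^sub>R b) * \<zeta> x) \<in> borel_measurable borel"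
        using borel_measurable_times[OF joint(1)[of g] joint(3)[of \<zeta>]] by (simp add: split_beta)
      show "(\<integral>x. \<bar>g (x + s *\<^sub>R b) * \<zeta> x\<bar> \<partial>lborel) \<le> B * (\<integral>x. \<bar>g x\<bar> \<partial>lborel)" for s
      proof -
        have "(\<integral>x. \<bar>g (x + s *\<^sub>R b) * \<zeta> x\<bar> \<partial>lborel) \<le> (\<integral>x. B * \<bar>g (x + s *\<^sub>R b)\<bar> \<partial>lborel)"
        proof (rule integral_mono[OF integrable_abs[OF gz]])
          fix x show "\<bar>g (x + s *\<^sub>R b) * \<zeta> x\<bar> \<le> B * \<bar>g (x + s *\<^sub>R b)\<bar>"
            using mult_left_mono[OF B(2)[of x] abs_ge_zero[of "g (x + s *\<^sub>R b)"]] by (simp add: abs_mult mult.commute)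
        qed (use gt[of s] in simp)
        then show ?thesis by (simp add: abs_g)
      qed
    qed (rule gz)
    also have "\<dots> = (\<integral>s. indicator {0..h} s * - (\<integral>x. V x * frechet_derivative \<zeta> (at (x - s *\<^sub>R b)) b \<partial>lborel) \<partial>lborel)"
    proof (rule Bochner_Integration.integral_cong[OF refl])
      fix s :: real
      show "indicator {0..h} s * (\<integral>x. g (x + s *\<^sub>R b) * \<zeta> x \<partial>lborel)
        = indicator {0..h} s * - (\<integral>x. V x * frechet_derivative \<zeta> (at (x - s *\<^sub>R b)) b \<partial>lborel)"
        using weak[OF shift, of s] by (cases "s \<in> {0..h}") (auto simp: tr fd)
    qed
    also have "\<dots> = - (\<integral>s. indicator {0..h} s * (\<integral>x. V x * frechet_derivative \<zeta> (at (x - s *\<^sub>R b)) b \<partial>lborel) \<partial>lborel)"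
      by simp
    also have "(\<integral>s. indicator {0..h} s * (\<integral>x. V x * frechet_derivative \<zeta> (at (x - s *\<^sub>R b)) b \<partial>lborel) \<partial>lborel)
        = (\<integral>x. (\<integral>s. indicator {0..h} s * (V x * frechet_derivative \<zeta> (at (x - s *\<^sub>R b)) b) \<partial>lborel) \<partial>lborel)"
    proof (rule Fubini_interval(1)[symmetric])
      show "(\<lambda>(s, x). V x * frechet_derivative \<zeta> (at (x - s *\<^sub>R b)) b) \<in> borel_measurable borel"
        using borel_measurable_times[OF joint(3)[of V] joint(2)[OF meas_deriv[OF \<zeta>]]] by (simp add: split_beta)
      have md: "(\<lambda>x. frechet_derivative \<zeta> (at (x - s *\<^sub>R b)) b) \<in> borel_measurable borel" for s
        by (rule measurable_compose[OF _ meas_deriv[OF \<zeta>]]) simp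
      show vi: "integrable lborel (\<lambda>x. V x * frechet_derivative \<zeta> (at (x - s *\<^sub>R b)) b)" for s
        by (rule mb[OF V md]) (rule B'(2))
      show "(\<integral>x. \<bar>V x * frechet_derivative \<zeta> (at (x - s *\<^sub>R b)) b\<bar> \<partial>lborel) \<le> (\<integral>x. B' * \<bar>V x\<bar> \<partial>lborel)" for s
      proof (rule integral_mono[OF integrable_abs[OF vi]])
        fix x show "\<bar>V x * frechet_derivative \<zeta> (at (x - s *\<^sub>R b)) b\<bar> \<le> B' * \<bar>V x\<bar>"
          using mult_left_mono[OF B'(2)[of "x - s *\<^sub>R b"] abs_ge_zero[of "V x"]] by (simp add: abs_mult mult.commute)
      qed (use V in simp)
    qed
    also have "\<dots> = (\<integral>x. V x * (\<zeta> x - \<zeta> (x - h *\<^sub>R b)) \<partial>lborel)"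
      using test_function_difference_integral[OF \<zeta> b h(1)]
      by (simp add: mult.left_commute[of "indicator _ _"])
    also have "\<dots> = (\<integral>x. V x * \<zeta> x - V x * \<zeta> (x - h *\<^sub>R b) \<partial>lborel)"
      by (simp add: algebra_simps)
    also have "\<dots> = (\<integral>x. V x * \<zeta> x \<partial>lborel) - (\<integral>x. V x * \<zeta> (x - h *\<^sub>R b) \<partial>lborel)"
      by (intro Bochner_Integration.integral_diff mb[OF V _ B(2)]) auto
    also have "(\<integral>x. V x * \<zeta> (x - h *\<^sub>R b) \<partial>lborel) = (\<integral>x. V (x + h *\<^sub>R b) * \<zeta> x \<partial>lborel)"
      by (simp add: tr)
    finally have eq: "(\<integral>x. I h x * \<zeta> x \<partial>lborel)
        = (\<integral>x. V (x + h *\<^sub>R b) * \<zeta> x \<partial>lborel) - (\<integral>x. V x * \<zeta> x \<partial>lborel)" by simp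
    have m: "\<zeta> \<in> borel_measurable borel" by simp
    have "(\<integral>x. (V (x + h *\<^sub>R b) - V x - I h x) * \<zeta> x \<partial>lborel)
        = (\<integral>x. V (x + h *\<^sub>R b) * \<zeta> x - V x * \<zeta> x - I h x * \<zeta> x \<partial>lborel)"
      by (simp add: algebra_simps)
    also have "\<dots> = (\<integral>x. V (x + h *\<^sub>R b) * \<zeta> x \<partial>lborel) - (\<integral>x. V x * \<zeta> x \<partial>lborel) - (\<integral>x. I h x * \<zeta> x \<partial>lborel)"
      using mb[OF Vt m B(2)] mb[OF V m B(2)] mb[OF I_int m B(2)] by simp
    also have "\<dots> = 0" using eq by simp
    finally show "(\<integral>x. (V (x + h *\<^sub>R b) - V x - I h x) * \<zeta> x \<partial>lborel) = 0" .
  qed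

  \<comment> \<open>Vanishing step sizes and convergence of the difference quotients\<close>
  define hs where "hs n = r / 2 / real (Suc n)" for n
  have hs: "0 < hs n" "hs n \<le> r / 2" for n using r by (auto simp: hs_def field_simps)
  have hs0: "hs \<longlonglongrightarrow> 0"
  proof -
    have "(\<lambda>n. r / 2 * inverse (real (Suc n))) \<longlonglongrightarrow> r / 2 * 0"
      by (intro tendsto_intros LIMSEQ_inverse_real_of_nat)
    moreover have "hs = (\<lambda>n. r / 2 * inverse (real (Suc n)))"
      unfolding hs_def by (rule ext) (rule divide_inverse)
    ultimately show ?thesis by simp
  qed
  have small: "\<exists>N. \<forall>n\<ge>N. (\<integral>x. \<bar>w (x + hs n *\<^sub>R b) - w x\<bar> \<partial>lborel) \<le> e" if w: "integrable lborel w" and e: "e > 0" for w :: "'a \<Rightarrow> real" and e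
  proof -
    obtain d where d: "d > 0" "\<And>h. norm h < d \<Longrightarrow> (\<integral>x. \<bar>w (x + h) - w x\<bar> \<partial>lborel) \<le> e"
      using translation_continuous_L1[OF w e] by blast
    obtain N where N: "\<And>n. n \<ge> N \<Longrightarrow> norm (hs n - 0) < d" using LIMSEQ_D[OF hs0 d(1)] by blast
    show ?thesis
    proof (intro exI[of _ N] allI impI)
      fix n assume "n \<ge> N"
      then have "norm (hs n *\<^sub>R b) < d" using N[of n] hs(1)[of n] nb by simp
      then show "(\<integral>x. \<bar>w (x + hs n *\<^sub>R b) - w x\<bar> \<partial>lborel) \<le> e" by (rule d(2))
    qed
  qed
  \<comment> \<open>Continuity of translation in L^1 gives convergence almost everywhere only along
    a subsequence; the step sizes are thinned out to \<open>h\<close> accordingly.\<close>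
  have "\<exists>rr. strict_mono rr \<and> (AE x in lborel. (\<lambda>n. V (x + hs (rr n) *\<^sub>R b) - V x) \<longlonglongrightarrow> 0)"
  proof (rule tendsto_L1_AE_subseq)
    show "integrable lborel (\<lambda>x. V (x + hs n *\<^sub>R b) - V x)" for n using Vt V by simp
    show "(\<lambda>n. \<integral>x. norm (V (x + hs n *\<^sub>R b) - V x) \<partial>lborel) \<longlonglongrightarrow> 0"
    proof (rule LIMSEQ_I)
      fix e :: real assume "e > 0"
      then obtain N where "\<And>n. n \<ge> N \<Longrightarrow> (\<integral>x. \<bar>V (x + hs n *\<^sub>R b) - V x\<bar> \<partial>lborel) \<le> e / 2"
        using small[OF V, of "e/2"] by auto
      then show "\<exists>no. \<forall>n\<ge>no. norm ((\<integral>x. norm (V (x + hs n *\<^sub>R b) - V x) \<partial>lborel) - 0) < e"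
        using \<open>e > 0\<close> by (intro exI[of _ N]) (force intro: le_less_trans)
    qed
  qed
  then obtain rr where rr: "strict_mono rr" "AE x in lborel. (\<lambda>n. V (x + hs (rr n) *\<^sub>R b) - V x) \<longlonglongrightarrow> 0" by blast
  define h where "h n = hs (rr n)" for n
  have h: "0 < h n" "0 \<le> h n" "h n \<le> r / 2" for n using hs[of "rr n"] by (auto simp: h_def)
  have h0: "h \<longlonglongrightarrow> 0" using LIMSEQ_subseq_LIMSEQ[OF hs0 rr(1)] by (simp add: h_def[abs_def] o_def)
  define D where "D n x = I (h n) x / h n" for n x
  have D_int: "integrable lborel (D n)" for n unfolding D_def using I_int by simp
  note [measurable] = borel_measurable_integrable[OF D_int]
  \<comment> \<open>\<open>D n\<close> is the mean of the translates of \<open>g\<close> by at most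
    \<open>h n\<close>. By Fubini its L^1 distance to \<open>g\<close> is at most the mean of the
    distances of these translates to \<open>g\<close>.\<close>
  have D_lim: "(\<lambda>n. \<integral>x. \<bar>D n x - g x\<bar> \<partial>lborel) \<longlonglongrightarrow> 0"
  proof (rule LIMSEQ_I)
    fix e :: real assume e: "e > 0"
    obtain d where d: "d > 0" "\<And>k. norm k < d \<Longrightarrow> (\<integral>x. \<bar>g (x + k) - g x\<bar> \<partial>lborel) \<le> e / 2"
      using translation_continuous_L1[OF g, of "e/2"] e by auto
    obtain N where N: "\<And>n. n \<ge> N \<Longrightarrow> norm (h n - 0) < d" using LIMSEQ_D[OF h0 d(1)] by blast
    have "(\<integral>x. \<bar>D n x - g x\<bar> \<partial>lborel) \<le> e / 2" if "n \<ge> N" for n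
    proof -
      have hd: "h n < d" using N[OF that] h(1)[of n] by simp
      let ?f = "\<lambda>s x. \<bar>g (x + s *\<^sub>R b) - g x\<bar>"
      have fi: "integrable lborel (?f s)" for s using gt g by simp
      have fb: "(\<integral>x. ?f s x \<partial>lborel) \<le> e / 2" if "s \<in> {0..h n}" for s
        using that hd nb by (intro d(2)) simp
      have mp: "case_prod ?f \<in> borel_measurable borel"
        using borel_measurable_abs[OF borel_measurable_diff[OF joint(1)[of g] joint(3)[of g]]] by (simp add: split_beta)
      have int1: "(\<integral>s. indicator {0..h n} s * c \<partial>lborel) = h n * c" for c :: real
        using h(2)[of n] by simp
      have gs: "integrable lborel (\<lambda>s. indicator {0..h n} s * g (x + s *\<^sub>R b)) \<Longrightarrow>
          \<bar>D n x - g x\<bar> \<le> (\<integral>s. indicator {0..h n} s * ?f s x \<partial>lborel) / h n" for x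
      proof -
        assume a: "integrable lborel (\<lambda>s. indicator {0..h n} s * g (x + s *\<^sub>R b))"
        have ic: "integrable lborel (\<lambda>s. indicator {0..h n} s * g x)"
          by (intro integrable_mult_left integrable_real_indicator) (auto simp: emeasure_lborel_Icc_eq)
        have "D n x - g x = ((\<integral>s. indicator {0..h n} s * g (x + s *\<^sub>R b) \<partial>lborel) - (\<integral>s. indicator {0..h n} s * g x \<partial>lborel)) / h n"
          using h(1)[of n] by (simp only: int1) (simp add: D_def I_def diff_divide_distrib)
        also have "\<dots> = (\<integral>s. indicator {0..h n} s * g (x + s *\<^sub>R b) - indicator {0..h n} s * g x \<partial>lborel) / h n"
          using a ic by simp
        finally have "\<bar>D n x - g x\<bar> = \<bar>\<integral>s. indicator {0..h n} s * g (x + s *\<^sub>R b) - indicator {0..h n} s * g x \<partial>lborel\<bar> / h n"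
          using h(2)[of n] by (simp add: abs_divide)
        also have "\<dots> \<le> (\<integral>s. \<bar>indicator {0..h n} s * g (x + s *\<^sub>R b) - indicator {0..h n} s * g x\<bar> \<partial>lborel) / h n"
          using h(2)[of n] integral_abs_bound by (intro divide_right_mono) auto
        also have "(\<lambda>s. \<bar>indicator {0..h n} s * g (x + s *\<^sub>R b) - indicator {0..h n} s * g x\<bar>) = (\<lambda>s. indicator {0..h n} s * ?f s x)"
          by (auto simp: indicator_def)
        finally show ?thesis .
      qed
      have AEi: "AE x in lborel. integrable lborel (\<lambda>s. indicator {0..h n} s * g (x + s *\<^sub>R b))"
      proof -
        have "integrable (lborel \<Otimes>\<^sub>M lborel) (case_prod (\<lambda>s x. indicator {0..h n} s * g (x + s *\<^sub>R b)))"
          by (rule Fubini_interval(3)[where C="\<integral>x. \<bar>g x\<bar> \<partial>lborel", OF joint(1) gt]) (simp_all add: abs_g)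
        from lborel_pair.AE_integrable_snd[OF this] show ?thesis by simp
      qed
      have "(\<integral>x. \<bar>D n x - g x\<bar> \<partial>lborel) \<le> (\<integral>x. (\<integral>s. indicator {0..h n} s * ?f s x \<partial>lborel) / h n \<partial>lborel)"
      proof (rule integral_mono_AE)
        show "integrable lborel (\<lambda>x. (\<integral>s. indicator {0..h n} s * ?f s x \<partial>lborel) / h n)"
          using Fubini_interval(2)[OF mp fi, of "h n" "e/2"] fb by simp
        show "AE x in lborel. \<bar>D n x - g x\<bar> \<le> (\<integral>s. indicator {0..h n} s * ?f s x \<partial>lborel) / h n"
          using AEi by eventually_elim (rule gs)
      qed (use D_int g in simp)
      also have "\<dots> = (\<integral>s. indicator {0..h n} s * (\<integral>x. ?f s x \<partial>lborel) \<partial>lborel) / h n"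
        using Fubini_interval(1)[OF mp fi, of "h n" "e/2"] fb by simp
      also have "\<dots> \<le> (\<integral>s. indicator {0..h n} s * (e / 2) \<partial>lborel) / h n"
      proof (intro divide_right_mono integral_mono')
        show "integrable lborel (\<lambda>s. indicator {0..h n} s * (e / 2))"
          by (intro integrable_mult_left integrable_real_indicator) (auto simp: emeasure_lborel_Icc_eq)
      qed (use fb e h(2)[of n] in \<open>auto simp: indicator_def\<close>)
      also have "\<dots> = e / 2" using h(1)[of n] by (simp only: int1) simp
      finally show ?thesis .
    qed
    then show "\<exists>no. \<forall>n\<ge>no. norm ((\<integral>x. \<bar>D n x - g x\<bar> \<partial>lborel) - 0) < e"
      using e by (intro exI[of _ N]) (force intro: le_less_trans)
  qed
  text \<open>The difference quotients of \<open>G \<circ> V\<close> factor through those of \<open>V\<close>.\<close>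
  define \<Delta> where "\<Delta> n x = V (x + h n *\<^sub>R b) - V x" for n x
  define q where "q n x = (G (V (x + h n *\<^sub>R b)) - G (V x)) / \<Delta> n x - (if \<Delta> n x = 0 then 0 else G' (V x))" for n x
  have [measurable]: "\<Delta> n \<in> borel_measurable borel" for n unfolding \<Delta>_def by measurable
  have [measurable]: "q n \<in> borel_measurable borel" for n unfolding q_def by measurable
  \<comment> \<open>Also valid where \<open>\<Delta>\<close> vanishes: both sides are then zero,
    whatever value the division takes.\<close>
  have q_eq: "G (V (x + h n *\<^sub>R b)) - G (V x) = (q n x + G' (V x)) * \<Delta> n x" for n x
    by (auto simp: q_def \<Delta>_def field_simps)
  have q_bound: "\<bar>q n x\<bar> \<le> 2 * L" for n x
  proof (cases "\<Delta> n x = 0")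
    case False
    have 1: "\<bar>(G (V (x + h n *\<^sub>R b)) - G (V x)) / \<Delta> n x\<bar> \<le> L"
      using Glip[of "V (x + h n *\<^sub>R b)" "V x"] False by (simp add: abs_divide \<Delta>_def divide_le_eq)
    have "q n x = (G (V (x + h n *\<^sub>R b)) - G (V x)) / \<Delta> n x - G' (V x)"
      using False by (simp add: q_def)
    then show ?thesis using 1 L[of "V x"] by linarith
  qed (use L0 in \<open>simp add: q_def\<close>)
  have q_lim: "AE x in lborel. (\<lambda>n. q n x) \<longlonglongrightarrow> 0"
    using rr(2)
  proof eventually_elim
    case (elim x)
    then have \<Delta>0: "(\<lambda>n. \<Delta> n x) \<longlonglongrightarrow> 0" by (simp add: \<Delta>_def h_def)
    define Q where "Q t = (if t = 0 then 0 else (G (V x + t) - G (V x)) / t - G' (V x))" for t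
    have "((\<lambda>t. (G (V x + t) - G (V x)) / t) \<longlongrightarrow> G' (V x)) (at 0)"
      using G[of "V x"] by (simp add: DERIV_def)
    then have "((\<lambda>t. (G (V x + t) - G (V x)) / t - G' (V x)) \<longlongrightarrow> 0) (at 0)"
      by (rule LIM_zero)
    then have "(Q \<longlongrightarrow> 0) (at 0)"
      by (rule Lim_transform_eventually) (auto simp: Q_def eventually_at_filter)
    then have "isCont Q 0" by (simp add: isCont_def Q_def)
    from isCont_tendsto_compose[OF this \<Delta>0]
    have "(\<lambda>n. Q (\<Delta> n x)) \<longlonglongrightarrow> 0" by (simp add: Q_def)
    moreover have "Q (\<Delta> n x) = q n x" for n by (simp add: Q_def q_def) (simp add: \<Delta>_def)
    ultimately show ?case by simp
  qed

  \<comment> \<open>Limits on both sides of the tested difference quotient\<close>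
  note [measurable] = meas_test[OF \<phi>] meas_deriv[OF \<phi>]
  obtain B where B: "B > 0" "\<And>x. \<bar>\<phi> x\<bar> \<le> B" by (rule test_function_bounded[OF \<phi>]) blast
  obtain Bl where Bl: "Bl > 0" "\<And>x k. 0 \<le> k \<Longrightarrow> \<bar>\<phi> (x - k *\<^sub>R b) - \<phi> x\<bar> \<le> Bl * k"
    by (rule test_function_lipschitz[OF \<phi> b]) blast
  have mbound: "integrable lborel (\<lambda>x. m x * w x * \<phi> x)" if "integrable lborel w" "m \<in> borel_measurable borel" "\<And>x. \<bar>m x\<bar> \<le> C" for m w C
  proof (rule Bochner_Integration.integrable_bound[of _ "\<lambda>x. (C * B) * w x"])
    show "AE x in lborel. norm (m x * w x * \<phi> x) \<le> norm (C * B * w x)"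
    proof (intro AE_I2)
      fix x
      have "\<bar>m x\<bar> * \<bar>\<phi> x\<bar> \<le> C * B" using that(3)[of x] B(2)[of x] by (intro mult_mono) auto
      then have "\<bar>m x\<bar> * \<bar>\<phi> x\<bar> * \<bar>w x\<bar> \<le> C * B * \<bar>w x\<bar>" by (intro mult_right_mono) auto
      moreover have "0 \<le> C" using that(3)[of x] by linarith
      ultimately show "norm (m x * w x * \<phi> x) \<le> norm (C * B * w x)"
        using B(1) by (simp add: abs_mult mult.commute mult.left_commute)
    qed
  qed (use that in auto)
  have qG_bound: "\<bar>q n x + G' (V x)\<bar> \<le> 3 * L" for n x using q_bound[of n x] L[of "V x"] by linarith
  \<comment> \<open>Only \<open>D n\<close> converges in L^1, while the factor is merely bounded and
    convergent almost everywhere. So \<open>D n\<close> is replaced by \<open>g\<close> before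
    dominated convergence is applied to the factor.\<close>
  have lim1: "(\<lambda>n. \<integral>x. (q n x + G' (V x)) * D n x * \<phi> x \<partial>lborel) \<longlonglongrightarrow> (\<integral>x. G' (V x) * g x * \<phi> x \<partial>lborel)"
  proof -
    have a: "(\<lambda>n. \<integral>x. (q n x + G' (V x)) * (D n x - g x) * \<phi> x \<partial>lborel) \<longlonglongrightarrow> 0"
    proof (rule Lim_null_comparison)
      have "(\<lambda>n. 3 * L * B * (\<integral>x. \<bar>D n x - g x\<bar> \<partial>lborel)) \<longlonglongrightarrow> 3 * L * B * 0"
        by (intro tendsto_intros D_lim)
      then show "(\<lambda>n. 3 * L * B * (\<integral>x. \<bar>D n x - g x\<bar> \<partial>lborel)) \<longlonglongrightarrow> 0" by simp
      show "\<forall>\<^sub>F n in sequentially. norm (\<integral>x. (q n x + G' (V x)) * (D n x - g x) * \<phi> x \<partial>lborel)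
          \<le> 3 * L * B * (\<integral>x. \<bar>D n x - g x\<bar> \<partial>lborel)"
      proof (intro always_eventually allI)
        fix n
        have i: "integrable lborel (\<lambda>x. D n x - g x)" using D_int g by simp
        have "norm (\<integral>x. (q n x + G' (V x)) * (D n x - g x) * \<phi> x \<partial>lborel)
            \<le> (\<integral>x. norm ((q n x + G' (V x)) * (D n x - g x) * \<phi> x) \<partial>lborel)"
          by (rule integral_norm_bound)
        also have "\<dots> \<le> (\<integral>x. 3 * L * B * \<bar>D n x - g x\<bar> \<partial>lborel)"
        proof (rule integral_mono)
          show "integrable lborel (\<lambda>x. norm ((q n x + G' (V x)) * (D n x - g x) * \<phi> x))"
            by (intro integrable_norm mbound[OF i _ qG_bound]) measurable
          fix x
          have "\<bar>q n x + G' (V x)\<bar> * \<bar>\<phi> x\<bar> \<le> 3 * L * B"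
            using qG_bound[of n x] B(2)[of x] L0 by (intro mult_mono) auto
          then have "\<bar>q n x + G' (V x)\<bar> * \<bar>\<phi> x\<bar> * \<bar>D n x - g x\<bar> \<le> 3 * L * B * \<bar>D n x - g x\<bar>"
            by (intro mult_right_mono) auto
          then show "norm ((q n x + G' (V x)) * (D n x - g x) * \<phi> x) \<le> 3 * L * B * \<bar>D n x - g x\<bar>"
            by (simp add: abs_mult mult.commute mult.left_commute)
        qed (use i in simp)
        finally show "norm (\<integral>x. (q n x + G' (V x)) * (D n x - g x) * \<phi> x \<partial>lborel)
          \<le> 3 * L * B * (\<integral>x. \<bar>D n x - g x\<bar> \<partial>lborel)" by simp
      qed
    qed
    have c: "(\<lambda>n. \<integral>x. (q n x + G' (V x)) * g x * \<phi> x \<partial>lborel) \<longlonglongrightarrow> (\<integral>x. G' (V x) * g x * \<phi> x \<partial>lborel)"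
    proof (rule integral_dominated_convergence[where w="\<lambda>x. 3 * L * B * \<bar>g x\<bar>"])
      show "AE x in lborel. (\<lambda>n. (q n x + G' (V x)) * g x * \<phi> x) \<longlonglongrightarrow> G' (V x) * g x * \<phi> x"
        using q_lim
      proof eventually_elim
        case (elim x)
        have "(\<lambda>n. (q n x + G' (V x)) * g x * \<phi> x) \<longlonglongrightarrow> (0 + G' (V x)) * g x * \<phi> x"
          by (intro tendsto_intros elim)
        then show ?case by simp
      qed
      show "AE x in lborel. norm ((q n x + G' (V x)) * g x * \<phi> x) \<le> 3 * L * B * \<bar>g x\<bar>" for n
      proof (intro AE_I2)
        fix x
        have "\<bar>q n x + G' (V x)\<bar> * \<bar>\<phi> x\<bar> \<le> 3 * L * B"
          using qG_bound[of n x] B(2)[of x] L0 by (intro mult_mono) auto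
        then have "\<bar>q n x + G' (V x)\<bar> * \<bar>\<phi> x\<bar> * \<bar>g x\<bar> \<le> 3 * L * B * \<bar>g x\<bar>"
          by (intro mult_right_mono) auto
        then show "norm ((q n x + G' (V x)) * g x * \<phi> x) \<le> 3 * L * B * \<bar>g x\<bar>"
          by (simp add: abs_mult mult.commute mult.left_commute)
      qed
    qed (use g in auto)
    have "(\<integral>x. (q n x + G' (V x)) * (D n x - g x) * \<phi> x \<partial>lborel) + (\<integral>x. (q n x + G' (V x)) * g x * \<phi> x \<partial>lborel)
        = (\<integral>x. (q n x + G' (V x)) * D n x * \<phi> x \<partial>lborel)" for n
    proof -
      have i: "integrable lborel (\<lambda>x. D n x - g x)" using D_int g by simp
      have "integrable lborel (\<lambda>x. (q n x + G' (V x)) * (D n x - g x) * \<phi> x)"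
        "integrable lborel (\<lambda>x. (q n x + G' (V x)) * g x * \<phi> x)"
        by (intro mbound[OF i _ qG_bound] mbound[OF g _ qG_bound]; measurable)+
      then show ?thesis
        by (subst Bochner_Integration.integral_add[symmetric]) (auto simp: algebra_simps intro!: Bochner_Integration.integral_cong)
    qed
    with tendsto_add[OF a c] show ?thesis by simp
  qed
  \<comment> \<open>The indicator of \<open>\<Omega>\<close> is inserted because G(V) need not be
    integrable over the whole space when \<open>G 0\<close> is not zero; on the support of
    \<open>\<phi>\<close> it equals one both at x and at the shifted point.\<close>
  have eqn: "(\<integral>x. (q n x + G' (V x)) * D n x * \<phi> x \<partial>lborel)
      = (\<integral>x. indicator \<Omega> x * G (V x) * ((\<phi> (x - h n *\<^sub>R b) - \<phi> x) / h n) \<partial>lborel)" for n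
  proof -
    have GVi: "integrable lborel (\<lambda>x. indicator \<Omega> x * G (V x))"
    proof (rule Bochner_Integration.integrable_bound[of _ "\<lambda>x. \<bar>G 0\<bar> * indicator \<Omega> x + L * \<bar>V x\<bar>"])
      have "integrable lborel (indicator \<Omega> :: 'a \<Rightarrow> real)"
        using \<Omega> emeasure_bounded_finite[OF \<Omega>(2)] by (intro integrable_real_indicator) (auto simp: infinity_ennreal_def)
      then show "integrable lborel (\<lambda>x. \<bar>G 0\<bar> * indicator \<Omega> x + L * \<bar>V x\<bar>)" using V by simp
      show "AE x in lborel. norm (indicator \<Omega> x * G (V x)) \<le> norm (\<bar>G 0\<bar> * indicator \<Omega> x + L * \<bar>V x\<bar>)"
      proof (intro AE_I2)
        fix x
        have "0 \<le> L * \<bar>V x\<bar>" using L0 by simp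
        moreover have "\<bar>G (V x)\<bar> \<le> \<bar>G 0\<bar> + L * \<bar>V x\<bar>" using Glip[of "V x" 0] unfolding diff_zero by linarith
        ultimately show "norm (indicator \<Omega> x * G (V x)) \<le> norm (\<bar>G 0\<bar> * indicator \<Omega> x + L * \<bar>V x\<bar>)"
          by (auto simp: indicator_def)
      qed
    qed (use \<Omega>(1) in measurable)
    have GVphi: "integrable lborel (\<lambda>x. indicator \<Omega> x * G (V x) * p x)"
      if "p \<in> borel_measurable borel" "\<And>x. \<bar>p x\<bar> \<le> B" for p
    proof (rule Bochner_Integration.integrable_bound[of _ "\<lambda>x. B * (indicator \<Omega> x * G (V x))"])
      show "AE x in lborel. norm (indicator \<Omega> x * G (V x) * p x) \<le> norm (B * (indicator \<Omega> x * G (V x)))"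
      proof (intro AE_I2)
        fix x show "norm (indicator \<Omega> x * G (V x) * p x) \<le> norm (B * (indicator \<Omega> x * G (V x)))"
          using that(2)[of x] B(1) by (simp add: abs_mult mult.commute mult.left_commute mult_right_mono mult_left_mono)
      qed
    qed (use GVi that \<Omega>(1) in auto)
    have "(\<integral>x. (q n x + G' (V x)) * D n x * \<phi> x \<partial>lborel)
        = (\<integral>x. (G (V (x + h n *\<^sub>R b)) - G (V x)) / h n * \<phi> x \<partial>lborel)"
    proof (rule integral_cong_AE)
      show "AE x in lborel. (q n x + G' (V x)) * D n x * \<phi> x = (G (V (x + h n *\<^sub>R b)) - G (V x)) / h n * \<phi> x"
        using diff_eq[OF h(2)[of n] h(3)[of n]]
      proof eventually_elim
        case (elim x)
        show ?case
        proof (cases "x \<in> K")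
          case True
          then have "D n x = \<Delta> n x / h n" using elim KU by (auto simp: D_def \<Delta>_def)
          then show ?thesis by (simp add: q_eq)
        qed (simp add: K(3))
      qed
    qed measurable
    also have "\<dots> = (\<integral>x. (indicator \<Omega> (x + h n *\<^sub>R b) * G (V (x + h n *\<^sub>R b)) * \<phi> x - indicator \<Omega> x * G (V x) * \<phi> x) / h n \<partial>lborel)"
    proof (rule Bochner_Integration.integral_cong[OF refl])
      fix x
      show "(G (V (x + h n *\<^sub>R b)) - G (V x)) / h n * \<phi> x =
        (indicator \<Omega> (x + h n *\<^sub>R b) * G (V (x + h n *\<^sub>R b)) * \<phi> x - indicator \<Omega> x * G (V x) * \<phi> x) / h n"
      proof (cases "x \<in> K")
        case True
        then have "x \<in> \<Omega>" "x + h n *\<^sub>R b \<in> \<Omega>" using K(2) KU shiftU[OF _ h(2,3)] by auto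
        then show ?thesis by (simp add: algebra_simps diff_divide_distrib)
      qed (simp add: K(3))
    qed
    also have "\<dots> = ((\<integral>x. indicator \<Omega> (x + h n *\<^sub>R b) * G (V (x + h n *\<^sub>R b)) * \<phi> x \<partial>lborel) - (\<integral>x. indicator \<Omega> x * G (V x) * \<phi> x \<partial>lborel)) / h n"
    proof -
      have "integrable lborel (\<lambda>x. indicator \<Omega> x * G (V x) * \<phi> (x - h n *\<^sub>R b))"
        using B by (intro GVphi) auto
      from integrable_translate[OF this, of "h n *\<^sub>R b"]
      have "integrable lborel (\<lambda>x. indicator \<Omega> (x + h n *\<^sub>R b) * G (V (x + h n *\<^sub>R b)) * \<phi> x)" by simp
      moreover have "integrable lborel (\<lambda>x. indicator \<Omega> x * G (V x) * \<phi> x)"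
        using B by (intro GVphi) auto
      ultimately show ?thesis by simp
    qed
    also have "(\<integral>x. indicator \<Omega> (x + h n *\<^sub>R b) * G (V (x + h n *\<^sub>R b)) * \<phi> x \<partial>lborel)
        = (\<integral>x. indicator \<Omega> x * G (V x) * \<phi> (x - h n *\<^sub>R b) \<partial>lborel)"
      using integral_translate[of "\<lambda>x. indicator \<Omega> x * G (V x) * \<phi> (x - h n *\<^sub>R b)" "h n *\<^sub>R b"] \<Omega>(1) by simp
    also have "((\<integral>x. indicator \<Omega> x * G (V x) * \<phi> (x - h n *\<^sub>R b) \<partial>lborel) - (\<integral>x. indicator \<Omega> x * G (V x) * \<phi> x \<partial>lborel)) / h n
        = (\<integral>x. (indicator \<Omega> x * G (V x) * \<phi> (x - h n *\<^sub>R b) - indicator \<Omega> x * G (V x) * \<phi> x) / h n \<partial>lborel)"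
      using GVphi[of \<phi>] GVphi[of "\<lambda>x. \<phi> (x - h n *\<^sub>R b)"] B by simp
    finally show ?thesis by (simp add: algebra_simps)
  qed
  have lim2: "(\<lambda>n. \<integral>x. indicator \<Omega> x * G (V x) * ((\<phi> (x - h n *\<^sub>R b) - \<phi> x) / h n) \<partial>lborel)
      \<longlonglongrightarrow> (\<integral>x. indicator \<Omega> x * G (V x) * - frechet_derivative \<phi> (at x) b \<partial>lborel)"
  proof (rule integral_dominated_convergence[where w="\<lambda>x. Bl * (\<bar>G 0\<bar> * indicator \<Omega> x + L * \<bar>V x\<bar>)"])
    have "integrable lborel (indicator \<Omega> :: 'a \<Rightarrow> real)"
      using \<Omega> emeasure_bounded_finite[OF \<Omega>(2)] by (intro integrable_real_indicator) (auto simp: infinity_ennreal_def)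
    then show "integrable lborel (\<lambda>x. Bl * (\<bar>G 0\<bar> * indicator \<Omega> x + L * \<bar>V x\<bar>))" using V by simp
    show "AE x in lborel. (\<lambda>n. indicator \<Omega> x * G (V x) * ((\<phi> (x - h n *\<^sub>R b) - \<phi> x) / h n))
        \<longlonglongrightarrow> indicator \<Omega> x * G (V x) * - frechet_derivative \<phi> (at x) b"
    proof (intro AE_I2 tendsto_mult tendsto_const)
      fix x
      have "((\<lambda>s. \<phi> (x + s *\<^sub>R b)) has_real_derivative frechet_derivative \<phi> (at (x + 0 *\<^sub>R b)) b) (at 0)"
        by (rule has_derivative_along_line[OF test_function_derivative[OF \<phi>]])
      then have l: "((\<lambda>s. (\<phi> (x + s *\<^sub>R b) - \<phi> x) / s) \<longlongrightarrow> frechet_derivative \<phi> (at x) b) (at 0)"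
        by (simp add: DERIV_def)
      \<comment> \<open>The quotient on the test function looks backwards, which produces the minus
        sign of the integration by parts.\<close>
      have f: "filterlim (\<lambda>n. - h n) (at 0) sequentially"
        unfolding filterlim_at using tendsto_minus[OF h0] h(1) by (auto simp: less_imp_neq[symmetric])
      have "(\<lambda>n. - ((\<phi> (x + (- h n) *\<^sub>R b) - \<phi> x) / (- h n))) \<longlonglongrightarrow> - frechet_derivative \<phi> (at x) b"
        by (intro tendsto_minus filterlim_compose[OF l f])
      then show "(\<lambda>n. (\<phi> (x - h n *\<^sub>R b) - \<phi> x) / h n) \<longlonglongrightarrow> - frechet_derivative \<phi> (at x) b" by simp
    qed
    show "AE x in lborel. norm (indicator \<Omega> x * G (V x) * ((\<phi> (x - h n *\<^sub>R b) - \<phi> x) / h n))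
      \<le> Bl * (\<bar>G 0\<bar> * indicator \<Omega> x + L * \<bar>V x\<bar>)" for n
    proof (intro AE_I2)
      fix x
      have 1: "\<bar>(\<phi> (x - h n *\<^sub>R b) - \<phi> x) / h n\<bar> \<le> Bl"
        using Bl(2)[OF h(2)[of n], of x] h(1)[of n] by (simp add: abs_divide divide_le_eq)
      have 2: "\<bar>G (V x)\<bar> \<le> \<bar>G 0\<bar> + L * \<bar>V x\<bar>" using Glip[of "V x" 0] unfolding diff_zero by linarith
      have 3: "0 \<le> L * \<bar>V x\<bar>" using L0 by simp
      have "\<bar>indicator \<Omega> x * G (V x)\<bar> * \<bar>(\<phi> (x - h n *\<^sub>R b) - \<phi> x) / h n\<bar> \<le> (\<bar>G 0\<bar> * indicator \<Omega> x + L * \<bar>V x\<bar>) * Bl"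
        using 1 2 3 by (intro mult_mono) (auto simp: indicator_def)
      then show "norm (indicator \<Omega> x * G (V x) * ((\<phi> (x - h n *\<^sub>R b) - \<phi> x) / h n))
        \<le> Bl * (\<bar>G 0\<bar> * indicator \<Omega> x + L * \<bar>V x\<bar>)" by (simp add: abs_mult mult.commute)
    qed
  qed (use \<Omega>(1) in measurable)
  have "(\<integral>x. indicator \<Omega> x * G (V x) * - frechet_derivative \<phi> (at x) b \<partial>lborel) = (\<integral>x. G' (V x) * g x * \<phi> x \<partial>lborel)"
    using LIMSEQ_unique[OF lim2] lim1 by (simp add: eqn)
  moreover have "(\<integral>x. indicator \<Omega> x * G (V x) * - frechet_derivative \<phi> (at x) b \<partial>lborel)
      = (\<integral>x. - (G (V x) * frechet_derivative \<phi> (at x) b) \<partial>lborel)"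
  proof (rule Bochner_Integration.integral_cong[OF refl])
    fix x
    show "indicator \<Omega> x * G (V x) * - frechet_derivative \<phi> (at x) b = - (G (V x) * frechet_derivative \<phi> (at x) b)"
      using test_function_support(4)[OF \<phi>, of x b] K(2) by (cases "x \<in> K") (auto simp: K_def indicator_def)
  qed
  ultimately show ?thesis by simp
qed

subsection \<open>Weak gradients\<close>

context bounded_open
begin

lemma borel_measurable_M: "F \<in> borel_measurable borel \<Longrightarrow> F \<in> borel_measurable M"
  by (intro measurable_restrict_space1 measurable_completion) simp

text \<open>Functions on \<open>\<Omega>\<close> are only Lebesgue measurable. Extending by zero and
  passing to a Borel version makes translation and Fubini for \<open>lborel\<close>
  available.\<close>

lemma borel_representative:
  fixes v :: "'a \<Rightarrow> real"
  assumes "v \<in> borel_measurable M"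
  obtains V where "V \<in> borel_measurable borel" "\<And>x. x \<notin> \<Omega> \<Longrightarrow> V x = 0" "AE x in M. v x = V x"
proof -
  have "(\<lambda>x. if x \<in> \<Omega> then v x else 0) \<in> borel_measurable lebesgue"
    using assms by (rule borel_measurable_if_I) (rule dom_sets)
  from completion_ex_borel_measurable_real[OF this]
  obtain V where V: "V \<in> borel_measurable lborel" "AE x in lborel. (if x \<in> \<Omega> then v x else 0) = V x" by blast
  have [measurable]: "\<Omega> \<in> sets borel" using open_dom by simp
  show ?thesis
  proof
    show "(\<lambda>x. indicator \<Omega> x * V x) \<in> borel_measurable borel" using V(1) by measurable
    have "AE x in lebesgue. (if x \<in> \<Omega> then v x else 0) = V x"
      by (rule AE_completion[OF V(2)])
    then show "AE x in M. v x = indicator \<Omega> x * V x"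
      by (auto simp: AE_restrict_space_iff)
  qed auto
qed

lemma integral_representative:
  fixes f F :: "'a \<Rightarrow> real"
  assumes f: "integrable M f" and F: "F \<in> borel_measurable borel" "\<And>x. x \<notin> \<Omega> \<Longrightarrow> F x = 0"
    and eq: "AE x in M. f x = F x"
  shows "integrable lborel F" "(\<integral>x. f x \<partial>M) = (\<integral>x. F x \<partial>lborel)"
proof -
  have FM: "F \<in> borel_measurable M" by (rule borel_measurable_M[OF F(1)])
  have ind: "(\<lambda>x. indicator \<Omega> x * F x) = F" using F(2) by (auto simp: indicator_def fun_eq_iff)
  have "integrable M F" by (rule integrable_cong_AE_imp[OF f FM]) (use eq in auto)
  then have "integrable lebesgue F"
    by (simp add: integrable_restrict_space ind)
  then show "integrable lborel F" using F(1) by (simp add: integrable_completion)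
  have "(\<integral>x. f x \<partial>M) = (\<integral>x. F x \<partial>M)"
    using f FM eq by (intro integral_cong_AE) auto
  also have "\<dots> = (\<integral>x. F x \<partial>lebesgue)"
    by (simp add: integral_restrict_space ind)
  also have "\<dots> = (\<integral>x. F x \<partial>lborel)" using F(1) by (simp add: integral_completion)
  finally show "(\<integral>x. f x \<partial>M) = (\<integral>x. F x \<partial>lborel)" .
qed

lemma borel_test_function:
  assumes "\<phi> \<in> test_functions U"
  shows "\<phi> \<in> borel_measurable borel"
    and "b \<in> Basis \<Longrightarrow> (\<lambda>x. frechet_derivative \<phi> (at x) b) \<in> borel_measurable borel"
  using test_function_continuous[OF assms] test_function_continuous_deriv[OF assms]
  by (auto intro: borel_measurable_continuous_onI)

lemma L2_test_function:
  assumes "\<phi> \<in> test_functions U"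
  shows "\<phi> \<in> L2_space \<Omega>" "b \<in> Basis \<Longrightarrow> (\<lambda>x. frechet_derivative \<phi> (at x) b) \<in> L2_space \<Omega>"
proof -
  obtain B where B: "B > 0" "\<And>x. \<bar>\<phi> x\<bar> \<le> B" by (rule test_function_bounded[OF assms]) blast
  show "\<phi> \<in> L2_space \<Omega>"
    by (rule L2_bounded[OF borel_measurable_M[OF borel_test_function(1)[OF assms]]]) (use B in simp)
  assume b: "b \<in> Basis"
  obtain B where B: "B > 0" "\<And>x. \<bar>frechet_derivative \<phi> (at x) b\<bar> \<le> B"
    by (rule test_function_bounded_deriv[OF assms b]) blast
  show "(\<lambda>x. frechet_derivative \<phi> (at x) b) \<in> L2_space \<Omega>"
    by (rule L2_bounded[OF borel_measurable_M[OF borel_test_function(2)[OF assms b]]]) (use B in simp)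
qed

lemma fundamental_lemma_L2:
  fixes d :: "'a \<Rightarrow> real"
  assumes d: "d \<in> L2_space \<Omega>" and z: "\<And>\<phi>. \<phi> \<in> test_functions \<Omega> \<Longrightarrow> (\<integral>x. d x * \<phi> x \<partial>M) = 0"
  shows "AE x in M. d x = 0"
proof -
  obtain D where D: "D \<in> borel_measurable borel" "\<And>x. x \<notin> \<Omega> \<Longrightarrow> D x = 0" "AE x in M. d x = D x"
    by (rule borel_representative[OF L2_measurable[OF d]]) blast
  have "AE x in lborel. x \<in> \<Omega> \<longrightarrow> D x = 0"
  proof (rule fundamental_lemma[OF open_dom])
    show "integrable lborel D" by (rule integral_representative(1)[OF L2_integrable[OF d] D])
    fix \<phi> :: "'a \<Rightarrow> real" assume \<phi>: "\<phi> \<in> test_functions \<Omega>"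
    have "(\<integral>x. d x * \<phi> x \<partial>M) = (\<integral>x. D x * \<phi> x \<partial>lborel)"
      by (rule integral_representative(2)[OF L2_mult_integrable[OF d L2_test_function(1)[OF \<phi>]]])
        (use D borel_test_function(1)[OF \<phi>] in auto)
    then show "(\<integral>x. D x * \<phi> x \<partial>lborel) = 0" using z[OF \<phi>] by simp
  qed
  then have "AE x in M. D x = 0"
    by (auto simp: AE_restrict_space_iff dest: AE_completion)
  with D(3) show ?thesis by eventually_elim auto
qed

text \<open>Carries the gradient as an explicit argument. The chosen \<open>weak_gradient\<close> is
  determined only almost everywhere, so sums or compositions would not match it pointwise.\<close>

definition H1_pair :: "('a \<Rightarrow> real) \<Rightarrow> ('a \<Rightarrow> 'a) \<Rightarrow> bool" where
  "H1_pair v g \<longleftrightarrow> v \<in> L2_space \<Omega> \<and> g \<in> L2_space \<Omega> \<and> has_weak_gradient \<Omega> v g"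

lemma H1_pairD:
  assumes "H1_pair v g"
  shows "v \<in> L2_space \<Omega>" "g \<in> L2_space \<Omega>"
    and "\<phi> \<in> test_functions \<Omega> \<Longrightarrow> b \<in> Basis \<Longrightarrow>
      (\<integral>x. v x * frechet_derivative \<phi> (at x) b \<partial>M) = - (\<integral>x. (g x \<bullet> b) * \<phi> x \<partial>M)"
  using assms by (auto simp: H1_pair_def has_weak_gradient_def)

lemma H1_pair_integrable:
  assumes "H1_pair v g" "\<phi> \<in> test_functions U" "b \<in> Basis"
  shows "integrable M (\<lambda>x. v x * frechet_derivative \<phi> (at x) b)" "integrable M (\<lambda>x. (g x \<bullet> b) * \<phi> x)"
  by (rule L2_mult_integrable[OF H1_pairD(1)[OF assms(1)] L2_test_function(2)[OF assms(2,3)]],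
      rule L2_mult_integrable[OF L2_inner_const[OF H1_pairD(2)[OF assms(1)]] L2_test_function(1)[OF assms(2)]])

text \<open>Each component of the difference of the two gradients annihilates all test functions, so
  the fundamental lemma applies.\<close>

lemma H1_pair_unique:
  assumes p: "H1_pair v g" and q: "H1_pair w k" and eq: "AE x in M. v x = w x"
  shows "AE x in M. g x = k x"
proof -
  have "AE x in M. (g x - k x) \<bullet> b = 0" if b: "b \<in> Basis" for b
  proof (rule fundamental_lemma_L2)
    show "(\<lambda>x. (g x - k x) \<bullet> b) \<in> L2_space \<Omega>"
      by (intro L2_inner_const L2_diff H1_pairD(2)[OF p] H1_pairD(2)[OF q])
    fix \<phi> :: "'a \<Rightarrow> real" assume \<phi>: "\<phi> \<in> test_functions \<Omega>"
    have "(\<integral>x. v x * frechet_derivative \<phi> (at x) b \<partial>M) = (\<integral>x. w x * frechet_derivative \<phi> (at x) b \<partial>M)"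
      using H1_pair_integrable(1)[OF p \<phi> b] H1_pair_integrable(1)[OF q \<phi> b] eq
      by (intro integral_cong_AE) auto
    then have "(\<integral>x. (g x \<bullet> b) * \<phi> x \<partial>M) = (\<integral>x. (k x \<bullet> b) * \<phi> x \<partial>M)"
      using H1_pairD(3)[OF p \<phi> b] H1_pairD(3)[OF q \<phi> b] by simp
    then show "(\<integral>x. (g x - k x) \<bullet> b * \<phi> x \<partial>M) = 0"
      using H1_pair_integrable(2)[OF p \<phi> b] H1_pair_integrable(2)[OF q \<phi> b]
      by (simp add: inner_diff_left left_diff_distrib)
  qed
  then have "AE x in M. \<forall>b\<in>Basis. (g x - k x) \<bullet> b = 0"
    by (subst AE_finite_all) (auto simp: AE_ball_countable countable_finite)
  then show ?thesis
  proof eventually_elim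
    case (elim x)
    then have "g x - k x = 0" by (subst euclidean_all_zero_iff[symmetric]) auto
    then show ?case by simp
  qed
qed

lemma H1_pair_cong_AE:
  assumes p: "H1_pair v g" and eq: "AE x in M. v x = w x" "AE x in M. g x = k x"
  shows "H1_pair w k"
proof -
  have L: "w \<in> L2_space \<Omega>" "k \<in> L2_space \<Omega>"
    using L2_cong_AE[OF H1_pairD(1)[OF p] eq(1)] L2_cong_AE[OF H1_pairD(2)[OF p] eq(2)] by auto
  show ?thesis
    unfolding H1_pair_def has_weak_gradient_def
  proof (intro conjI L ballI)
    fix \<phi> :: "'a \<Rightarrow> real" and b :: 'a
    assume \<phi>: "\<phi> \<in> test_functions \<Omega>" and b: "b \<in> Basis"
    have 1: "(\<integral>x. v x * frechet_derivative \<phi> (at x) b \<partial>M) = (\<integral>x. w x * frechet_derivative \<phi> (at x) b \<partial>M)"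
      using H1_pair_integrable(1)[OF p \<phi> b] L2_mult_integrable[OF L(1) L2_test_function(2)[OF \<phi> b]] eq(1)
      by (intro integral_cong_AE) auto
    have 2: "(\<integral>x. (g x \<bullet> b) * \<phi> x \<partial>M) = (\<integral>x. (k x \<bullet> b) * \<phi> x \<partial>M)"
      using H1_pair_integrable(2)[OF p \<phi> b] L2_mult_integrable[OF L2_inner_const[OF L(2)] L2_test_function(1)[OF \<phi>]] eq(2)
      by (intro integral_cong_AE) auto
    show "(\<integral>x. w x * frechet_derivative \<phi> (at x) b \<partial>M) = - (\<integral>x. (k x \<bullet> b) * \<phi> x \<partial>M)"
      using H1_pairD(3)[OF p \<phi> b] 1 2 by simp
  qed
qed

lemma H1_pair_add:
  assumes p: "H1_pair v g" and q: "H1_pair w k"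
  shows "H1_pair (\<lambda>x. v x + w x) (\<lambda>x. g x + k x)"
  unfolding H1_pair_def has_weak_gradient_def
proof (intro conjI ballI)
  fix \<phi> :: "'a \<Rightarrow> real" and b :: 'a
  assume \<phi>: "\<phi> \<in> test_functions \<Omega>" and b: "b \<in> Basis"
  show "(\<integral>x. (v x + w x) * frechet_derivative \<phi> (at x) b \<partial>M) = - (\<integral>x. ((g x + k x) \<bullet> b) * \<phi> x \<partial>M)"
    using H1_pair_integrable[OF p \<phi> b] H1_pair_integrable[OF q \<phi> b] H1_pairD(3)[OF p \<phi> b] H1_pairD(3)[OF q \<phi> b]
    by (simp add: distrib_right inner_add_left)
qed (use p q in \<open>auto intro!: L2_add dest: H1_pairD\<close>)

lemma H1_pair_scale:
  assumes p: "H1_pair v g"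
  shows "H1_pair (\<lambda>x. c * v x) (\<lambda>x. c *\<^sub>R g x)"
  unfolding H1_pair_def has_weak_gradient_def
proof (intro conjI ballI)
  fix \<phi> :: "'a \<Rightarrow> real" and b :: 'a
  assume \<phi>: "\<phi> \<in> test_functions \<Omega>" and b: "b \<in> Basis"
  show "(\<integral>x. c * v x * frechet_derivative \<phi> (at x) b \<partial>M) = - (\<integral>x. (c *\<^sub>R g x \<bullet> b) * \<phi> x \<partial>M)"
    using H1_pairD(3)[OF p \<phi> b] by (simp add: mult.assoc)
qed (use p in \<open>auto intro!: L2_mult L2_scaleR dest: H1_pairD\<close>)

lemma H1_pair_diff:
  assumes "H1_pair v g" "H1_pair w k"
  shows "H1_pair (\<lambda>x. v x - w x) (\<lambda>x. g x - k x)"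
  using H1_pair_add[OF assms(1) H1_pair_scale[OF assms(2), of "-1"]] by simp

lemma H1_pair_zero: "H1_pair (\<lambda>x. 0) (\<lambda>x. 0)"
  by (simp add: H1_pair_def has_weak_gradient_def L2_const)

text \<open>The bounded derivative gives \<open>G\<close> linear growth, which on a set of finite
  measure keeps \<open>G (v x)\<close> in L^2. The weak equation is then moved to Borel
  representatives vanishing outside \<open>\<Omega>\<close>, where the version for
  \<open>lborel\<close> applies.\<close>

lemma H1_pair_chain:
  assumes p: "H1_pair v g"
    and G: "\<And>s. (G has_real_derivative G' s) (at s)" and G'c: "continuous_on UNIV G'"
    and L: "\<And>s. \<bar>G' s\<bar> \<le> L"
  shows "H1_pair (\<lambda>x. G (v x)) (\<lambda>x. G' (v x) *\<^sub>R g x)"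
proof -
  note vL = H1_pairD(1)[OF p] and gL = H1_pairD(2)[OF p]
  have [measurable]: "v \<in> borel_measurable M" "g \<in> borel_measurable M" using vL gL L2_measurable by auto
  have [measurable]: "G' \<in> borel_measurable borel" using G'c by (rule borel_measurable_continuous_onI)
  have "continuous_on UNIV G" using G DERIV_isCont continuous_at_imp_continuous_on by blast
  then have [measurable]: "G \<in> borel_measurable borel" by (rule borel_measurable_continuous_onI)
  have L0: "0 \<le> L" using L[of 0] by linarith
  have Glip: "\<bar>G y\<bar> \<le> \<bar>G 0\<bar> + L * \<bar>y\<bar>" for y
  proof -
    have "\<bar>G y - G 0\<bar> \<le> L * \<bar>y - 0\<bar>"
      using field_differentiable_bound[of UNIV G G' L y 0] G L
      by (auto intro: has_field_derivative_at_within)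
    then show ?thesis unfolding diff_zero by linarith
  qed
  have GL: "(\<lambda>x. G (v x)) \<in> L2_space \<Omega>"
  proof (rule L2_dominated)
    show "(\<lambda>x. \<bar>G 0\<bar> + L * norm (v x)) \<in> L2_space \<Omega>"
      by (intro L2_add L2_const L2_mult L2_norm_space vL)
    show "norm (G (v x)) \<le> norm (\<bar>G 0\<bar> + L * norm (v x))" for x
      using Glip[of "v x"] L0 by simp
  qed measurable
  have GgL: "(\<lambda>x. G' (v x) *\<^sub>R g x) \<in> L2_space \<Omega>"
  proof (rule L2_dominated)
    show "(\<lambda>x. L *\<^sub>R g x) \<in> L2_space \<Omega>" by (intro L2_scaleR gL)
    show "norm (G' (v x) *\<^sub>R g x) \<le> norm (L *\<^sub>R g x)" for x
      using L[of "v x"] L0 by (simp add: mult_right_mono)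
  qed measurable
  obtain V where V: "V \<in> borel_measurable borel" "\<And>x. x \<notin> \<Omega> \<Longrightarrow> V x = 0" "AE x in M. v x = V x"
    by (rule borel_representative[OF L2_measurable[OF vL]]) blast
  note [measurable] = V(1)
  show ?thesis
    unfolding H1_pair_def has_weak_gradient_def
  proof (intro conjI GL GgL ballI)
    fix \<phi> :: "'a \<Rightarrow> real" and b :: 'a
    assume \<phi>: "\<phi> \<in> test_functions \<Omega>" and b: "b \<in> Basis"
    have gbL: "(\<lambda>x. g x \<bullet> b) \<in> L2_space \<Omega>" by (rule L2_inner_const[OF gL])
    obtain h where h: "h \<in> borel_measurable borel" "\<And>x. x \<notin> \<Omega> \<Longrightarrow> h x = 0" "AE x in M. g x \<bullet> b = h x"
      by (rule borel_representative[OF L2_measurable[OF gbL]]) blast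
    note [measurable] = h(1)
    have off: "\<zeta> x = 0" "frechet_derivative \<zeta> (at x) b = 0" if "\<zeta> \<in> test_functions \<Omega>" "x \<notin> \<Omega>" for \<zeta> x
      using test_function_support(2-4)[OF that(1)] that(2) by blast+
    have "(\<integral>x. G (V x) * frechet_derivative \<phi> (at x) b \<partial>lborel) = - (\<integral>x. G' (V x) * h x * \<phi> x \<partial>lborel)"
    proof (rule weak_derivative_chain_lborel[OF open_dom bounded_dom _ _ b _ G G'c L \<phi>])
      show "integrable lborel V" by (rule integral_representative(1)[OF L2_integrable[OF vL] V])
      show "integrable lborel h" by (rule integral_representative(1)[OF L2_integrable[OF gbL] h])
      fix \<zeta> :: "'a \<Rightarrow> real" assume \<zeta>: "\<zeta> \<in> test_functions \<Omega>"
      note [measurable] = borel_test_function(1)[OF \<zeta>] borel_test_function(2)[OF \<zeta> b]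
      have 1: "(\<integral>x. v x * frechet_derivative \<zeta> (at x) b \<partial>M) = (\<integral>x. V x * frechet_derivative \<zeta> (at x) b \<partial>lborel)"
        by (rule integral_representative(2)[OF H1_pair_integrable(1)[OF p \<zeta> b]]) (use V in auto)
      have 2: "(\<integral>x. (g x \<bullet> b) * \<zeta> x \<partial>M) = (\<integral>x. h x * \<zeta> x \<partial>lborel)"
        by (rule integral_representative(2)[OF H1_pair_integrable(2)[OF p \<zeta> b]]) (use h in auto)
      show "(\<integral>x. V x * frechet_derivative \<zeta> (at x) b \<partial>lborel) = - (\<integral>x. h x * \<zeta> x \<partial>lborel)"
        using H1_pairD(3)[OF p \<zeta> b] 1 2 by simp
    qed
    moreover have "(\<integral>x. G (v x) * frechet_derivative \<phi> (at x) b \<partial>M) = (\<integral>x. G (V x) * frechet_derivative \<phi> (at x) b \<partial>lborel)"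
    proof (rule integral_representative(2)[OF L2_mult_integrable[OF GL L2_test_function(2)[OF \<phi> b]]])
      note [measurable] = borel_test_function(2)[OF \<phi> b]
      show "(\<lambda>x. G (V x) * frechet_derivative \<phi> (at x) b) \<in> borel_measurable borel" by measurable
      show "AE x in M. G (v x) * frechet_derivative \<phi> (at x) b = G (V x) * frechet_derivative \<phi> (at x) b"
        using V(3) by eventually_elim simp
    qed (use off[OF \<phi>] in simp)
    moreover have "(\<integral>x. (G' (v x) *\<^sub>R g x \<bullet> b) * \<phi> x \<partial>M) = (\<integral>x. G' (V x) * h x * \<phi> x \<partial>lborel)"
    proof (rule integral_representative(2)[OF L2_mult_integrable[OF L2_inner_const[OF GgL] L2_test_function(1)[OF \<phi>]]])
      note [measurable] = borel_test_function(1)[OF \<phi>]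
      show "(\<lambda>x. G' (V x) * h x * \<phi> x) \<in> borel_measurable borel" by measurable
      show "AE x in M. (G' (v x) *\<^sub>R g x \<bullet> b) * \<phi> x = G' (V x) * h x * \<phi> x"
        using V(3) h(3) by eventually_elim simp
    qed (use off[OF \<phi>] in simp)
    ultimately show "(\<integral>x. G (v x) * frechet_derivative \<phi> (at x) b \<partial>M) = - (\<integral>x. (G' (v x) *\<^sub>R g x \<bullet> b) * \<phi> x \<partial>M)"
      by simp
  qed
qed

text \<open>The chain rule with a constant \<open>G\<close> replaces a separate proof that
  derivatives of test functions have integral zero.\<close>

lemma H1_pair_const: "H1_pair (\<lambda>x. k) (\<lambda>x. 0)"
  using H1_pair_chain[OF H1_pair_zero, of "\<lambda>_. k" "\<lambda>_. 0" 0] by simp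

lemma H1_space_iff: "v \<in> H1_space \<Omega> \<longleftrightarrow> (\<exists>g. H1_pair v g)"
  by (auto simp: H1_space_def H1_pair_def)

lemma H1_pair_weak_gradient:
  assumes "v \<in> H1_space \<Omega>"
  shows "H1_pair v (weak_gradient \<Omega> v)"
proof -
  have "\<exists>g. g \<in> L2_space \<Omega> \<and> has_weak_gradient \<Omega> v g" using assms by (auto simp: H1_space_def)
  from someI_ex[OF this] assms show ?thesis
    by (auto simp: H1_pair_def weak_gradient_def H1_space_def)
qed

lemma weak_gradient_AE: "H1_pair v g \<Longrightarrow> AE x in M. weak_gradient \<Omega> v x = g x"
  using H1_pair_unique[OF H1_pair_weak_gradient] H1_space_iff by blast

text \<open>A true equality of functions, not just almost everywhere: both choices are made from the
  same set of candidates.\<close>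

lemma weak_gradient_cong_AE:
  assumes "v \<in> L2_space \<Omega>" "AE x in M. v x = w x"
  shows "weak_gradient \<Omega> v = weak_gradient \<Omega> w"
proof -
  have w: "w \<in> L2_space \<Omega>" by (rule L2_cong_AE[OF assms])
  have sym: "AE x in M. w x = v x" using assms(2) by eventually_elim simp
  have "g \<in> L2_space \<Omega> \<and> has_weak_gradient \<Omega> v g \<longleftrightarrow> g \<in> L2_space \<Omega> \<and> has_weak_gradient \<Omega> w g" for g
    using H1_pair_cong_AE[of v g w g] H1_pair_cong_AE[of w g v g] assms w sym
    by (auto simp: H1_pair_def)
  then show ?thesis by (simp add: weak_gradient_def)
qed

text \<open>The weak equation is linear in the pair, so weak limits suffice; the vector field
  \<open>\<phi>\<close> times b extracts the component b of the gradients.\<close>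

lemma H1_pair_closed:
  assumes z: "\<And>n. H1_pair (v n) (g n)" and L: "v' \<in> L2_space \<Omega>" "g' \<in> L2_space \<Omega>"
    and lim: "\<And>h :: 'a \<Rightarrow> real. h \<in> L2_space \<Omega> \<Longrightarrow> (\<lambda>n. L2_inner \<Omega> (v n) h) \<longlonglongrightarrow> L2_inner \<Omega> v' h"
      "\<And>h :: 'a \<Rightarrow> 'a. h \<in> L2_space \<Omega> \<Longrightarrow> (\<lambda>n. L2_inner \<Omega> (g n) h) \<longlonglongrightarrow> L2_inner \<Omega> g' h"
  shows "H1_pair v' g'"
  unfolding H1_pair_def has_weak_gradient_def
proof (intro conjI L ballI)
  fix \<phi> :: "'a \<Rightarrow> real" and b :: 'a
  assume \<phi>: "\<phi> \<in> test_functions \<Omega>" and b: "b \<in> Basis"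
  have "(\<lambda>x. \<phi> x *\<^sub>R b) \<in> L2_space \<Omega>"
  proof (rule L2_dominated[OF _ L2_test_function(1)[OF \<phi>]])
    show "(\<lambda>x. \<phi> x *\<^sub>R b) \<in> borel_measurable M"
      using L2_measurable[OF L2_test_function(1)[OF \<phi>]] by measurable
  qed (use b in simp)
  from lim(2)[OF this] have 2: "(\<lambda>n. \<integral>x. (g n x \<bullet> b) * \<phi> x \<partial>M) \<longlonglongrightarrow> (\<integral>x. (g' x \<bullet> b) * \<phi> x \<partial>M)"
    by (simp add: L2_inner_def mult.commute)
  from lim(1)[OF L2_test_function(2)[OF \<phi> b]]
  have 1: "(\<lambda>n. - (\<integral>x. (g n x \<bullet> b) * \<phi> x \<partial>M)) \<longlonglongrightarrow> (\<integral>x. v' x * frechet_derivative \<phi> (at x) b \<partial>M)"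
    by (simp add: L2_inner_def H1_pairD(3)[OF z \<phi> b])
  show "(\<integral>x. v' x * frechet_derivative \<phi> (at x) b \<partial>M) = - (\<integral>x. (g' x \<bullet> b) * \<phi> x \<partial>M)"
    by (rule LIMSEQ_unique[OF 1 tendsto_minus[OF 2]])
qed

end

subsection \<open>Minimisation of strongly convex integral functionals\<close>

text \<open>Along the segment from w to z the auxiliary \<open>h\<close> is the potential minus its
  linear and quadratic parts at w; monotonicity of P makes it nondecreasing. The sign of
  \<open>\<delta>\<close> is free: positive values give strong convexity of \<open>A\<close> and of
  the truncated energies, the value - \<open>C\<psi>\<close> gives the semiconvexity of
  \<open>\<psi>\<close>.\<close>

lemma potential_monotone_ge:
  fixes \<Phi> :: "'b::euclidean_space \<Rightarrow> real"
  assumes D: "\<And>z. GDERIV \<Phi> z :> P z"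
    and mono: "\<And>z w. (P z - P w) \<bullet> (z - w) \<ge> \<delta> * (norm (z - w))\<^sup>2"
  shows "\<Phi> z \<ge> \<Phi> w + P w \<bullet> (z - w) + \<delta> / 2 * (norm (z - w))\<^sup>2"
proof -
  define h where "h s = \<Phi> (w + s *\<^sub>R (z - w)) - s * (P w \<bullet> (z - w)) - \<delta> / 2 * s\<^sup>2 * (norm (z - w))\<^sup>2" for s
  have d: "(h has_real_derivative ((P (w + s *\<^sub>R (z - w)) - P w) \<bullet> (z - w) - \<delta> * s * (norm (z - w))\<^sup>2)) (at s)" for s
  proof -
    have "((\<lambda>s. \<Phi> (w + s *\<^sub>R (z - w))) has_derivative (\<lambda>k. (k *\<^sub>R (z - w)) \<bullet> P (w + s *\<^sub>R (z - w)))) (at s)"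
      by (rule has_derivative_compose[of "\<lambda>s. w + s *\<^sub>R (z - w)" "\<lambda>k. k *\<^sub>R (z - w)", OF _ D[unfolded gderiv_def]])
        (auto intro!: derivative_eq_intros)
    moreover have "(\<lambda>k. (k *\<^sub>R (z - w)) \<bullet> P (w + s *\<^sub>R (z - w))) = (*) (P (w + s *\<^sub>R (z - w)) \<bullet> (z - w))"
      by (rule ext) (simp add: inner_commute)
    ultimately have "((\<lambda>s. \<Phi> (w + s *\<^sub>R (z - w))) has_real_derivative (P (w + s *\<^sub>R (z - w)) \<bullet> (z - w))) (at s)"
      by (simp add: has_field_derivative_def)
    then show ?thesis
      unfolding h_def by (auto intro!: derivative_eq_intros simp: inner_diff_left)
  qed
  have "h 0 \<le> h 1"
  proof (rule DERIV_nonneg_imp_nondecreasing[of 0 1 h])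
    fix s :: real assume s: "0 \<le> s" "s \<le> 1"
    have "(P (w + s *\<^sub>R (z - w)) - P w) \<bullet> (z - w) - \<delta> * s * (norm (z - w))\<^sup>2 \<ge> 0"
    proof (cases "s = 0")
      case False
      have "\<delta> * (s\<^sup>2 * (norm (z - w))\<^sup>2) \<le> s * ((P (w + s *\<^sub>R (z - w)) - P w) \<bullet> (z - w))"
        using mono[where z="w + s *\<^sub>R (z - w)" and w=w] by (simp add: power_mult_distrib)
      moreover have "s * (\<delta> * s * (norm (z - w))\<^sup>2) = \<delta> * (s\<^sup>2 * (norm (z - w))\<^sup>2)"
        by (simp add: power2_eq_square)
      ultimately have "s * (\<delta> * s * (norm (z - w))\<^sup>2) \<le> s * ((P (w + s *\<^sub>R (z - w)) - P w) \<bullet> (z - w))"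
        by linarith
      then show ?thesis using s False by (simp add: mult_le_cancel_left)
    qed simp
    with d show "\<exists>y. (h has_real_derivative y) (at s) \<and> 0 \<le> y" by blast
  qed simp
  then show ?thesis by (simp add: h_def)
qed

context bounded_open
begin

lemma L2_Cauchy_Schwarz:
  assumes v: "v \<in> L2_space \<Omega>" and w: "w \<in> L2_space \<Omega>"
  shows "(L2_inner \<Omega> v w)\<^sup>2 \<le> (\<integral>x. (norm (v x))\<^sup>2 \<partial>M) * (\<integral>x. (norm (w x))\<^sup>2 \<partial>M)"
proof -
  let ?A = "\<integral>x. (norm (v x))\<^sup>2 \<partial>M" and ?B = "\<integral>x. (norm (w x))\<^sup>2 \<partial>M"
  define I where "I = L2_inner \<Omega> v w"
  note int = L2_integrable_sq[OF v] L2_integrable_sq[OF w] L2_inner_integrable[OF v w]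
  have q: "0 \<le> ?A - 2 * t * I + t\<^sup>2 * ?B" for t
  proof -
    have "0 \<le> (\<integral>x. (norm (v x - t *\<^sub>R w x))\<^sup>2 \<partial>M)" by simp
    also have "(\<lambda>x. (norm (v x - t *\<^sub>R w x))\<^sup>2) = (\<lambda>x. (norm (v x))\<^sup>2 - 2 * t * (v x \<bullet> w x) + t\<^sup>2 * (norm (w x))\<^sup>2)"
      by (rule ext) (simp add: power2_norm_eq_inner inner_diff_left inner_diff_right inner_commute algebra_simps power2_eq_square[of t])
    also have "(\<integral>x. \<dots> x \<partial>M) = ?A - 2 * t * I + t\<^sup>2 * ?B"
      using int by (simp add: I_def L2_inner_def)
    finally show ?thesis .
  qed
  show ?thesis
  proof (cases "?B = 0")
    case True
    have "I = 0"
    proof (rule ccontr)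
      assume "I \<noteq> 0"
      \<comment> \<open>Without its quadratic term the expression is affine in t, and at this t it
        equals -1.\<close>
      with q[of "(?A + 1) / (2 * I)"] True show False by (simp add: field_simps)
    qed
    then show ?thesis using True by (simp add: I_def)
  next
    case False
    moreover have "0 \<le> ?B" by simp
    ultimately have B: "?B > 0" by linarith
    have "0 \<le> (?A - 2 * (I / ?B) * I + (I / ?B)\<^sup>2 * ?B) * ?B"
      using q[of "I / ?B"] B by (intro mult_nonneg_nonneg) auto
    also have "\<dots> = ?A * ?B - I\<^sup>2" using B by (simp add: field_simps power2_eq_square)
    finally show ?thesis by (simp add: I_def)
  qed
qed

lemma L2_inner_tendsto:
  assumes z: "\<And>n. z n \<in> L2_space \<Omega>" and l: "l \<in> L2_space \<Omega>" and h: "h \<in> L2_space \<Omega>"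
    and lim: "(\<lambda>n. \<integral>x. (norm (z n x - l x))\<^sup>2 \<partial>M) \<longlonglongrightarrow> 0"
  shows "(\<lambda>n. L2_inner \<Omega> (z n) h) \<longlonglongrightarrow> L2_inner \<Omega> l h"
proof -
  let ?H = "\<integral>x. (norm (h x))\<^sup>2 \<partial>M"
  have "(\<lambda>n. sqrt ((\<integral>x. (norm (z n x - l x))\<^sup>2 \<partial>M) * ?H)) \<longlonglongrightarrow> sqrt (0 * ?H)"
    by (intro tendsto_intros lim)
  then have s: "(\<lambda>n. sqrt ((\<integral>x. (norm (z n x - l x))\<^sup>2 \<partial>M) * ?H)) \<longlonglongrightarrow> 0" by simp
  have "(\<lambda>n. L2_inner \<Omega> (z n) h - L2_inner \<Omega> l h) \<longlonglongrightarrow> 0"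
  proof (rule Lim_null_comparison[OF _ s], intro always_eventually allI)
    fix n
    have "L2_inner \<Omega> (z n) h - L2_inner \<Omega> l h = L2_inner \<Omega> (\<lambda>x. z n x - l x) h"
      unfolding L2_inner_def using L2_inner_integrable[OF z h] L2_inner_integrable[OF l h]
      by (simp add: inner_diff_left)
    then show "norm (L2_inner \<Omega> (z n) h - L2_inner \<Omega> l h) \<le> sqrt ((\<integral>x. (norm (z n x - l x))\<^sup>2 \<partial>M) * ?H)"
      using real_sqrt_le_mono[OF L2_Cauchy_Schwarz[OF L2_diff[OF z l] h]] by simp
  qed
  then show ?thesis by (simp add: LIM_zero_iff)
qed

end

text \<open>Strong convexity makes every minimising sequence a Cauchy sequence, so that no weak
  compactness is needed.\<close>

locale strongly_convex_problem = bounded_open \<Omega> for \<Omega> :: "'a::euclidean_space set" +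
  fixes S :: "('a \<Rightarrow> 'b::euclidean_space) set" and \<Phi> :: "'b \<Rightarrow> real" and P :: "'b \<Rightarrow> 'b"
    and \<delta> a b :: real and w :: "'a \<Rightarrow> 'b"
  assumes S_L2: "z \<in> S \<Longrightarrow> z \<in> L2_space \<Omega>"
    and S_zero: "(\<lambda>x. 0) \<in> S"
    and S_add: "z \<in> S \<Longrightarrow> z' \<in> S \<Longrightarrow> (\<lambda>x. z x + z' x) \<in> S"
    and S_scale: "z \<in> S \<Longrightarrow> (\<lambda>x. t *\<^sub>R z x) \<in> S"
    and S_closed: "(\<And>n. zs n \<in> S) \<Longrightarrow> l \<in> L2_space \<Omega> \<Longrightarrow>
        (\<lambda>n. \<integral>x. (norm (zs n x - l x))\<^sup>2 \<partial>lebesgue_on \<Omega>) \<longlonglongrightarrow> 0 \<Longrightarrow> l \<in> S"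
    and potential: "GDERIV \<Phi> p :> P p"
    and P_continuous: "continuous_on UNIV P"
    and P_mono: "(P p - P q) \<bullet> (p - q) \<ge> \<delta> * (norm (p - q))\<^sup>2"
    and \<delta>_pos: "\<delta> > 0" and a_nonneg: "a \<ge> 0" and b_nonneg: "b \<ge> 0"
    and P_growth: "norm (P p) \<le> a + b * norm p"
    and w_L2: "w \<in> L2_space \<Omega>"
begin

definition energy :: "('a \<Rightarrow> 'b) \<Rightarrow> real" where
  "energy z = (\<integral>x. \<Phi> (z x) - w x \<bullet> z x \<partial>M)"

lemma convex: "\<Phi> z \<ge> \<Phi> v + P v \<bullet> (z - v) + \<delta> / 2 * (norm (z - v))\<^sup>2"
  by (rule potential_monotone_ge[OF potential P_mono])

lemma P_borel [measurable]: "P \<in> borel_measurable borel"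
  using P_continuous by (rule borel_measurable_continuous_onI)

lemma \<Phi>_borel [measurable]: "\<Phi> \<in> borel_measurable borel"
proof (rule borel_measurable_continuous_onI)
  show "continuous_on UNIV \<Phi>"
    using potential by (auto simp: gderiv_def intro!: continuous_at_imp_continuous_on has_derivative_continuous)
qed

lemma P_L2:
  assumes "z \<in> L2_space \<Omega>"
  shows "(\<lambda>x. P (z x)) \<in> L2_space \<Omega>"
proof (rule L2_dominated)
  show "(\<lambda>x. a + b * norm (z x)) \<in> L2_space \<Omega>"
    by (intro L2_add L2_const L2_mult L2_norm_space assms)
  show "norm (P (z x)) \<le> norm (a + b * norm (z x))" for x
    using P_growth[of "z x"] a_nonneg b_nonneg by simp
  show "(\<lambda>x. P (z x)) \<in> borel_measurable M"
    using L2_measurable[OF assms] by measurable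
qed

text \<open>The tangent at 0 bounds \<Phi>(z) from below, the tangent at z evaluated at 0 bounds it
  from above, and both bounds are integrable by the linear growth of \<open>P\<close>.\<close>

lemma energy_integrable:
  assumes z: "z \<in> L2_space \<Omega>"
  shows "integrable M (\<lambda>x. \<Phi> (z x) - w x \<bullet> z x)"
proof -
  have "integrable M (\<lambda>x. \<Phi> (z x))"
  proof (rule Bochner_Integration.integrable_bound)
    show "integrable M (\<lambda>x. \<bar>\<Phi> 0\<bar> + \<bar>P 0 \<bullet> z x\<bar> + \<bar>P (z x) \<bullet> z x\<bar>)"
      by (intro Bochner_Integration.integrable_add integrable_abs integrable_const_M
          L2_inner_integrable P_L2 L2_const z)
    show "(\<lambda>x. \<Phi> (z x)) \<in> borel_measurable M" using L2_measurable[OF z] by measurable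
    show "AE x in M. norm (\<Phi> (z x)) \<le> norm (\<bar>\<Phi> 0\<bar> + \<bar>P 0 \<bullet> z x\<bar> + \<bar>P (z x) \<bullet> z x\<bar>)"
    proof (intro AE_I2)
      fix x
      have nn: "0 \<le> \<delta> / 2 * (norm p)\<^sup>2" for p :: 'b using \<delta>_pos by simp
      have "\<Phi> (z x) \<ge> \<Phi> 0 + P 0 \<bullet> z x" using convex[of 0 "z x"] nn[of "z x"] by simp
      moreover have "\<Phi> 0 \<ge> \<Phi> (z x) - P (z x) \<bullet> z x"
        using convex[of "z x" 0] nn[of "z x"] by (simp add: inner_diff_right)
      ultimately show "norm (\<Phi> (z x)) \<le> norm (\<bar>\<Phi> 0\<bar> + \<bar>P 0 \<bullet> z x\<bar> + \<bar>P (z x) \<bullet> z x\<bar>)" by simp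
    qed
  qed
  then show ?thesis using L2_inner_integrable[OF w_L2 z] by simp
qed

lemma energy_convex:
  assumes z: "z \<in> L2_space \<Omega>" and v: "v \<in> L2_space \<Omega>"
  shows "energy v \<ge> energy z + L2_inner \<Omega> (\<lambda>x. P (z x) - w x) (\<lambda>x. v x - z x)
      + \<delta> / 2 * (\<integral>x. (norm (v x - z x))\<^sup>2 \<partial>M)"
proof -
  note int = energy_integrable[OF z] L2_inner_integrable[OF L2_diff[OF P_L2[OF z] w_L2] L2_diff[OF v z]]
    L2_integrable_sq[OF L2_diff[OF v z]]
  have "energy z + L2_inner \<Omega> (\<lambda>x. P (z x) - w x) (\<lambda>x. v x - z x) + \<delta> / 2 * (\<integral>x. (norm (v x - z x))\<^sup>2 \<partial>M)
    = (\<integral>x. (\<Phi> (z x) - w x \<bullet> z x) + (P (z x) - w x) \<bullet> (v x - z x) + \<delta> / 2 * (norm (v x - z x))\<^sup>2 \<partial>M)"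
    unfolding energy_def L2_inner_def using int by simp
  also have "\<dots> \<le> energy v"
    unfolding energy_def
  proof (rule integral_mono)
    show "integrable M (\<lambda>x. (\<Phi> (z x) - w x \<bullet> z x) + (P (z x) - w x) \<bullet> (v x - z x) + \<delta> / 2 * (norm (v x - z x))\<^sup>2)"
      using int by simp
    show "integrable M (\<lambda>x. \<Phi> (v x) - w x \<bullet> v x)" by (rule energy_integrable[OF v])
    fix x
    show "(\<Phi> (z x) - w x \<bullet> z x) + (P (z x) - w x) \<bullet> (v x - z x) + \<delta> / 2 * (norm (v x - z x))\<^sup>2 \<le> \<Phi> (v x) - w x \<bullet> v x"
      using convex[of "z x" "v x"] by (simp add: inner_diff_left inner_diff_right)
  qed
  finally show ?thesis .
qed

text \<open>The tangent at zero leaves a linear term in v, which Young's inequality with weight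
  \<delta> / 2 absorbs into the quadratic part.\<close>

lemma energy_bdd_below: "\<exists>c. \<forall>v\<in>S. c \<le> energy v"
proof -
  let ?h = "\<lambda>x. P 0 - w x"
  have hL: "?h \<in> L2_space \<Omega>" by (intro L2_diff L2_const w_L2)
  have "energy (\<lambda>x. 0) - (\<integral>x. (norm (?h x))\<^sup>2 \<partial>M) / (2 * \<delta>) \<le> energy v" if "v \<in> S" for v
  proof -
    note v = S_L2[OF that]
    have "- ((\<integral>x. (norm (?h x))\<^sup>2 \<partial>M) / (2 * \<delta>)) \<le> L2_inner \<Omega> ?h v + \<delta> / 2 * (\<integral>x. (norm (v x))\<^sup>2 \<partial>M)"
    proof -
      have "(\<integral>x. - ((norm (?h x))\<^sup>2 / (2 * \<delta>)) \<partial>M) \<le> (\<integral>x. ?h x \<bullet> v x + \<delta> / 2 * (norm (v x))\<^sup>2 \<partial>M)"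
      proof (rule integral_mono)
        fix x
        have "norm (v x) * norm (?h x) \<le> \<delta> / 2 * (norm (v x))\<^sup>2 + (norm (?h x))\<^sup>2 / (4 * (\<delta> / 2))"
          using \<delta>_pos by (intro young) simp
        moreover have "\<bar>?h x \<bullet> v x\<bar> \<le> norm (?h x) * norm (v x)" by (rule Cauchy_Schwarz_ineq2)
        ultimately show "- ((norm (?h x))\<^sup>2 / (2 * \<delta>)) \<le> ?h x \<bullet> v x + \<delta> / 2 * (norm (v x))\<^sup>2"
          by (simp add: mult.commute)
      qed (use L2_integrable_sq[OF hL] L2_integrable_sq[OF v] L2_inner_integrable[OF hL v] in auto)
      then show ?thesis
        using L2_integrable_sq[OF hL] L2_integrable_sq[OF v] L2_inner_integrable[OF hL v]
        by (simp add: L2_inner_def)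
    qed
    then show ?thesis using energy_convex[OF L2_const[of 0] v] by simp
  qed
  then show ?thesis by blast
qed

text \<open>Expanding the energy at the midpoint of u and v, the first order terms cancel and the
  quadratic ones add up to \<delta> / 4 times the squared distance; this is the Cauchy estimate. The
  quadratic growth in the last conclusion is what allows minimisers of different functionals to be
  compared.\<close>

theorem minimizer_exists:
  obtains z where "z \<in> S" "\<And>\<phi>. \<phi> \<in> S \<Longrightarrow> L2_inner \<Omega> (\<lambda>x. P (z x)) \<phi> = L2_inner \<Omega> w \<phi>"
    "\<And>v. v \<in> S \<Longrightarrow> energy v \<ge> energy z + \<delta> / 2 * (\<integral>x. (norm (v x - z x))\<^sup>2 \<partial>M)"
proof -
  define m where "m = Inf (energy ` S)"
  have bdd: "bdd_below (energy ` S)" using energy_bdd_below by (auto simp: bdd_below_def)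
  have m_le: "m \<le> energy v" if "v \<in> S" for v
    unfolding m_def using bdd that by (intro cInf_lower) auto
  have near: "\<exists>v\<in>S. energy v < m + e" if "e > 0" for e
  proof -
    have "Inf (energy ` S) < m + e" using that by (simp add: m_def)
    then show ?thesis using cInf_lessD[of "energy ` S"] S_zero by blast
  qed
  have dist: "\<delta> / 4 * (\<integral>x. (norm (u x - v x))\<^sup>2 \<partial>M) \<le> energy u + energy v - 2 * m" if u: "u \<in> S" and v: "v \<in> S" for u v
  proof -
    define c where "c x = (1/2) *\<^sub>R (u x + v x)" for x
    have cS: "c \<in> S" unfolding c_def using S_scale[OF S_add[OF u v]] .
    define h where "h x = P (c x) - w x" for x
    have hL: "h \<in> L2_space \<Omega>" unfolding h_def by (intro L2_diff P_L2 w_L2 S_L2 cS)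
    have d: "u x - c x = (1/2) *\<^sub>R (u x - v x)" "v x - c x = (-1/2) *\<^sub>R (u x - v x)" for x
    proof -
      have "u x = (1/2) *\<^sub>R u x + (1/2) *\<^sub>R u x" "v x = (1/2) *\<^sub>R v x + (1/2) *\<^sub>R v x"
        by (simp_all flip: scaleR_left_distrib)
      then show "u x - c x = (1/2) *\<^sub>R (u x - v x)" "v x - c x = (-1/2) *\<^sub>R (u x - v x)"
        by (simp_all add: c_def algebra_simps)
    qed
    have "energy u \<ge> energy c + L2_inner \<Omega> h (\<lambda>x. (1/2) *\<^sub>R (u x - v x)) + \<delta> / 2 * (\<integral>x. (norm ((1/2) *\<^sub>R (u x - v x)))\<^sup>2 \<partial>M)"
      using energy_convex[OF S_L2[OF cS] S_L2[OF u]] unfolding d h_def .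
    moreover have "energy v \<ge> energy c + L2_inner \<Omega> h (\<lambda>x. (-1/2) *\<^sub>R (u x - v x)) + \<delta> / 2 * (\<integral>x. (norm ((-1/2) *\<^sub>R (u x - v x)))\<^sup>2 \<partial>M)"
      using energy_convex[OF S_L2[OF cS] S_L2[OF v]] unfolding d h_def .
    ultimately show ?thesis using m_le[OF cS] by (simp add: L2_inner_def power_divide)
  qed
  have "\<forall>n. \<exists>v. v \<in> S \<and> energy v < m + 1 / real (Suc n)"
  proof
    fix n show "\<exists>v. v \<in> S \<and> energy v < m + 1 / real (Suc n)"
      using near[of "1 / real (Suc n)"] by auto
  qed
  then have "\<exists>z. \<forall>n. z n \<in> S \<and> energy (z n) < m + 1 / real (Suc n)"
    by (rule choice)
  then obtain z where z: "\<And>n. z n \<in> S" "\<And>n. energy (z n) < m + 1 / real (Suc n)" by blast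
  obtain l r where l: "l \<in> L2_space \<Omega>" "(\<lambda>n. \<integral>x. (norm (z n x - l x))\<^sup>2 \<partial>M) \<longlonglongrightarrow> 0"
  proof (rule L2_complete[of z])
    show "z n \<in> L2_space \<Omega>" for n by (rule S_L2[OF z(1)])
    fix e :: real assume e: "e > 0"
    \<comment> \<open>Two members of the sequence together exceed 2 m by less than 2 / (n0 + 1),
      which has to stay below e \<delta> / 4.\<close>
    obtain n0 where n0: "1 / real (Suc n0) < e * \<delta> / 8"
      using nat_approx_posE[of "e * \<delta> / 8"] e \<delta>_pos by auto
    have "(\<integral>x. (norm (z i x - z j x))\<^sup>2 \<partial>M) \<le> e" if "i \<ge> n0" "j \<ge> n0" for i j
    proof -
      have "1 / real (Suc i) \<le> 1 / real (Suc n0)" "1 / real (Suc j) \<le> 1 / real (Suc n0)"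
        using that by (auto simp: frac_le)
      then have "\<delta> / 4 * (\<integral>x. (norm (z i x - z j x))\<^sup>2 \<partial>M) \<le> \<delta> / 4 * e"
        using dist[OF z(1)[of i] z(1)[of j]] z(2)[of i] z(2)[of j] n0 by (simp add: mult.commute)
      then show ?thesis using \<delta>_pos by (simp add: mult_le_cancel_left)
    qed
    then show "\<exists>n0. \<forall>m\<ge>n0. \<forall>n\<ge>n0. (\<integral>x. (norm (z m x - z n x))\<^sup>2 \<partial>M) \<le> e" by blast
  qed blast
  have lS: "l \<in> S" by (rule S_closed[OF z(1) l])
  \<comment> \<open>Lower semicontinuity is read off the tangent inequality at \<open>l\<close>: its
    linear term converges to zero along the sequence.\<close>
  have min: "energy l \<le> m"
  proof -
    define h where "h x = P (l x) - w x" for x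
    have hL: "h \<in> L2_space \<Omega>" unfolding h_def by (intro L2_diff P_L2 w_L2 l)
    have "(\<lambda>n. L2_inner \<Omega> (z n) h) \<longlonglongrightarrow> L2_inner \<Omega> l h"
      by (rule L2_inner_tendsto[OF S_L2[OF z(1)] l(1) hL l(2)])
    then have "(\<lambda>n. m + 1 / real (Suc n) - (L2_inner \<Omega> (z n) h - L2_inner \<Omega> l h)) \<longlonglongrightarrow> m + 0 - (L2_inner \<Omega> l h - L2_inner \<Omega> l h)"
      using LIMSEQ_inverse_real_of_nat by (intro tendsto_intros) (auto simp: inverse_eq_divide)
    moreover have "energy l \<le> m + 1 / real (Suc n) - (L2_inner \<Omega> (z n) h - L2_inner \<Omega> l h)" for n
    proof -
      have "L2_inner \<Omega> h (\<lambda>x. z n x - l x) = L2_inner \<Omega> (z n) h - L2_inner \<Omega> l h"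
        using L2_inner_integrable[OF S_L2[OF z(1)[of n]] hL] L2_inner_integrable[OF l(1) hL]
        by (simp add: L2_inner_def inner_diff_right inner_commute[of "h _"])
      moreover have "0 \<le> \<delta> / 2 * (\<integral>x. (norm (z n x - l x))\<^sup>2 \<partial>M)" using \<delta>_pos by simp
      ultimately show ?thesis
        using energy_convex[OF l(1) S_L2[OF z(1)[of n]]] z(2)[of n] unfolding h_def[abs_def, symmetric] by linarith
    qed
    ultimately show ?thesis by (intro LIMSEQ_le_const) auto
  qed
  \<comment> \<open>The convexity inequality is used at the perturbed point \<open>y n\<close> and
    not at \<open>l\<close>. Combined with minimality of \<open>l\<close> it gives the sign for each
    n, and then only \<open>P\<close> has to be taken to the limit.\<close>
  have dir: "L2_inner \<Omega> (\<lambda>x. P (l x) - w x) \<phi> \<ge> 0" if \<phi>S: "\<phi> \<in> S" for \<phi>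
  proof -
    note \<phi> = S_L2[OF \<phi>S]
    define t where "t n = 1 / real (Suc n)" for n
    have t: "0 < t n" "t n \<le> 1" for n by (auto simp: t_def)
    have t0: "t \<longlonglongrightarrow> 0" using LIMSEQ_inverse_real_of_nat by (simp add: t_def[abs_def] inverse_eq_divide)
    define y where "y n x = l x + t n *\<^sub>R \<phi> x" for n x
    have yS: "y n \<in> S" for n unfolding y_def by (intro S_add lS S_scale \<phi>S)
    note yL = S_L2[OF yS]
    have ge: "L2_inner \<Omega> (\<lambda>x. P (y n x) - w x) \<phi> \<ge> 0" for n
    proof -
      have "energy l \<ge> energy (y n) + L2_inner \<Omega> (\<lambda>x. P (y n x) - w x) (\<lambda>x. l x - y n x)
          + \<delta> / 2 * (\<integral>x. (norm (l x - y n x))\<^sup>2 \<partial>M)" by (rule energy_convex[OF yL l(1)])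
      moreover have "0 \<le> \<delta> / 2 * (\<integral>x. (norm (l x - y n x))\<^sup>2 \<partial>M)" using \<delta>_pos by simp
      moreover have "L2_inner \<Omega> (\<lambda>x. P (y n x) - w x) (\<lambda>x. l x - y n x) = - t n * L2_inner \<Omega> (\<lambda>x. P (y n x) - w x) \<phi>"
        by (simp add: L2_inner_def y_def)
      ultimately have "0 \<le> t n * L2_inner \<Omega> (\<lambda>x. P (y n x) - w x) \<phi>"
        using m_le[OF yS[of n]] min by linarith
      then show ?thesis using t(1)[of n] by (simp add: zero_le_mult_iff)
    qed
    have "(\<lambda>n. L2_inner \<Omega> (\<lambda>x. P (y n x) - w x) \<phi>) \<longlonglongrightarrow> L2_inner \<Omega> (\<lambda>x. P (l x) - w x) \<phi>"
      unfolding L2_inner_def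
    proof (rule integral_dominated_convergence[where w="\<lambda>x. (a + b * norm (l x) + b * norm (\<phi> x) + norm (w x)) * norm (\<phi> x)"])
      have m[measurable]: "l \<in> borel_measurable M" "\<phi> \<in> borel_measurable M" "w \<in> borel_measurable M"
        using l(1) \<phi> w_L2 L2_measurable by auto
      show "(\<lambda>x. (P (l x) - w x) \<bullet> \<phi> x) \<in> borel_measurable M" by measurable
      show "(\<lambda>x. (P (y n x) - w x) \<bullet> \<phi> x) \<in> borel_measurable M" for n unfolding y_def by measurable
      show "integrable M (\<lambda>x. (a + b * norm (l x) + b * norm (\<phi> x) + norm (w x)) * norm (\<phi> x))"
        by (intro L2_mult_integrable L2_add L2_const L2_mult L2_norm_space l \<phi> w_L2)
      show "AE x in M. (\<lambda>n. (P (y n x) - w x) \<bullet> \<phi> x) \<longlonglongrightarrow> (P (l x) - w x) \<bullet> \<phi> x"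
      proof (intro AE_I2 tendsto_inner tendsto_diff tendsto_const)
        fix x
        have "(\<lambda>n. y n x) \<longlonglongrightarrow> l x + 0 *\<^sub>R \<phi> x" unfolding y_def by (intro tendsto_intros t0)
        moreover have "isCont P (l x)" using P_continuous by (simp add: continuous_on_eq_continuous_at)
        ultimately show "(\<lambda>n. P (y n x)) \<longlonglongrightarrow> P (l x)" using isCont_tendsto_compose by force
      qed
      show "AE x in M. norm ((P (y n x) - w x) \<bullet> \<phi> x) \<le> (a + b * norm (l x) + b * norm (\<phi> x) + norm (w x)) * norm (\<phi> x)" for n
      proof (intro AE_I2)
        fix x
        have "norm ((P (y n x) - w x) \<bullet> \<phi> x) \<le> norm (P (y n x) - w x) * norm (\<phi> x)"
          using Cauchy_Schwarz_ineq2 by simp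
        also have "\<dots> \<le> (a + b * norm (l x) + b * norm (\<phi> x) + norm (w x)) * norm (\<phi> x)"
        proof (rule mult_right_mono)
          have "norm (y n x) \<le> norm (l x) + norm (t n *\<^sub>R \<phi> x)" unfolding y_def by (rule norm_triangle_ineq)
          also have "norm (t n *\<^sub>R \<phi> x) \<le> norm (\<phi> x)"
            using t[of n] by (simp add: mult_left_le_one_le)
          finally have "b * norm (y n x) \<le> b * (norm (l x) + norm (\<phi> x))"
            using b_nonneg by (intro mult_left_mono) auto
          then have "norm (P (y n x)) \<le> a + b * norm (l x) + b * norm (\<phi> x)"
            using P_growth[of "y n x"] by (simp add: distrib_left)
          then show "norm (P (y n x) - w x) \<le> a + b * norm (l x) + b * norm (\<phi> x) + norm (w x)"
            using norm_triangle_ineq4[of "P (y n x)" "w x"] by linarith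
        qed simp
        finally show "norm ((P (y n x) - w x) \<bullet> \<phi> x) \<le> (a + b * norm (l x) + b * norm (\<phi> x) + norm (w x)) * norm (\<phi> x)" .
      qed
    qed
    then show ?thesis using ge by (intro LIMSEQ_le_const) auto
  qed
  have EL0: "L2_inner \<Omega> (\<lambda>x. P (l x) - w x) \<phi> = 0" if "\<phi> \<in> S" for \<phi>
    using dir[OF that] dir[OF S_scale[OF that, of "-1"]] by (simp add: L2_inner_def)
  show ?thesis
  proof (rule that[OF lS])
    fix \<phi> assume \<phi>: "\<phi> \<in> S"
    then show "L2_inner \<Omega> (\<lambda>x. P (l x)) \<phi> = L2_inner \<Omega> w \<phi>"
      using EL0[OF \<phi>] L2_inner_integrable[OF P_L2[OF l(1)] S_L2[OF \<phi>]] L2_inner_integrable[OF w_L2 S_L2[OF \<phi>]]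
      by (simp add: L2_inner_def inner_diff_left)
  next
    fix v assume v: "v \<in> S"
    have "(\<lambda>x. v x + (-1) *\<^sub>R l x) \<in> S" by (intro S_add S_scale v lS)
    then have "L2_inner \<Omega> (\<lambda>x. P (l x) - w x) (\<lambda>x. v x - l x) = 0" using EL0 by simp
    then show "energy v \<ge> energy l + \<delta> / 2 * (\<integral>x. (norm (v x - l x))\<^sup>2 \<partial>M)"
      using energy_convex[OF l(1) S_L2[OF v]] by simp
  qed
qed

end

subsection \<open>The equation of a single time step\<close>

lemma continuous_antiderivative:
  fixes \<gamma> :: "real \<Rightarrow> real"
  assumes "continuous_on UNIV \<gamma>"
  obtains \<Gamma> where "\<And>s. (\<Gamma> has_real_derivative \<gamma> s) (at s)"
proof -
  have "\<exists>F. \<forall>x::real. -\<infinity> < ereal x \<longrightarrow> ereal x < \<infinity> \<longrightarrow> (F has_vector_derivative \<gamma> x) (at x)"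
    using assms by (intro einterval_antiderivative) (auto simp: continuous_on_eq_continuous_at)
  then show ?thesis using that by (auto simp: has_real_derivative_iff_has_vector_derivative)
qed

definition clamp_real :: "real \<Rightarrow> real \<Rightarrow> real" where
  "clamp_real k s = max (- k) (min k s)"

lemma clamp_real_bound: "0 \<le> k \<Longrightarrow> \<bar>clamp_real k s\<bar> \<le> k"
  by (auto simp: clamp_real_def)

lemma clamp_real_mono: "s \<le> t \<Longrightarrow> clamp_real k s \<le> clamp_real k t"
  by (auto simp: clamp_real_def)

lemma clamp_real_eq: "\<bar>s\<bar> \<le> k \<Longrightarrow> clamp_real k s = s"
  by (auto simp: clamp_real_def)

text \<open>For nonnegative \<open>k\<close> the clamped value has the sign of s, or is zero, and
  does not exceed s in absolute value.\<close>

lemma clamp_real_square_le: "0 \<le> k \<Longrightarrow> (clamp_real k s)\<^sup>2 \<le> s * clamp_real k s"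
proof -
  assume k: "0 \<le> k"
  consider "\<bar>s\<bar> \<le> k" | "s > k" | "s < - k" by linarith
  then show ?thesis
  proof cases
    case 2
    then have "clamp_real k s = k" using k by (auto simp: clamp_real_def)
    then show ?thesis using 2 k by (simp add: power2_eq_square mult_right_mono)
  next
    case 3
    then have "clamp_real k s = - k" using k by (auto simp: clamp_real_def)
    moreover have "k * k \<le> (- s) * k" using 3 k by (intro mult_right_mono) auto
    ultimately show ?thesis by (simp add: power2_eq_square)
  qed (simp add: clamp_real_eq power2_eq_square)
qed

lemma continuous_clamp_real: "continuous_on S f \<Longrightarrow> continuous_on S (\<lambda>x. clamp_real k (f x))"
  unfolding clamp_real_def by (intro continuous_intros)

text \<open>\<open>\<psi>'_semimono\<close> is the form in which the lower bound on the second
  derivatives of the approximations survives in the limit \<open>\<psi>\<close>, which is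
  differentiable only once.\<close>

locale discrete_step = bounded_open \<Omega> for \<Omega> :: "'a::euclidean_space set" +
  fixes A :: "'a \<Rightarrow> real" and A' :: "'a \<Rightarrow> 'a" and CA CA_bar :: real
    and \<psi> \<psi>' :: "real \<Rightarrow> real" and C\<psi> m\<psi> :: real
  assumes A_deriv: "GDERIV A p :> A' p" and A'_continuous: "continuous_on UNIV A'"
    and CA_pos: "CA > 0" and CA_bar_pos: "CA_bar > 0"
    and A'_mono: "(A' p - A' q) \<bullet> (p - q) \<ge> CA * (norm (p - q))\<^sup>2"
    and A'_growth: "norm (A' p) \<le> CA_bar * norm p"
    and \<psi>_deriv: "(\<psi> has_real_derivative \<psi>' s) (at s)" and \<psi>'_continuous: "continuous_on UNIV \<psi>'"
    and \<psi>_bound: "m\<psi> \<le> \<psi> s"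
    and C\<psi>_nonneg: "C\<psi> \<ge> 0"
    and \<psi>'_semimono: "(\<psi>' s - \<psi>' t) * (s - t) \<ge> - C\<psi> * (s - t)\<^sup>2"
begin

lemma A'_0: "A' 0 = 0"
  using A'_growth[of 0] by simp

lemma A'_inner_ge: "A' p \<bullet> p \<ge> CA * (norm p)\<^sup>2"
  using A'_mono[of p 0] by (simp add: A'_0)

lemma A'_inner_nonneg: "A' p \<bullet> p \<ge> 0"
  using A'_inner_ge[of p] CA_pos by (meson less_imp_le mult_nonneg_nonneg order_trans zero_le_power2)

lemma A_convex: "A p \<ge> A q + A' q \<bullet> (p - q) + CA / 2 * (norm (p - q))\<^sup>2"
  by (rule potential_monotone_ge[OF A_deriv A'_mono])

text \<open>Lower bound: the tangent at 0, where \<open>A'\<close> vanishes. Upper bound: the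
  tangent at p evaluated at 0, with the growth of \<open>A'\<close>.\<close>

lemma A_bounds: "A p \<ge> A 0 + CA / 2 * (norm p)\<^sup>2" "A p \<le> A 0 + CA_bar * (norm p)\<^sup>2"
proof -
  show "A p \<ge> A 0 + CA / 2 * (norm p)\<^sup>2" using A_convex[of 0 p] by (simp add: A'_0)
  have "A p \<le> A 0 + A' p \<bullet> p - CA / 2 * (norm p)\<^sup>2"
    using A_convex[of p 0] by (simp add: inner_diff_right)
  moreover have "0 \<le> CA / 2 * (norm p)\<^sup>2" using CA_pos by simp
  moreover have "A' p \<bullet> p \<le> norm (A' p) * norm p" by (rule norm_cauchy_schwarz)
  moreover have "norm (A' p) * norm p \<le> CA_bar * norm p * norm p"
    by (intro mult_right_mono A'_growth) auto
  ultimately show "A p \<le> A 0 + CA_bar * (norm p)\<^sup>2" by (simp add: power2_eq_square)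
qed

lemma A'_borel [measurable]: "A' \<in> borel_measurable borel"
  using A'_continuous by (rule borel_measurable_continuous_onI)

lemma A_borel [measurable]: "A \<in> borel_measurable borel"
proof (rule borel_measurable_continuous_onI)
  show "continuous_on UNIV A"
    using A_deriv by (auto simp: gderiv_def intro!: continuous_at_imp_continuous_on has_derivative_continuous)
qed

lemma \<psi>'_borel [measurable]: "\<psi>' \<in> borel_measurable borel"
  using \<psi>'_continuous by (rule borel_measurable_continuous_onI)

lemma \<psi>_borel [measurable]: "\<psi> \<in> borel_measurable borel"
proof (rule borel_measurable_continuous_onI)
  show "continuous_on UNIV \<psi>" using \<psi>_deriv DERIV_isCont continuous_at_imp_continuous_on by blast
qed

lemma A'_L2:
  assumes "g \<in> L2_space \<Omega>"
  shows "(\<lambda>x. A' (g x)) \<in> L2_space \<Omega>"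
proof (rule L2_dominated)
  show "(\<lambda>x. CA_bar *\<^sub>R g x) \<in> L2_space \<Omega>" by (intro L2_scaleR assms)
  show "(\<lambda>x. A' (g x)) \<in> borel_measurable M" using L2_measurable[OF assms] by measurable
  show "norm (A' (g x)) \<le> norm (CA_bar *\<^sub>R g x)" for x using A'_growth[of "g x"] CA_bar_pos by simp
qed

lemma A_integrable:
  assumes "g \<in> L2_space \<Omega>"
  shows "integrable M (\<lambda>x. A (g x))"
proof (rule Bochner_Integration.integrable_bound)
  show "integrable M (\<lambda>x. \<bar>A 0\<bar> + CA_bar * (norm (g x))\<^sup>2)"
    using L2_integrable_sq[OF assms] by simp
  show "(\<lambda>x. A (g x)) \<in> borel_measurable M" using L2_measurable[OF assms] by measurable
  show "AE x in M. norm (A (g x)) \<le> norm (\<bar>A 0\<bar> + CA_bar * (norm (g x))\<^sup>2)"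
  proof (intro AE_I2)
    fix x
    have "0 \<le> CA / 2 * (norm (g x))\<^sup>2" "0 \<le> CA_bar * (norm (g x))\<^sup>2" using CA_pos CA_bar_pos by simp_all
    then show "norm (A (g x)) \<le> norm (\<bar>A 0\<bar> + CA_bar * (norm (g x))\<^sup>2)"
      using A_bounds[of "g x"] by simp
  qed
qed

text \<open>Since \<open>\<gamma>\<close> is merely continuous, \<open>\<gamma>(v)\<close> need not lie in \<open>H\<^sup>1\<close>; it is approximated by
  \<open>G n (v)\<close> with the continuously differentiable averages \<open>G n\<close> of \<open>\<gamma>\<close> over \<open>[s, s + 1/n]\<close>.\<close>

lemma monotone_test:
  assumes p: "H1_pair v g" and \<gamma>: "continuous_on UNIV \<gamma>" "mono \<gamma>" "\<And>s. \<bar>\<gamma> s\<bar> \<le> K"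
    and r: "\<And>\<phi> k. H1_pair \<phi> k \<Longrightarrow> integrable M (\<lambda>x. r x * \<phi> x)"
    and eq: "\<And>\<phi> k. H1_pair \<phi> k \<Longrightarrow> L2_inner \<Omega> (\<lambda>x. A' (g x)) k + (\<integral>x. r x * \<phi> x \<partial>M) = 0"
  shows "integrable M (\<lambda>x. r x * \<gamma> (v x))" "(\<integral>x. r x * \<gamma> (v x) \<partial>M) \<le> 0"
proof -
  have [measurable]: "v \<in> borel_measurable M" using H1_pairD(1)[OF p] L2_measurable by blast
  have [measurable]: "\<gamma> \<in> borel_measurable borel" using \<gamma>(1) by (rule borel_measurable_continuous_onI)
  have r1: "integrable M r" using r[OF H1_pair_const[of 1]] by simp
  then have [measurable]: "r \<in> borel_measurable M" by simp
  have rb: "integrable M (\<lambda>x. K * \<bar>r x\<bar>)" using r1 by simp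
  have rle: "norm (r x * t) \<le> K * \<bar>r x\<bar>" if "\<bar>t\<bar> \<le> K" for x t
    using mult_left_mono[OF that abs_ge_zero[of "r x"]] by (simp add: abs_mult mult.commute)
  show i: "integrable M (\<lambda>x. r x * \<gamma> (v x))"
    by (rule Bochner_Integration.integrable_bound[OF rb]) (use rle \<gamma>(3) in \<open>auto intro!: AE_I2 order_trans[OF _ abs_ge_self]\<close>)
  obtain \<Gamma> where \<Gamma>: "\<And>s. (\<Gamma> has_real_derivative \<gamma> s) (at s)"
    by (rule continuous_antiderivative[OF \<gamma>(1)]) blast
  define e where "e n = 1 / real (Suc n)" for n
  have e: "e n > 0" for n by (simp add: e_def)
  define G where "G n s = (\<Gamma> (s + e n) - \<Gamma> s) / e n" for n s
  define G' where "G' n s = (\<gamma> (s + e n) - \<gamma> s) / e n" for n s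
  have G: "(G n has_real_derivative G' n s) (at s)" for n s
  proof -
    have "((\<lambda>s. \<Gamma> (s + e n)) has_real_derivative \<gamma> (s + e n)) (at s)"
      using \<Gamma>[of "s + e n"] by (simp add: DERIV_shift)
    then show ?thesis unfolding G_def[abs_def] G'_def by (intro DERIV_cdivide DERIV_diff \<Gamma>)
  qed
  have G'_cont: "continuous_on UNIV (G' n)" for n
    unfolding G'_def[abs_def] using e[of n]
    by (auto intro!: continuous_intros continuous_on_compose2[OF \<gamma>(1)])
  have G'_nonneg: "G' n s \<ge> 0" for n s
    unfolding G'_def using e[of n] monoD[OF \<gamma>(2), of s "s + e n"] by simp
  have G'_le: "\<bar>G' n s\<bar> \<le> 2 * K / e n" for n s
    unfolding G'_def using e[of n] \<gamma>(3)[of s] \<gamma>(3)[of "s + e n"] by (simp add: abs_divide divide_right_mono)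
  have G_mvt: "\<exists>t. s < t \<and> t < s + e n \<and> G n s = \<gamma> t" for n s
  proof -
    obtain t where "s < t" "t < s + e n" "\<Gamma> (s + e n) - \<Gamma> s = (s + e n - s) * \<gamma> t"
      using MVT2[of s "s + e n" \<Gamma> \<gamma>] \<Gamma> e[of n] by auto
    then show ?thesis using e[of n] by (intro exI[of _ t]) (simp add: G_def)
  qed
  \<comment> \<open>By the mean value theorem each average is a value of \<open>\<gamma>\<close>.
    This bound is uniform in n, unlike that on \<open>G' n\<close>, and is what the dominated
    convergence below relies on.\<close>
  have G_bound: "\<bar>G n s\<bar> \<le> K" for n s using G_mvt[of s n] \<gamma>(3) by metis
  have Gpair: "H1_pair (\<lambda>x. G n (v x)) (\<lambda>x. G' n (v x) *\<^sub>R g x)" for n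
    by (rule H1_pair_chain[OF p G G'_cont G'_le])
  have le: "(\<integral>x. r x * G n (v x) \<partial>M) \<le> 0" for n
  proof -
    \<comment> \<open>Monotonicity of \<open>\<gamma>\<close> enters here: the integrand is the
      nonnegative \<open>G' n\<close> times the nonnegative product of \<open>A' (g x)\<close> and
      \<open>g x\<close>.\<close>
    have "0 \<le> L2_inner \<Omega> (\<lambda>x. A' (g x)) (\<lambda>x. G' n (v x) *\<^sub>R g x)"
      unfolding L2_inner_def by (intro Bochner_Integration.integral_nonneg) (simp add: G'_nonneg A'_inner_nonneg)
    then show ?thesis using eq[OF Gpair, of n] by simp
  qed
  have "(\<lambda>n. \<integral>x. r x * G n (v x) \<partial>M) \<longlonglongrightarrow> (\<integral>x. r x * \<gamma> (v x) \<partial>M)"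
  proof (rule integral_dominated_convergence[OF _ _ rb])
    show "(\<lambda>x. r x * \<gamma> (v x)) \<in> borel_measurable M" by measurable
    show "(\<lambda>x. r x * G n (v x)) \<in> borel_measurable M" for n
      by (rule borel_measurable_integrable[OF r[OF Gpair]])
    show "AE x in M. norm (r x * G n (v x)) \<le> K * \<bar>r x\<bar>" for n
      using rle G_bound by (intro AE_I2) blast
    show "AE x in M. (\<lambda>n. r x * G n (v x)) \<longlonglongrightarrow> r x * \<gamma> (v x)"
    proof (intro AE_I2 tendsto_mult tendsto_const)
      fix x
      have e0: "e \<longlonglongrightarrow> 0" using LIMSEQ_inverse_real_of_nat by (simp add: e_def[abs_def] inverse_eq_divide)
      have f: "filterlim e (at 0) sequentially"
        unfolding filterlim_at using e0 e by (auto simp: less_imp_neq[symmetric])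
      have "((\<lambda>h. (\<Gamma> (v x + h) - \<Gamma> (v x)) / h) \<longlongrightarrow> \<gamma> (v x)) (at 0)"
        using \<Gamma>[of "v x"] by (simp add: DERIV_def)
      from filterlim_compose[OF this f] show "(\<lambda>n. G n (v x)) \<longlonglongrightarrow> \<gamma> (v x)"
        by (simp add: G_def)
    qed
  qed
  then show "(\<integral>x. r x * \<gamma> (v x) \<partial>M) \<le> 0"
    using le by (intro LIMSEQ_le_const2) auto
qed

text \<open>Only bounded functions of v are admissible in \<open>monotone_test\<close>, so
  \<open>\<beta>\<close> is clamped to \<open>\<gamma> k\<close>. The square of
  \<open>\<gamma> k\<close> is at most \<open>\<gamma> k\<close> times \<open>\<beta>\<close>, the
  sign of the elliptic part bounds the integral of that product by the one with \<open>h\<close>,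
  and Young absorbs half. Fatou then removes the level k.\<close>

lemma monotone_term_L2:
  assumes p: "H1_pair v g" and \<beta>: "continuous_on UNIV \<beta>" "mono \<beta>" and h: "h \<in> L2_space \<Omega>"
    and int: "\<And>\<phi> k. H1_pair \<phi> k \<Longrightarrow> integrable M (\<lambda>x. \<beta> (v x) * \<phi> x)"
    and eq: "\<And>\<phi> k. H1_pair \<phi> k \<Longrightarrow>
      L2_inner \<Omega> (\<lambda>x. A' (g x)) k + (\<integral>x. \<beta> (v x) * \<phi> x \<partial>M) = (\<integral>x. h x * \<phi> x \<partial>M)"
  shows "(\<lambda>x. \<beta> (v x)) \<in> L2_space \<Omega>" "(\<integral>x. (\<beta> (v x))\<^sup>2 \<partial>M) \<le> (\<integral>x. (h x)\<^sup>2 \<partial>M)"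
proof -
  have [measurable]: "v \<in> borel_measurable M" using H1_pairD(1)[OF p] L2_measurable by blast
  have [measurable]: "\<beta> \<in> borel_measurable borel" using \<beta>(1) by (rule borel_measurable_continuous_onI)
  have hsq: "integrable M (\<lambda>x. (h x)\<^sup>2)" using L2_integrable_sq[OF h] by simp
  define \<gamma> where "\<gamma> k s = clamp_real (real k) (\<beta> s)" for k s
  have \<gamma>c: "continuous_on UNIV (\<gamma> k)" for k unfolding \<gamma>_def[abs_def] by (rule continuous_clamp_real[OF \<beta>(1)])
  have [measurable]: "\<gamma> k \<in> borel_measurable borel" for k using \<gamma>c by (rule borel_measurable_continuous_onI)
  have \<gamma>m: "mono (\<gamma> k)" for k using \<beta>(2) by (auto simp: \<gamma>_def mono_def intro!: clamp_real_mono)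
  have \<gamma>b: "\<bar>\<gamma> k s\<bar> \<le> real k" for k s unfolding \<gamma>_def by (rule clamp_real_bound) simp
  have \<gamma>L: "(\<lambda>x. \<gamma> k (v x)) \<in> L2_space \<Omega>" for k
    by (rule L2_bounded[where C="real k"]) (use \<gamma>b in auto)
  have \<gamma>sq: "integrable M (\<lambda>x. (\<gamma> k (v x))\<^sup>2)" for k using L2_integrable_sq[OF \<gamma>L] by simp
  have bound: "(\<integral>x. (\<gamma> k (v x))\<^sup>2 \<partial>M) \<le> (\<integral>x. (h x)\<^sup>2 \<partial>M)" for k
  proof -
    let ?r = "\<lambda>x. \<beta> (v x) - h x"
    have rint: "integrable M (\<lambda>x. ?r x * \<phi> x)" if "H1_pair \<phi> q" for \<phi> q
      using int[OF that] L2_mult_integrable[OF h H1_pairD(1)[OF that]] by (simp add: left_diff_distrib)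
    have req: "L2_inner \<Omega> (\<lambda>x. A' (g x)) q + (\<integral>x. ?r x * \<phi> x \<partial>M) = 0" if "H1_pair \<phi> q" for \<phi> q
      using int[OF that] L2_mult_integrable[OF h H1_pairD(1)[OF that]] eq[OF that] by (simp add: left_diff_distrib)
    have T: "integrable M (\<lambda>x. ?r x * \<gamma> k (v x))" "(\<integral>x. ?r x * \<gamma> k (v x) \<partial>M) \<le> 0"
      by (rule monotone_test[OF p \<gamma>c \<gamma>m \<gamma>b], erule rint, erule req)+
    have "(\<integral>x. (\<gamma> k (v x))\<^sup>2 \<partial>M) \<le> (\<integral>x. ?r x * \<gamma> k (v x) + ((h x)\<^sup>2 / 2 + (\<gamma> k (v x))\<^sup>2 / 2) \<partial>M)"
    proof (rule integral_mono)
      fix x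
      have "(\<gamma> k (v x))\<^sup>2 \<le> \<beta> (v x) * \<gamma> k (v x)" unfolding \<gamma>_def by (rule clamp_real_square_le) simp
      moreover have "h x * \<gamma> k (v x) \<le> (h x)\<^sup>2 / 2 + (\<gamma> k (v x))\<^sup>2 / 2"
        using young[of "1/2" "h x" "\<gamma> k (v x)"] by simp
      ultimately show "(\<gamma> k (v x))\<^sup>2 \<le> ?r x * \<gamma> k (v x) + ((h x)\<^sup>2 / 2 + (\<gamma> k (v x))\<^sup>2 / 2)"
        by (simp add: left_diff_distrib)
    qed (use T \<gamma>sq hsq in auto)
    also have "\<dots> = (\<integral>x. ?r x * \<gamma> k (v x) \<partial>M) + ((\<integral>x. (h x)\<^sup>2 \<partial>M) / 2 + (\<integral>x. (\<gamma> k (v x))\<^sup>2 \<partial>M) / 2)"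
      using T(1) \<gamma>sq hsq by simp
    finally show ?thesis using T(2) by simp
  qed
  have lim: "AE x in M. (\<lambda>k. (\<gamma> k (v x))\<^sup>2) \<longlonglongrightarrow> (\<beta> (v x))\<^sup>2"
  proof (intro AE_I2)
    fix x
    obtain N :: nat where "\<bar>\<beta> (v x)\<bar> \<le> N" using real_arch_simple by blast
    then have "\<forall>\<^sub>F k in sequentially. (\<gamma> k (v x))\<^sup>2 = (\<beta> (v x))\<^sup>2"
      unfolding eventually_sequentially by (intro exI[of _ N]) (auto simp: \<gamma>_def clamp_real_eq)
    then show "(\<lambda>k. (\<gamma> k (v x))\<^sup>2) \<longlonglongrightarrow> (\<beta> (v x))\<^sup>2" by (rule tendsto_eventually)
  qed
  have "integrable M (\<lambda>x. (\<beta> (v x))\<^sup>2)" "(\<integral>x. (\<beta> (v x))\<^sup>2 \<partial>M) \<le> (\<integral>x. (h x)\<^sup>2 \<partial>M)"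
    by (rule Fatou_bound[OF \<gamma>sq _ bound lim]; simp)+
  then show "(\<lambda>x. \<beta> (v x)) \<in> L2_space \<Omega>" "(\<integral>x. (\<beta> (v x))\<^sup>2 \<partial>M) \<le> (\<integral>x. (h x)\<^sup>2 \<partial>M)"
    by (auto intro!: L2_I)
qed

text \<open>One time step in isolation: \<open>w\<close> stands for the whole right-hand side \<tau>
  u_j + y_{j-1}. The equation is required for every representative \<open>k\<close> of the gradient
  of a test function.\<close>

definition step_solution :: "real \<Rightarrow> ('a \<Rightarrow> real) \<Rightarrow> ('a \<Rightarrow> real) \<Rightarrow> ('a \<Rightarrow> 'a) \<Rightarrow> bool" where
  "step_solution \<tau> w v g \<longleftrightarrow> H1_pair v g \<and> (\<forall>\<phi> k. H1_pair \<phi> k \<longrightarrow>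
     integrable M (\<lambda>x. \<psi>' (v x) * \<phi> x) \<and>
     L2_inner \<Omega> v \<phi> + \<tau> * L2_inner \<Omega> (\<lambda>x. A' (g x)) k + \<tau> * L2_inner \<Omega> (\<lambda>x. \<psi>' (v x)) \<phi> = L2_inner \<Omega> w \<phi>)"

lemma step_solutionD:
  assumes "step_solution \<tau> w v g"
  shows "H1_pair v g" "H1_pair \<phi> k \<Longrightarrow> integrable M (\<lambda>x. \<psi>' (v x) * \<phi> x)"
    "H1_pair \<phi> k \<Longrightarrow> L2_inner \<Omega> v \<phi> + \<tau> * L2_inner \<Omega> (\<lambda>x. A' (g x)) k
      + \<tau> * L2_inner \<Omega> (\<lambda>x. \<psi>' (v x)) \<phi> = L2_inner \<Omega> w \<phi>"
  using assms unfolding step_solution_def by blast+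

text \<open>Subtracting \<open>\<psi>' 0\<close> makes the nondecreasing function vanish at zero, so
  that it never has the sign opposite to its argument.\<close>

definition \<beta> :: "real \<Rightarrow> real" where
  "\<beta> s = \<psi>' s + C\<psi> * s - \<psi>' 0"

lemma \<beta>_continuous: "continuous_on UNIV \<beta>"
  unfolding \<beta>_def[abs_def] by (intro continuous_intros \<psi>'_continuous)

lemma \<beta>_mono: "mono \<beta>"
proof (rule monoI)
  fix s t :: real assume "s \<le> t"
  show "\<beta> s \<le> \<beta> t"
  proof (cases "s = t")
    case False
    then have st: "t - s > 0" using \<open>s \<le> t\<close> by simp
    have "0 \<le> (\<beta> t - \<beta> s) * (t - s)"
      using \<psi>'_semimono[of t s] by (simp add: \<beta>_def algebra_simps power2_eq_square)
    then show ?thesis using st by (simp add: zero_le_mult_iff)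
  qed simp
qed

lemma \<beta>_0: "\<beta> 0 = 0" by (simp add: \<beta>_def)

text \<open>Solved for the monotone term, the equation reads: elliptic part plus
  \<open>\<beta>(v)\<close> equals (w - v) / \<tau> + \<open>C\<psi>\<close> v -
  \<open>\<psi>' 0\<close>, and this right-hand side is in L^2 because w and v are.\<close>

lemma step_solution_L2:
  assumes s: "step_solution \<tau> w v g" and \<tau>: "\<tau> > 0" and w: "w \<in> L2_space \<Omega>"
  shows "(\<lambda>x. \<beta> (v x)) \<in> L2_space \<Omega>"
    and "(\<integral>x. (\<beta> (v x))\<^sup>2 \<partial>M) \<le> (\<integral>x. ((w x - v x) / \<tau> + C\<psi> * v x - \<psi>' 0)\<^sup>2 \<partial>M)"
    and "(\<lambda>x. \<psi>' (v x)) \<in> L2_space \<Omega>"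
proof -
  note p = step_solutionD(1)[OF s]
  note vL = H1_pairD(1)[OF p]
  define h where "h x = (w x - v x) / \<tau> + C\<psi> * v x - \<psi>' 0" for x
  have hL: "h \<in> L2_space \<Omega>" unfolding h_def by (intro L2_add L2_diff L2_divide L2_mult L2_const w vL)
  have int: "integrable M (\<lambda>x. \<beta> (v x) * \<phi> x)" if q: "H1_pair \<phi> k" for \<phi> k
  proof -
    have "integrable M (\<lambda>x. \<psi>' (v x) * \<phi> x + (C\<psi> * v x - \<psi>' 0) * \<phi> x)"
      by (intro Bochner_Integration.integrable_add step_solutionD(2)[OF s q]
          L2_mult_integrable[OF _ H1_pairD(1)[OF q]] L2_diff L2_mult L2_const vL)
    then show ?thesis by (simp add: \<beta>_def algebra_simps)
  qed
  have eq: "L2_inner \<Omega> (\<lambda>x. A' (g x)) k + (\<integral>x. \<beta> (v x) * \<phi> x \<partial>M) = (\<integral>x. h x * \<phi> x \<partial>M)"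
    if q: "H1_pair \<phi> k" for \<phi> k
  proof -
    note \<phi>L = H1_pairD(1)[OF q]
    note i = step_solutionD(2)[OF s q] L2_mult_integrable[OF vL \<phi>L] L2_mult_integrable[OF w \<phi>L] L2_integrable[OF \<phi>L]
    have 1: "(\<integral>x. \<beta> (v x) * \<phi> x \<partial>M) = (\<integral>x. \<psi>' (v x) * \<phi> x \<partial>M) + C\<psi> * (\<integral>x. v x * \<phi> x \<partial>M) - \<psi>' 0 * (\<integral>x. \<phi> x \<partial>M)"
    proof -
      have "(\<lambda>x. \<beta> (v x) * \<phi> x) = (\<lambda>x. \<psi>' (v x) * \<phi> x + C\<psi> * (v x * \<phi> x) - \<psi>' 0 * \<phi> x)"
        by (simp add: \<beta>_def algebra_simps)
      then show ?thesis using i by simp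
    qed
    have 2: "(\<integral>x. h x * \<phi> x \<partial>M) = ((\<integral>x. w x * \<phi> x \<partial>M) - (\<integral>x. v x * \<phi> x \<partial>M)) / \<tau> + C\<psi> * (\<integral>x. v x * \<phi> x \<partial>M) - \<psi>' 0 * (\<integral>x. \<phi> x \<partial>M)"
    proof -
      have "(\<lambda>x. h x * \<phi> x) = (\<lambda>x. (w x * \<phi> x - v x * \<phi> x) / \<tau> + C\<psi> * (v x * \<phi> x) - \<psi>' 0 * \<phi> x)"
        by (simp add: h_def algebra_simps diff_divide_distrib)
      then show ?thesis using i by simp
    qed
    have "(\<integral>x. v x * \<phi> x \<partial>M) + \<tau> * L2_inner \<Omega> (\<lambda>x. A' (g x)) k + \<tau> * (\<integral>x. \<psi>' (v x) * \<phi> x \<partial>M) = (\<integral>x. w x * \<phi> x \<partial>M)"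
      using step_solutionD(3)[OF s q] by (simp add: L2_inner_def[where 'b=real])
    then have "((\<integral>x. w x * \<phi> x \<partial>M) - (\<integral>x. v x * \<phi> x \<partial>M)) / \<tau> = L2_inner \<Omega> (\<lambda>x. A' (g x)) k + (\<integral>x. \<psi>' (v x) * \<phi> x \<partial>M)"
      using \<tau> by (simp add: field_simps)
    then show ?thesis using 1 2 by simp
  qed
  show bL: "(\<lambda>x. \<beta> (v x)) \<in> L2_space \<Omega>"
    by (rule monotone_term_L2(1)[OF p \<beta>_continuous \<beta>_mono hL int eq])
  show "(\<integral>x. (\<beta> (v x))\<^sup>2 \<partial>M) \<le> (\<integral>x. ((w x - v x) / \<tau> + C\<psi> * v x - \<psi>' 0)\<^sup>2 \<partial>M)"
    using monotone_term_L2(2)[OF p \<beta>_continuous \<beta>_mono hL int eq] by (simp add: h_def)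
  have "(\<lambda>x. \<beta> (v x) - C\<psi> * v x + \<psi>' 0) \<in> L2_space \<Omega>"
    by (intro L2_add L2_diff L2_mult L2_const bL vL)
  then show "(\<lambda>x. \<psi>' (v x)) \<in> L2_space \<Omega>" by (simp add: \<beta>_def)
qed

text \<open>The difference of the equations is tested with v - v'. The elliptic part is nonnegative
  and \<open>\<psi>'\<close> loses at most \<tau> \<open>C\<psi>\<close> times the squared
  difference, which leaves the positive factor 1 - \<tau> \<open>C\<psi>\<close>. The right-hand
  sides agree only almost everywhere because in the time recursion the previous states do.\<close>

lemma step_solution_unique:
  assumes s: "step_solution \<tau> w v g" and s': "step_solution \<tau> w' v' g'"
    and ww': "w \<in> L2_space \<Omega>" "AE x in M. w x = w' x" and \<tau>: "\<tau> > 0" "\<tau> * C\<psi> < 1"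
  shows "AE x in M. v x = v' x"
proof -
  note p = step_solutionD(1)[OF s] and p' = step_solutionD(1)[OF s']
  have q: "H1_pair (\<lambda>x. v x - v' x) (\<lambda>x. g x - g' x)" by (rule H1_pair_diff[OF p p'])
  note L = H1_pairD(1)[OF p] H1_pairD(1)[OF p'] A'_L2[OF H1_pairD(2)[OF p]] A'_L2[OF H1_pairD(2)[OF p']]
    and qL = H1_pairD(1)[OF q] H1_pairD(2)[OF q]
  have w'L: "w' \<in> L2_space \<Omega>" by (rule L2_cong_AE[OF ww'])
  have "L2_inner \<Omega> w (\<lambda>x. v x - v' x) = L2_inner \<Omega> w' (\<lambda>x. v x - v' x)"
    unfolding L2_inner_def
    using L2_inner_integrable[OF ww'(1) qL(1)] L2_inner_integrable[OF w'L qL(1)] ww'(2)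
    by (intro integral_cong_AE) auto
  then have e: "(L2_inner \<Omega> v (\<lambda>x. v x - v' x) - L2_inner \<Omega> v' (\<lambda>x. v x - v' x))
     + \<tau> * (L2_inner \<Omega> (\<lambda>x. A' (g x)) (\<lambda>x. g x - g' x) - L2_inner \<Omega> (\<lambda>x. A' (g' x)) (\<lambda>x. g x - g' x))
     + \<tau> * (L2_inner \<Omega> (\<lambda>x. \<psi>' (v x)) (\<lambda>x. v x - v' x) - L2_inner \<Omega> (\<lambda>x. \<psi>' (v' x)) (\<lambda>x. v x - v' x)) = 0"
    using step_solutionD(3)[OF s q] step_solutionD(3)[OF s' q] by (simp add: algebra_simps)
  note i = L2_inner_integrable[OF L(1) qL(1)] L2_inner_integrable[OF L(2) qL(1)]
    L2_inner_integrable[OF L(3) qL(2)] L2_inner_integrable[OF L(4) qL(2)]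
    step_solutionD(2)[OF s q] step_solutionD(2)[OF s' q]
  define F where "F x = (v x \<bullet> (v x - v' x) - v' x \<bullet> (v x - v' x))
     + \<tau> * (A' (g x) \<bullet> (g x - g' x) - A' (g' x) \<bullet> (g x - g' x))
     + \<tau> * (\<psi>' (v x) * (v x - v' x) - \<psi>' (v' x) * (v x - v' x))" for x
  have Fi: "integrable M F" unfolding F_def using i by (intro Bochner_Integration.integrable_add
      Bochner_Integration.integrable_diff integrable_mult_right)
  have F0: "(\<integral>x. F x \<partial>M) = 0"
    using e i unfolding F_def by (simp add: L2_inner_def)
  have Fge: "(1 - \<tau> * C\<psi>) * (v x - v' x)\<^sup>2 \<le> F x" for x
  proof -
    have "F x = (v x - v' x)\<^sup>2 + \<tau> * ((A' (g x) - A' (g' x)) \<bullet> (g x - g' x)) + \<tau> * ((\<psi>' (v x) - \<psi>' (v' x)) * (v x - v' x))"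
      by (simp add: F_def inner_diff_left power2_eq_square algebra_simps)
    moreover have "0 \<le> (A' (g x) - A' (g' x)) \<bullet> (g x - g' x)"
      using A'_mono[of "g x" "g' x"] CA_pos by (meson less_imp_le mult_nonneg_nonneg order_trans zero_le_power2)
    then have "0 \<le> \<tau> * ((A' (g x) - A' (g' x)) \<bullet> (g x - g' x))" using \<tau> by simp
    moreover have "\<tau> * (- C\<psi> * (v x - v' x)\<^sup>2) \<le> \<tau> * ((\<psi>' (v x) - \<psi>' (v' x)) * (v x - v' x))"
      using \<tau> by (intro mult_left_mono \<psi>'_semimono) auto
    ultimately show ?thesis by (simp add: algebra_simps)
  qed
  have sq: "integrable M (\<lambda>x. (1 - \<tau> * C\<psi>) * (v x - v' x)\<^sup>2)" using L2_integrable_sq[OF qL(1)] by simp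
  have "(\<integral>x. (1 - \<tau> * C\<psi>) * (v x - v' x)\<^sup>2 \<partial>M) \<le> 0"
    using integral_mono[OF sq Fi Fge] F0 by simp
  moreover have "0 \<le> (\<integral>x. (1 - \<tau> * C\<psi>) * (v x - v' x)\<^sup>2 \<partial>M)" using \<tau> by simp
  ultimately have "(\<integral>x. (1 - \<tau> * C\<psi>) * (v x - v' x)\<^sup>2 \<partial>M) = 0" by linarith
  then have "AE x in M. (1 - \<tau> * C\<psi>) * (v x - v' x)\<^sup>2 = 0"
    using \<tau> by (subst (asm) integral_nonneg_eq_0_iff_AE[OF sq]) auto
  then show ?thesis by eventually_elim (use \<tau> in auto)
qed

definition total_energy :: "('a \<Rightarrow> real) \<Rightarrow> ('a \<Rightarrow> 'a) \<Rightarrow> real" where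
  "total_energy v g = (\<integral>x. A (g x) \<partial>M) + (\<integral>x. \<psi> (v x) \<partial>M)"

text \<open>Tested with v - v0. Of the squared increment, one half pays for the nonconvexity of
  \<open>\<psi>\<close> and one quarter for the control by Young's inequality; the quarter that
  remains, divided by \<tau>, is the first term. Integrability of \<open>\<psi>(v)\<close> follows
  because it lies between \<open>m\<psi>\<close> and its semiconvexity bound, where the term
  \<open>\<psi>'(v) (v - v0)\<close> is integrable by the equation.\<close>

lemma step_energy_estimate:
  assumes s: "step_solution \<tau> (\<lambda>x. \<tau> * u x + v0 x) v g" and p0: "H1_pair v0 g0"
    and u: "u \<in> L2_space \<Omega>" and \<tau>: "\<tau> > 0" "\<tau> * C\<psi> < 1"
    and \<psi>0: "integrable M (\<lambda>x. \<psi> (v0 x))"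
  shows "integrable M (\<lambda>x. \<psi> (v x))"
    and "(\<integral>x. (v x - v0 x)\<^sup>2 \<partial>M) / (4 * \<tau>) + total_energy v g \<le> total_energy v0 g0 + \<tau> * (\<integral>x. (u x)\<^sup>2 \<partial>M)"
proof -
  note p = step_solutionD(1)[OF s]
  have q: "H1_pair (\<lambda>x. v x - v0 x) (\<lambda>x. g x - g0 x)" by (rule H1_pair_diff[OF p p0])
  note L = H1_pairD(1)[OF p] H1_pairD(1)[OF p0] H1_pairD(2)[OF p] H1_pairD(2)[OF p0] and qL = H1_pairD[OF q]
  have [measurable]: "v \<in> borel_measurable M" using L L2_measurable by blast
  have qsq: "integrable M (\<lambda>x. (v x - v0 x)\<^sup>2)" using L2_integrable_sq[OF qL(1)] by simp
  have usq: "integrable M (\<lambda>x. (u x)\<^sup>2)" using L2_integrable_sq[OF u] by simp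
  note i\<psi> = step_solutionD(2)[OF s q]
  have conv: "\<psi> (v x) \<le> \<psi> (v0 x) + \<psi>' (v x) * (v x - v0 x) + C\<psi> / 2 * (v x - v0 x)\<^sup>2" for x
  proof -
    have "\<psi> (v0 x) \<ge> \<psi> (v x) + \<psi>' (v x) \<bullet> (v0 x - v x) + (- C\<psi>) / 2 * (norm (v0 x - v x))\<^sup>2"
      by (rule potential_monotone_ge[of \<psi> \<psi>' "- C\<psi>"]) (use \<psi>_deriv \<psi>'_semimono in auto)
    then show ?thesis by (simp add: algebra_simps power2_commute)
  qed
  have ub: "integrable M (\<lambda>x. \<psi> (v0 x) + \<psi>' (v x) * (v x - v0 x) + C\<psi> / 2 * (v x - v0 x)\<^sup>2)"
    using \<psi>0 i\<psi> qsq by simp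
  show \<psi>i: "integrable M (\<lambda>x. \<psi> (v x))"
  proof (rule Bochner_Integration.integrable_bound)
    show "integrable M (\<lambda>x. \<bar>m\<psi>\<bar> + \<bar>\<psi> (v0 x) + \<psi>' (v x) * (v x - v0 x) + C\<psi> / 2 * (v x - v0 x)\<^sup>2\<bar>)"
      by (rule Bochner_Integration.integrable_add[OF integrable_const_M integrable_abs[OF ub]])
    show "AE x in M. norm (\<psi> (v x)) \<le> norm (\<bar>m\<psi>\<bar> + \<bar>\<psi> (v0 x) + \<psi>' (v x) * (v x - v0 x) + C\<psi> / 2 * (v x - v0 x)\<^sup>2\<bar>)"
    proof (intro AE_I2)
      fix x show "norm (\<psi> (v x)) \<le> norm (\<bar>m\<psi>\<bar> + \<bar>\<psi> (v0 x) + \<psi>' (v x) * (v x - v0 x) + C\<psi> / 2 * (v x - v0 x)\<^sup>2\<bar>)"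
        using conv[of x] \<psi>_bound[of "v x"] by (simp only: real_norm_def)
    qed
  qed measurable
  note iA = A_integrable[OF L(3)] A_integrable[OF L(4)]
    and iA' = L2_inner_integrable[OF A'_L2[OF L(3)] qL(2)]
    and iu = L2_mult_integrable[OF u qL(1)] and iv0 = L2_mult_integrable[OF L(2) qL(1)]
  have eq: "(\<integral>x. (v x - v0 x)\<^sup>2 \<partial>M) + \<tau> * L2_inner \<Omega> (\<lambda>x. A' (g x)) (\<lambda>x. g x - g0 x)
      + \<tau> * (\<integral>x. \<psi>' (v x) * (v x - v0 x) \<partial>M) = \<tau> * (\<integral>x. u x * (v x - v0 x) \<partial>M)"
  proof -
    have 1: "L2_inner \<Omega> v (\<lambda>x. v x - v0 x) = (\<integral>x. (v x - v0 x)\<^sup>2 \<partial>M) + (\<integral>x. v0 x * (v x - v0 x) \<partial>M)"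
    proof -
      have "(\<lambda>x. v x \<bullet> (v x - v0 x)) = (\<lambda>x. (v x - v0 x)\<^sup>2 + v0 x * (v x - v0 x))"
        by (simp add: power2_eq_square algebra_simps)
      then show ?thesis unfolding L2_inner_def using qsq iv0 by simp
    qed
    have 2: "L2_inner \<Omega> (\<lambda>x. \<tau> * u x + v0 x) (\<lambda>x. v x - v0 x) = \<tau> * (\<integral>x. u x * (v x - v0 x) \<partial>M) + (\<integral>x. v0 x * (v x - v0 x) \<partial>M)"
    proof -
      have "(\<lambda>x. (\<tau> * u x + v0 x) \<bullet> (v x - v0 x)) = (\<lambda>x. \<tau> * (u x * (v x - v0 x)) + v0 x * (v x - v0 x))"
        by (simp add: algebra_simps)
      then show ?thesis unfolding L2_inner_def using iu iv0 by simp
    qed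
    have 3: "L2_inner \<Omega> (\<lambda>x. \<psi>' (v x)) (\<lambda>x. v x - v0 x) = (\<integral>x. \<psi>' (v x) * (v x - v0 x) \<partial>M)"
      by (simp add: L2_inner_def)
    show ?thesis using step_solutionD(3)[OF s q] unfolding 1 2 3 by simp
  qed
  have *: "(\<integral>x. \<tau> * (A (g x) - A (g0 x) + \<psi> (v x) - \<psi> (v0 x)) \<partial>M)
     \<le> (\<integral>x. \<tau> * (A' (g x) \<bullet> (g x - g0 x)) + \<tau> * (\<psi>' (v x) * (v x - v0 x)) + (v x - v0 x)\<^sup>2 / 2 \<partial>M)"
  proof (rule integral_mono)
    fix x
    have "A (g x) - A (g0 x) \<le> A' (g x) \<bullet> (g x - g0 x)"
    proof -
      have "0 \<le> CA / 2 * (norm (g0 x - g x))\<^sup>2" using CA_pos by simp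
      then show ?thesis using A_convex[of "g x" "g0 x"] by (simp add: inner_diff_right)
    qed
    then have "\<tau> * (A (g x) - A (g0 x) + \<psi> (v x) - \<psi> (v0 x))
        \<le> \<tau> * (A' (g x) \<bullet> (g x - g0 x) + \<psi>' (v x) * (v x - v0 x) + C\<psi> / 2 * (v x - v0 x)\<^sup>2)"
      using conv[of x] \<tau>(1) by (intro mult_left_mono) auto
    moreover have "(\<tau> * C\<psi>) * ((v x - v0 x)\<^sup>2 / 2) \<le> 1 * ((v x - v0 x)\<^sup>2 / 2)"
      using \<tau> by (intro mult_right_mono) auto
    ultimately show "\<tau> * (A (g x) - A (g0 x) + \<psi> (v x) - \<psi> (v0 x))
      \<le> \<tau> * (A' (g x) \<bullet> (g x - g0 x)) + \<tau> * (\<psi>' (v x) * (v x - v0 x)) + (v x - v0 x)\<^sup>2 / 2"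
      by (simp add: distrib_left)
  qed (use iA iA' i\<psi> \<psi>i \<psi>0 qsq in auto)
  have 1: "\<tau> * (total_energy v g - total_energy v0 g0)
     \<le> \<tau> * L2_inner \<Omega> (\<lambda>x. A' (g x)) (\<lambda>x. g x - g0 x) + \<tau> * (\<integral>x. \<psi>' (v x) * (v x - v0 x) \<partial>M) + (\<integral>x. (v x - v0 x)\<^sup>2 \<partial>M) / 2"
  proof -
    have "(\<integral>x. A (g x) - A (g0 x) + \<psi> (v x) - \<psi> (v0 x) \<partial>M) = total_energy v g - total_energy v0 g0"
      using iA \<psi>i \<psi>0 by (simp add: total_energy_def)
    moreover have "(\<integral>x. \<tau> * (A' (g x) \<bullet> (g x - g0 x)) + \<tau> * (\<psi>' (v x) * (v x - v0 x)) + (v x - v0 x)\<^sup>2 / 2 \<partial>M)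
      = \<tau> * L2_inner \<Omega> (\<lambda>x. A' (g x)) (\<lambda>x. g x - g0 x) + \<tau> * (\<integral>x. \<psi>' (v x) * (v x - v0 x) \<partial>M) + (\<integral>x. (v x - v0 x)\<^sup>2 \<partial>M) / 2"
      using iA' i\<psi> qsq by (simp add: L2_inner_def)
    ultimately show ?thesis using * by simp
  qed
  have "(\<integral>x. \<tau> * (u x * (v x - v0 x)) \<partial>M) \<le> (\<integral>x. \<tau>\<^sup>2 * (u x)\<^sup>2 + (v x - v0 x)\<^sup>2 / 4 \<partial>M)"
  proof (rule integral_mono)
    fix x
    show "\<tau> * (u x * (v x - v0 x)) \<le> \<tau>\<^sup>2 * (u x)\<^sup>2 + (v x - v0 x)\<^sup>2 / 4"
      using young[of 1 "\<tau> * u x" "v x - v0 x"] by (simp add: power_mult_distrib mult.assoc)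
  qed (use iu usq qsq in auto)
  then have 2: "\<tau> * (\<integral>x. u x * (v x - v0 x) \<partial>M) \<le> \<tau>\<^sup>2 * (\<integral>x. (u x)\<^sup>2 \<partial>M) + (\<integral>x. (v x - v0 x)\<^sup>2 \<partial>M) / 4"
    using iu usq qsq by simp
  have "\<tau> * (total_energy v g - total_energy v0 g0) + (\<integral>x. (v x - v0 x)\<^sup>2 \<partial>M) / 4 \<le> \<tau>\<^sup>2 * (\<integral>x. (u x)\<^sup>2 \<partial>M)"
    using 1 2 eq by linarith
  then show "(\<integral>x. (v x - v0 x)\<^sup>2 \<partial>M) / (4 * \<tau>) + total_energy v g \<le> total_energy v0 g0 + \<tau> * (\<integral>x. (u x)\<^sup>2 \<partial>M)"
    using \<tau>(1) by (simp add: field_simps power2_eq_square)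
qed

end

lemma GDERIV_fst_plus_snd:
  assumes "GDERIV h (fst z) :> h'" "GDERIV k (snd z) :> k'"
  shows "GDERIV (\<lambda>z. h (fst z) + k (snd z)) z :> (h', k')"
proof -
  have "((\<lambda>z. h (fst z)) has_derivative (\<lambda>y. fst y \<bullet> h')) (at z)"
    using has_derivative_compose[OF has_derivative_fst[OF has_derivative_ident] assms(1)[unfolded gderiv_def]] by simp
  moreover have "((\<lambda>z. k (snd z)) has_derivative (\<lambda>y. snd y \<bullet> k')) (at z)"
    using has_derivative_compose[OF has_derivative_snd[OF has_derivative_ident] assms(2)[unfolded gderiv_def]] by simp
  ultimately have "((\<lambda>z. h (fst z) + k (snd z)) has_derivative (\<lambda>y. fst y \<bullet> h' + snd y \<bullet> k')) (at z)"
    by (rule has_derivative_add)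
  then show ?thesis by (simp add: gderiv_def inner_prod_def)
qed

context discrete_step
begin

text \<open>The truncations of \<open>\<beta>\<close> have potentials that increase with the truncation level, because
  \<open>\<beta> 0 = 0\<close>. Hence the minimal energies increase, and strong convexity turns their convergence
  into convergence of the minimisers.\<close>

lemma step_solution_exists:
  assumes \<tau>: "\<tau> > 0" "\<tau> * C\<psi> < 1" and w: "w \<in> L2_space \<Omega>"
  shows "\<exists>v g. step_solution \<tau> w v g"
proof -
  define \<kappa> where "\<kappa> = 1 - \<tau> * C\<psi>"
  have \<kappa>: "\<kappa> > 0" using \<tau> by (simp add: \<kappa>_def)

  \<comment> \<open>Truncations and their potentials\<close>
  define bn where "bn n s = clamp_real (real n) (\<beta> s)" for n s
  have bn_cont: "continuous_on UNIV (bn n)" for n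
    unfolding bn_def[abs_def] by (rule continuous_clamp_real[OF \<beta>_continuous])
  have bn_mono: "mono (bn n)" for n using \<beta>_mono by (auto simp: bn_def mono_def intro!: clamp_real_mono)
  have bn_bound: "\<bar>bn n s\<bar> \<le> real n" for n s unfolding bn_def by (rule clamp_real_bound) simp
  have [measurable]: "bn n \<in> borel_measurable borel" for n using bn_cont by (rule borel_measurable_continuous_onI)
  have [measurable]: "\<beta> \<in> borel_measurable borel" using \<beta>_continuous by (rule borel_measurable_continuous_onI)
  have "\<forall>n. \<exists>B. (\<forall>s. (B has_real_derivative bn n s) (at s)) \<and> B 0 = 0"
  proof
    fix n
    obtain F where F: "\<And>s. (F has_real_derivative bn n s) (at s)"
      by (rule continuous_antiderivative[OF bn_cont]) blast
    have "((\<lambda>s. F s - F 0) has_real_derivative bn n s) (at s)" for s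
      using F[of s] by (auto intro!: derivative_eq_intros)
    then show "\<exists>B. (\<forall>s. (B has_real_derivative bn n s) (at s)) \<and> B 0 = 0"
      by (intro exI[of _ "\<lambda>s. F s - F 0"]) auto
  qed
  then obtain B where B: "\<And>n s. (B n has_real_derivative bn n s) (at s)" "\<And>n. B n 0 = 0"
    by (metis (mono_tags))
  have B_mono: "B n s \<le> B m s" if nm: "n \<le> m" for n m s
  proof -
    have d: "((\<lambda>s. B m s - B n s) has_real_derivative bn m t - bn n t) (at t)" for t
      by (intro DERIV_diff B)
    show ?thesis
    proof (cases "0 \<le> s")
      case True
      have "B m 0 - B n 0 \<le> B m s - B n s"
      proof (rule DERIV_nonneg_imp_nondecreasing[of 0 s "\<lambda>s. B m s - B n s", OF True])
        fix t :: real assume "0 \<le> t"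
        then have "0 \<le> \<beta> t" using monoD[OF \<beta>_mono, of 0 t] \<beta>_0 by simp
        then have "0 \<le> bn m t - bn n t" using nm by (auto simp: bn_def clamp_real_def)
        with d[of t] show "\<exists>y. ((\<lambda>s. B m s - B n s) has_real_derivative y) (at t) \<and> 0 \<le> y" by blast
      qed
      then show ?thesis by (simp add: B)
    next
      case False
      have "B m s - B n s \<ge> B m 0 - B n 0"
      proof (rule DERIV_nonpos_imp_nonincreasing[of s 0 "\<lambda>s. B m s - B n s"])
        fix t :: real assume "t \<le> 0"
        then have "\<beta> t \<le> 0" using monoD[OF \<beta>_mono, of t 0] \<beta>_0 by simp
        then have "bn m t - bn n t \<le> 0" using nm by (auto simp: bn_def clamp_real_def)
        with d[of t] show "\<exists>y. ((\<lambda>s. B m s - B n s) has_real_derivative y) (at t) \<and> y \<le> 0" by blast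
      qed (use False in simp)
      then show ?thesis by (simp add: B)
    qed
  qed
  \<comment> \<open>The source is the identity v + \<tau> \<open>\<psi>'(v)\<close> =
    \<open>\<kappa>\<close> v + \<tau> \<open>\<beta>(v)\<close> + \<tau> \<open>\<psi>' 0\<close>:
    the constant goes to the right-hand side \<open>W\<close>, the rest into the gradient, with
    \<open>\<beta>\<close> truncated in \<open>P n\<close> and untruncated in \<open>P'\<close>. The
    unknown is the pair of value and weak gradient, and \<open>W\<close> has no gradient
    component.\<close>
  define \<Phi> where "\<Phi> n z = (\<kappa> / 2 * (fst z)\<^sup>2 + \<tau> * B n (fst z)) + \<tau> * A (snd z)" for n and z :: "real \<times> 'a"
  define P where "P n z = (\<kappa> * fst z + \<tau> * bn n (fst z), \<tau> *\<^sub>R A' (snd z))" for n and z :: "real \<times> 'a"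
  define P' where "P' z = (\<kappa> * fst z + \<tau> * \<beta> (fst z), \<tau> *\<^sub>R A' (snd z))" for z :: "real \<times> 'a"
  define W where "W x = (w x - \<tau> * \<psi>' 0, 0 :: 'a)" for x
  define \<delta> where "\<delta> = min \<kappa> (\<tau> * CA)"
  have \<delta>: "\<delta> > 0" using \<kappa> \<tau> CA_pos by (simp add: \<delta>_def)
  define S where "S = {z :: 'a \<Rightarrow> real \<times> 'a. H1_pair (\<lambda>x. fst (z x)) (\<lambda>x. snd (z x))}"
  have W_L2: "W \<in> L2_space \<Omega>" unfolding W_def by (intro L2_Pair L2_diff L2_const w)
  have S_L2: "z \<in> L2_space \<Omega>" if "z \<in> S" for z
    using L2_Pair[OF H1_pairD(1,2)[of "\<lambda>x. fst (z x)" "\<lambda>x. snd (z x)"]] that by (simp add: S_def)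
  have prob: "strongly_convex_problem \<Omega> S (\<Phi> n) (P n) \<delta> (\<tau> * real n) (\<kappa> + \<tau> * CA_bar) W" for n
  proof (unfold_locales)
    show "z \<in> L2_space \<Omega>" if "z \<in> S" for z by (rule S_L2[OF that])
    show "(\<lambda>x. 0) \<in> S" using H1_pair_zero by (simp add: S_def)
    show "(\<lambda>x. z x + z' x) \<in> S" if "z \<in> S" "z' \<in> S" for z z'
      using H1_pair_add that by (simp add: S_def)
    show "(\<lambda>x. t *\<^sub>R z x) \<in> S" if "z \<in> S" for z t
      using H1_pair_scale that by (simp add: S_def)
    show "l \<in> S" if zs: "\<And>n. zs n \<in> S" and l: "l \<in> L2_space \<Omega>"
      and lim: "(\<lambda>n. \<integral>x. (norm (zs n x - l x))\<^sup>2 \<partial>M) \<longlonglongrightarrow> 0" for zs :: "nat \<Rightarrow> 'a \<Rightarrow> real \<times> 'a" and l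
    proof -
      have pair: "H1_pair (\<lambda>x. fst (zs n x)) (\<lambda>x. snd (zs n x))" for n using zs[of n] by (simp add: S_def)
      have f: "(\<lambda>n. L2_inner \<Omega> (\<lambda>x. fst (zs n x)) h) \<longlonglongrightarrow> L2_inner \<Omega> (\<lambda>x. fst (l x)) h"
        if h: "h \<in> L2_space \<Omega>" for h
        using L2_inner_tendsto[OF S_L2[OF zs] l L2_Pair[OF h L2_const[of 0]] lim]
        by (simp add: L2_inner_def inner_prod_def)
      have g: "(\<lambda>n. L2_inner \<Omega> (\<lambda>x. snd (zs n x)) h) \<longlonglongrightarrow> L2_inner \<Omega> (\<lambda>x. snd (l x)) h"
        if h: "h \<in> L2_space \<Omega>" for h
        using L2_inner_tendsto[OF S_L2[OF zs] l L2_Pair[OF L2_const[of 0] h] lim]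
        by (simp add: L2_inner_def inner_prod_def)
      show ?thesis
        using H1_pair_closed[OF pair L2_fst[OF l] L2_snd[OF l] f g] by (simp add: S_def)
    qed
    show "GDERIV (\<Phi> n) p :> P n p" for p
      unfolding \<Phi>_def[abs_def] P_def
    proof (rule GDERIV_fst_plus_snd[of "\<lambda>s. \<kappa> / 2 * s\<^sup>2 + \<tau> * B n s" _ _ "\<lambda>q. \<tau> * A q"])
      show "GDERIV (\<lambda>s. \<kappa> / 2 * s\<^sup>2 + \<tau> * B n s) (fst p) :> \<kappa> * fst p + \<tau> * bn n (fst p)"
        by (auto intro!: derivative_eq_intros B)
      show "GDERIV (\<lambda>q. \<tau> * A q) (snd p) :> \<tau> *\<^sub>R A' (snd p)"
        using GDERIV_mult[OF GDERIV_const[of \<tau>] A_deriv] by simp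
    qed
    show "continuous_on UNIV (P n)"
      unfolding P_def[abs_def]
      by (intro continuous_intros continuous_on_compose2[OF bn_cont] continuous_on_compose2[OF A'_continuous]) auto
    show "(P n p - P n q) \<bullet> (p - q) \<ge> \<delta> * (norm (p - q))\<^sup>2" for p q
    proof -
      have "\<delta> * (fst p - fst q)\<^sup>2 \<le> \<kappa> * (fst p - fst q)\<^sup>2"
        by (intro mult_right_mono) (auto simp: \<delta>_def)
      moreover have "\<delta> * (norm (snd p - snd q))\<^sup>2 \<le> (\<tau> * CA) * (norm (snd p - snd q))\<^sup>2"
        by (intro mult_right_mono) (auto simp: \<delta>_def)
      moreover have "\<tau> * (CA * (norm (snd p - snd q))\<^sup>2) \<le> \<tau> * ((A' (snd p) - A' (snd q)) \<bullet> (snd p - snd q))"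
        using \<tau> by (intro mult_left_mono A'_mono) auto
      moreover have "0 \<le> \<tau> * ((bn n (fst p) - bn n (fst q)) * (fst p - fst q))"
      proof -
        have "0 \<le> (bn n (fst p) - bn n (fst q)) * (fst p - fst q)"
          using bn_mono[of n] by (cases "fst p \<le> fst q") (auto simp: mono_def intro: mult_nonpos_nonpos mult_nonneg_nonneg)
        then show ?thesis using \<tau> by simp
      qed
      moreover have "(norm (p - q))\<^sup>2 = (fst p - fst q)\<^sup>2 + (norm (snd p - snd q))\<^sup>2"
        by (simp add: norm_prod_def)
      moreover have "(P n p - P n q) \<bullet> (p - q) = \<kappa> * (fst p - fst q)\<^sup>2
          + \<tau> * ((bn n (fst p) - bn n (fst q)) * (fst p - fst q))
          + \<tau> * ((A' (snd p) - A' (snd q)) \<bullet> (snd p - snd q))"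
        by (simp add: P_def inner_prod_def inner_diff_left power2_eq_square algebra_simps)
      ultimately show ?thesis by (simp add: distrib_left)
    qed
    show "norm (P n p) \<le> \<tau> * real n + (\<kappa> + \<tau> * CA_bar) * norm p" for p
    proof -
      have "norm (P n p) \<le> norm (\<kappa> * fst p + \<tau> * bn n (fst p)) + norm (\<tau> *\<^sub>R A' (snd p))"
        unfolding P_def by (rule norm_Pair_le)
      also have "norm (\<kappa> * fst p + \<tau> * bn n (fst p)) \<le> \<kappa> * \<bar>fst p\<bar> + \<tau> * \<bar>bn n (fst p)\<bar>"
        using \<kappa> \<tau> abs_triangle_ineq[of "\<kappa> * fst p" "\<tau> * bn n (fst p)"] by (simp add: abs_mult)
      also have "\<kappa> * \<bar>fst p\<bar> \<le> \<kappa> * norm p"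
        using \<kappa> norm_fst_le[of "fst p" "snd p"] by (intro mult_left_mono) auto
      also have "\<tau> * \<bar>bn n (fst p)\<bar> \<le> \<tau> * real n"
        using \<tau> by (intro mult_left_mono bn_bound) auto
      also have "norm (\<tau> *\<^sub>R A' (snd p)) \<le> \<tau> * (CA_bar * norm p)"
      proof -
        have "norm (A' (snd p)) \<le> CA_bar * norm (snd p)" by (rule A'_growth)
        also have "\<dots> \<le> CA_bar * norm p"
          using CA_bar_pos norm_snd_le[of "snd p" "fst p"] by (intro mult_left_mono) auto
        finally show ?thesis using \<tau> by (simp add: mult_left_mono)
      qed
      finally show ?thesis by (simp add: algebra_simps)
    qed
    show "\<tau> * real n \<ge> 0" "\<kappa> + \<tau> * CA_bar \<ge> 0" using \<tau> \<kappa> CA_bar_pos by simp_all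
  qed (use \<delta> W_L2 in auto)
  define J where "J n v = (\<integral>x. \<Phi> n (v x) - W x \<bullet> v x \<partial>M)" for n v
  have Ji: "integrable M (\<lambda>x. \<Phi> n (v x) - W x \<bullet> v x)" if "v \<in> S" for n v
    by (rule strongly_convex_problem.energy_integrable[OF prob S_L2[OF that]])
  have "\<forall>n. \<exists>z. z \<in> S \<and> (\<forall>\<phi>\<in>S. L2_inner \<Omega> (\<lambda>x. P n (z x)) \<phi> = L2_inner \<Omega> W \<phi>)
      \<and> (\<forall>v\<in>S. J n v \<ge> J n z + \<delta> / 2 * (\<integral>x. (norm (v x - z x))\<^sup>2 \<partial>M))"
  proof
    fix n
    interpret sc: strongly_convex_problem \<Omega> S "\<Phi> n" "P n" \<delta> "\<tau> * real n" "\<kappa> + \<tau> * CA_bar" W by (rule prob)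
    have J: "J n v = sc.energy v" for v by (simp add: J_def sc.energy_def)
    obtain z where "z \<in> S" "\<And>\<phi>. \<phi> \<in> S \<Longrightarrow> L2_inner \<Omega> (\<lambda>x. P n (z x)) \<phi> = L2_inner \<Omega> W \<phi>"
      "\<And>v. v \<in> S \<Longrightarrow> sc.energy v \<ge> sc.energy z + \<delta> / 2 * (\<integral>x. (norm (v x - z x))\<^sup>2 \<partial>M)"
      by (rule sc.minimizer_exists) blast
    then show "\<exists>z. z \<in> S \<and> (\<forall>\<phi>\<in>S. L2_inner \<Omega> (\<lambda>x. P n (z x)) \<phi> = L2_inner \<Omega> W \<phi>)
      \<and> (\<forall>v\<in>S. J n v \<ge> J n z + \<delta> / 2 * (\<integral>x. (norm (v x - z x))\<^sup>2 \<partial>M))"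
      unfolding J by blast
  qed
  from choice[OF this] obtain z where z: "\<And>n. z n \<in> S"
    and EL: "\<And>n \<phi>. \<phi> \<in> S \<Longrightarrow> L2_inner \<Omega> (\<lambda>x. P n (z n x)) \<phi> = L2_inner \<Omega> W \<phi>"
    and min: "\<And>n v. v \<in> S \<Longrightarrow> J n v \<ge> J n (z n) + \<delta> / 2 * (\<integral>x. (norm (v x - z n x))\<^sup>2 \<partial>M)"
    by blast

  \<comment> \<open>Strong convergence of the minimisers\<close>
  note zL = S_L2[OF z]
  define D where "D m n = (\<integral>x. (norm (z m x - z n x))\<^sup>2 \<partial>M)" for m n
  have D0: "0 \<le> D m n" for m n by (simp add: D_def)
  have Dsym: "D m n = D n m" for m n by (simp add: D_def norm_minus_commute)
  \<comment> \<open>The minimiser at level m serves as competitor at the lower level n: quadratic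
    growth of \<open>J n\<close> around \<open>z n\<close> yields the distance, and the ordering of
    the potentials replaces \<open>J n (z m)\<close> by \<open>J m (z m)\<close>.\<close>
  have step: "J n (z n) + \<delta> / 2 * D m n \<le> J m (z m)" if nm: "n \<le> m" for n m
  proof -
    have "J n (z m) \<le> J m (z m)"
      unfolding J_def
    proof (rule integral_mono[OF Ji[OF z] Ji[OF z]])
      fix x show "\<Phi> n (z m x) - W x \<bullet> z m x \<le> \<Phi> m (z m x) - W x \<bullet> z m x"
        using B_mono[OF nm] \<tau> by (simp add: \<Phi>_def)
    qed
    then show ?thesis using min[OF z[of m], of n] by (simp add: D_def)
  qed
  \<comment> \<open>Zero as competitor: all truncated potentials vanish there, so the bound is the
    same at every level.\<close>
  have up: "J m (z m) \<le> (\<integral>x. \<tau> * A 0 \<partial>M)" for m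
  proof -
    have "(\<lambda>x. 0) \<in> S" using H1_pair_zero by (simp add: S_def)
    from min[OF this, of m] have "J m (z m) + \<delta> / 2 * (\<integral>x. (norm (0 - z m x))\<^sup>2 \<partial>M) \<le> (\<integral>x. \<tau> * A 0 \<partial>M)"
      by (simp add: J_def \<Phi>_def B)
    moreover have "0 \<le> \<delta> / 2 * (\<integral>x. (norm (0 - z m x))\<^sup>2 \<partial>M)" using \<delta> by simp
    ultimately show ?thesis by linarith
  qed
  have "incseq (\<lambda>n. J n (z n))"
  proof (rule incseq_SucI)
    fix n
    have "0 \<le> \<delta> / 2 * D (Suc n) n" using \<delta> D0 by simp
    then show "J n (z n) \<le> J (Suc n) (z (Suc n))" using step[of n "Suc n"] by simp
  qed
  then obtain L where L: "(\<lambda>n. J n (z n)) \<longlonglongrightarrow> L"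
    using incseq_convergent[of "\<lambda>n. J n (z n)"] up by blast
  then have cau: "Cauchy (\<lambda>n. J n (z n))" by (rule LIMSEQ_imp_Cauchy)
  have cauchy: "\<exists>n0. \<forall>m\<ge>n0. \<forall>n\<ge>n0. (\<integral>x. (norm (z m x - z n x))\<^sup>2 \<partial>M) \<le> e" if e: "e > 0" for e
  proof -
    obtain n0 where n0: "\<And>m n. m \<ge> n0 \<Longrightarrow> n \<ge> n0 \<Longrightarrow> \<bar>J m (z m) - J n (z n)\<bar> < \<delta> / 2 * e"
      using CauchyD[OF cau, of "\<delta> / 2 * e"] e \<delta> by auto
    have le: "D m n \<le> e" if "n0 \<le> n" "n \<le> m" for m n
    proof -
      have "\<delta> / 2 * D m n \<le> \<delta> / 2 * e" using step[OF that(2)] n0[of m n] that by linarith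
      then show ?thesis using \<delta> by simp
    qed
    have "D m n \<le> e" if "n0 \<le> n" "n0 \<le> m" for m n
      using le[of n m] le[of m n] Dsym[of m n] that by (cases "n \<le> m") auto
    then show ?thesis unfolding D_def by blast
  qed
  obtain l r where l: "l \<in> L2_space \<Omega>" and lim: "(\<lambda>n. \<integral>x. (norm (z n x - l x))\<^sup>2 \<partial>M) \<longlonglongrightarrow> 0"
    and r: "strict_mono r" and ae: "AE x in M. (\<lambda>n. z (r n) x) \<longlonglongrightarrow> l x"
    by (rule L2_complete[OF zL cauchy]) blast
  have lS: "l \<in> S" by (rule strongly_convex_problem.S_closed[OF prob[of 0] z l lim])

  \<comment> \<open>Bounds independent of the truncation level\<close>
  obtain K where K: "\<And>n. (\<integral>x. (norm (z n x - l x))\<^sup>2 \<partial>M) \<le> K"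
  proof -
    have "Bseq (\<lambda>n. \<integral>x. (norm (z n x - l x))\<^sup>2 \<partial>M)" using lim by (intro convergent_imp_Bseq convergentI)
    then show ?thesis using that unfolding Bseq_def by (metis abs_le_D1 real_norm_def)
  qed
  define C0 where "C0 = 2 * K + 2 * (\<integral>x. (norm (l x))\<^sup>2 \<partial>M)"
  have zC0: "(\<integral>x. (norm (z n x))\<^sup>2 \<partial>M) \<le> C0" for n
  proof -
    have "(\<integral>x. (norm (z n x))\<^sup>2 \<partial>M) \<le> (\<integral>x. 2 * (norm (z n x - l x))\<^sup>2 + 2 * (norm (l x))\<^sup>2 \<partial>M)"
    proof (rule integral_mono)
      fix x show "(norm (z n x))\<^sup>2 \<le> 2 * (norm (z n x - l x))\<^sup>2 + 2 * (norm (l x))\<^sup>2"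
        using norm_add_squared_le[of "z n x - l x" "l x"] by simp
    qed (use L2_integrable_sq[OF zL] L2_integrable_sq[OF l] L2_integrable_sq[OF L2_diff[OF zL l]] in auto)
    also have "\<dots> = 2 * (\<integral>x. (norm (z n x - l x))\<^sup>2 \<partial>M) + 2 * (\<integral>x. (norm (l x))\<^sup>2 \<partial>M)"
      using L2_integrable_sq[OF l] L2_integrable_sq[OF L2_diff[OF zL l]] by simp
    finally show ?thesis using K[of n] by (simp add: C0_def)
  qed
  define w0 where "w0 x = w x - \<tau> * \<psi>' 0" for x
  have w0L: "w0 \<in> L2_space \<Omega>" unfolding w0_def by (intro L2_diff L2_const w)
  have pair_S: "(\<lambda>x. (\<phi> x, k x)) \<in> S" if "H1_pair \<phi> k" for \<phi> k using that by (simp add: S_def)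
  have split: "L2_inner \<Omega> (\<lambda>x. (a x, \<tau> *\<^sub>R A' (g x))) (\<lambda>x. (\<phi> x, k x))
      = L2_inner \<Omega> a \<phi> + \<tau> * L2_inner \<Omega> (\<lambda>x. A' (g x)) k"
    if "a \<in> L2_space \<Omega>" "g \<in> L2_space \<Omega>" "H1_pair \<phi> k" for a g \<phi> k
    using L2_inner_integrable[OF that(1) H1_pairD(1)[OF that(3)]] L2_inner_integrable[OF A'_L2[OF that(2)] H1_pairD(2)[OF that(3)]]
    by (simp add: L2_inner_def inner_prod_def)
  have Wsplit: "L2_inner \<Omega> W (\<lambda>x. (\<phi> x, k x)) = L2_inner \<Omega> w0 \<phi>" for \<phi> k
    by (simp add: L2_inner_def W_def w0_def inner_prod_def)
  \<comment> \<open>Solving the truncated equation for \<open>bn n\<close> leaves the right-hand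
    side (w0 - \<kappa> v) / \<tau>. This is its squared L^2 norm, estimated by twice the sum of
    squares and by \<open>C0\<close>.\<close>
  define C1 where "C1 = (2 * (\<integral>x. (w0 x)\<^sup>2 \<partial>M) + 2 * \<kappa>\<^sup>2 * C0) / \<tau>\<^sup>2"
  have b_bound: "(\<integral>x. (bn n (fst (z n x)))\<^sup>2 \<partial>M) \<le> C1" for n
  proof -
    let ?v = "\<lambda>x. fst (z n x)" and ?g = "\<lambda>x. snd (z n x)"
    have p: "H1_pair ?v ?g" using z[of n] by (simp add: S_def)
    note vL = H1_pairD(1)[OF p] and gL = H1_pairD(2)[OF p]
    have [measurable]: "?v \<in> borel_measurable M" using vL L2_measurable by blast
    have bL: "(\<lambda>x. bn n (?v x)) \<in> L2_space \<Omega>"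
      by (rule L2_bounded[where C="real n"]) (use bn_bound in auto)
    define h where "h x = (w0 x - \<kappa> * ?v x) / \<tau>" for x
    have hL: "h \<in> L2_space \<Omega>" unfolding h_def by (intro L2_divide L2_diff L2_mult w0L vL)
    have "(\<integral>x. (bn n (?v x))\<^sup>2 \<partial>M) \<le> (\<integral>x. (h x)\<^sup>2 \<partial>M)"
    proof (rule monotone_term_L2(2)[OF p bn_cont bn_mono hL])
      fix \<phi> k assume q: "H1_pair \<phi> k"
      note \<phi>L = H1_pairD(1)[OF q]
      show bi: "integrable M (\<lambda>x. bn n (?v x) * \<phi> x)" by (rule L2_mult_integrable[OF bL \<phi>L])
      have aL: "(\<lambda>x. \<kappa> * ?v x + \<tau> * bn n (?v x)) \<in> L2_space \<Omega>" by (intro L2_add L2_mult vL bL)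
      have "L2_inner \<Omega> (\<lambda>x. \<kappa> * ?v x + \<tau> * bn n (?v x)) \<phi> + \<tau> * L2_inner \<Omega> (\<lambda>x. A' (?g x)) k = L2_inner \<Omega> w0 \<phi>"
        using EL[OF pair_S[OF q], of n] unfolding P_def split[OF aL gL q] Wsplit .
      moreover have "L2_inner \<Omega> (\<lambda>x. \<kappa> * ?v x + \<tau> * bn n (?v x)) \<phi>
          = \<kappa> * (\<integral>x. ?v x * \<phi> x \<partial>M) + \<tau> * (\<integral>x. bn n (?v x) * \<phi> x \<partial>M)"
        using bi L2_mult_integrable[OF vL \<phi>L] by (simp add: L2_inner_def distrib_right mult.assoc)
      moreover have "(\<integral>x. h x * \<phi> x \<partial>M) = (L2_inner \<Omega> w0 \<phi> - \<kappa> * (\<integral>x. ?v x * \<phi> x \<partial>M)) / \<tau>"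
      proof -
        have "(\<lambda>x. h x * \<phi> x) = (\<lambda>x. (w0 x * \<phi> x - \<kappa> * (?v x * \<phi> x)) / \<tau>)"
          by (simp add: h_def algebra_simps)
        then show ?thesis
          using L2_mult_integrable[OF w0L \<phi>L] L2_mult_integrable[OF vL \<phi>L] by (simp add: L2_inner_def)
      qed
      ultimately have "\<tau> * (L2_inner \<Omega> (\<lambda>x. A' (?g x)) k + (\<integral>x. bn n (?v x) * \<phi> x \<partial>M)) = \<tau> * (\<integral>x. h x * \<phi> x \<partial>M)"
        using \<tau>(1) by (simp add: distrib_left)
      then show "L2_inner \<Omega> (\<lambda>x. A' (?g x)) k + (\<integral>x. bn n (?v x) * \<phi> x \<partial>M) = (\<integral>x. h x * \<phi> x \<partial>M)"
        using \<tau>(1) by simp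
    qed
    also have "\<dots> \<le> (\<integral>x. (2 * (w0 x)\<^sup>2 + 2 * \<kappa>\<^sup>2 * (norm (z n x))\<^sup>2) / \<tau>\<^sup>2 \<partial>M)"
    proof (rule integral_mono)
      fix x
      have "(w0 x - \<kappa> * ?v x)\<^sup>2 \<le> 2 * (w0 x)\<^sup>2 + 2 * (\<kappa> * ?v x)\<^sup>2"
        using norm_diff_squared_le[of "w0 x" "\<kappa> * ?v x"] by simp
      moreover have "(\<kappa> * ?v x)\<^sup>2 \<le> \<kappa>\<^sup>2 * (norm (z n x))\<^sup>2"
        by (simp add: power_mult_distrib norm_prod_def mult_left_mono)
      ultimately show "(h x)\<^sup>2 \<le> (2 * (w0 x)\<^sup>2 + 2 * \<kappa>\<^sup>2 * (norm (z n x))\<^sup>2) / \<tau>\<^sup>2"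
        by (simp add: h_def power_divide divide_right_mono)
    qed (use L2_integrable_sq[OF hL] L2_integrable_sq[OF w0L] L2_integrable_sq[OF zL] in auto)
    also have "\<dots> = (2 * (\<integral>x. (w0 x)\<^sup>2 \<partial>M) + 2 * \<kappa>\<^sup>2 * (\<integral>x. (norm (z n x))\<^sup>2 \<partial>M)) / \<tau>\<^sup>2"
      using L2_integrable_sq[OF w0L] L2_integrable_sq[OF zL[of n]] by simp
    also have "\<dots> \<le> C1"
      unfolding C1_def using zC0[of n] by (intro divide_right_mono add_left_mono mult_left_mono) auto
    finally show ?thesis .
  qed
  \<comment> \<open>Squares of the components of \<open>P n\<close>: the first is split by twice the
    sum of squares, the second is bounded by the growth of \<open>A'\<close>.\<close>
  define C2 where "C2 = (2 * \<kappa>\<^sup>2 + \<tau>\<^sup>2 * CA_bar\<^sup>2) * C0 + 2 * \<tau>\<^sup>2 * C1"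
  have PL: "(\<lambda>x. P n (z n x)) \<in> L2_space \<Omega>" for n
    by (rule strongly_convex_problem.P_L2[OF prob zL])
  have P_bound: "(\<integral>x. (norm (P n (z n x)))\<^sup>2 \<partial>M) \<le> C2" for n
  proof -
    have [measurable]: "z n \<in> borel_measurable M" using zL L2_measurable by blast
    have fm: "(\<lambda>x. fst (z n x)) \<in> borel_measurable M" by (rule L2_measurable[OF L2_fst[OF zL]])
    have bsq: "integrable M (\<lambda>x. (bn n (fst (z n x)))\<^sup>2)"
    proof -
      have "(\<lambda>x. bn n (fst (z n x))) \<in> L2_space \<Omega>"
        by (rule L2_bounded[where C="real n"]) (use fm bn_bound in auto)
      then show ?thesis using L2_integrable_sq by fastforce
    qed
    have "(\<integral>x. (norm (P n (z n x)))\<^sup>2 \<partial>M)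
        \<le> (\<integral>x. (2 * \<kappa>\<^sup>2 + \<tau>\<^sup>2 * CA_bar\<^sup>2) * (norm (z n x))\<^sup>2 + 2 * \<tau>\<^sup>2 * (bn n (fst (z n x)))\<^sup>2 \<partial>M)"
    proof (rule integral_mono)
      fix x
      let ?v = "fst (z n x)" and ?g = "snd (z n x)"
      have nz: "(norm (z n x))\<^sup>2 = ?v\<^sup>2 + (norm ?g)\<^sup>2" by (simp add: norm_prod_def)
      have "(norm (P n (z n x)))\<^sup>2 = (\<kappa> * ?v + \<tau> * bn n ?v)\<^sup>2 + \<tau>\<^sup>2 * (norm (A' ?g))\<^sup>2"
        using \<tau> by (simp add: P_def norm_prod_def power_mult_distrib)
      also have "(\<kappa> * ?v + \<tau> * bn n ?v)\<^sup>2 \<le> 2 * \<kappa>\<^sup>2 * ?v\<^sup>2 + 2 * \<tau>\<^sup>2 * (bn n ?v)\<^sup>2"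
        using norm_add_squared_le[of "\<kappa> * ?v" "\<tau> * bn n ?v"] by (simp add: power_mult_distrib)
      also have "(norm (A' ?g))\<^sup>2 \<le> CA_bar\<^sup>2 * (norm ?g)\<^sup>2"
        using power_mono[OF A'_growth[of ?g], of 2] by (simp add: power_mult_distrib)
      finally have "(norm (P n (z n x)))\<^sup>2 \<le> 2 * \<kappa>\<^sup>2 * ?v\<^sup>2 + 2 * \<tau>\<^sup>2 * (bn n ?v)\<^sup>2 + \<tau>\<^sup>2 * (CA_bar\<^sup>2 * (norm ?g)\<^sup>2)"
        by (simp add: mult_left_mono)
      also have "\<dots> \<le> (2 * \<kappa>\<^sup>2 + \<tau>\<^sup>2 * CA_bar\<^sup>2) * (norm (z n x))\<^sup>2 + 2 * \<tau>\<^sup>2 * (bn n ?v)\<^sup>2"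
        unfolding nz by (simp add: algebra_simps)
      finally show "(norm (P n (z n x)))\<^sup>2 \<le> (2 * \<kappa>\<^sup>2 + \<tau>\<^sup>2 * CA_bar\<^sup>2) * (norm (z n x))\<^sup>2 + 2 * \<tau>\<^sup>2 * (bn n ?v)\<^sup>2" .
    qed (use L2_integrable_sq[OF PL[of n]] L2_integrable_sq[OF zL[of n]] bsq in auto)
    also have "\<dots> = (2 * \<kappa>\<^sup>2 + \<tau>\<^sup>2 * CA_bar\<^sup>2) * (\<integral>x. (norm (z n x))\<^sup>2 \<partial>M) + 2 * \<tau>\<^sup>2 * (\<integral>x. (bn n (fst (z n x)))\<^sup>2 \<partial>M)"
      using L2_integrable_sq[OF zL[of n]] bsq by simp
    also have "\<dots> \<le> C2"
      unfolding C2_def using zC0[of n] b_bound[of n] by (intro add_mono mult_left_mono) auto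
    finally show ?thesis .
  qed

  \<comment> \<open>Identification of the limit equation\<close>
  have limP: "AE x in M. (\<lambda>n. P (r n) (z (r n) x)) \<longlonglongrightarrow> P' (l x)"
    using ae
  proof eventually_elim
    case (elim x)
    let ?v = "\<lambda>n. fst (z (r n) x)"
    have v: "?v \<longlonglongrightarrow> fst (l x)" and g: "(\<lambda>n. snd (z (r n) x)) \<longlonglongrightarrow> snd (l x)"
      using elim by (auto intro: tendsto_intros)
    have b: "(\<lambda>n. \<beta> (?v n)) \<longlonglongrightarrow> \<beta> (fst (l x))"
      using \<beta>_continuous v by (auto simp: continuous_on_eq_continuous_at intro: isCont_tendsto_compose)
    have "(\<lambda>n. bn (r n) (?v n)) \<longlonglongrightarrow> \<beta> (fst (l x))"
    proof (rule Lim_transform_eventually[OF b])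
      \<comment> \<open>At a point of convergence the values of \<open>\<beta>\<close> eventually
        stay below this N, while the truncation level grows beyond it, so the clamp becomes
        inactive.\<close>
      obtain N :: nat where N: "\<bar>\<beta> (fst (l x))\<bar> + 1 \<le> N" using real_arch_simple by blast
      have "\<forall>\<^sub>F n in sequentially. \<bar>\<beta> (?v n) - \<beta> (fst (l x))\<bar> < 1"
        using tendstoD[OF b, of 1] by (simp add: dist_real_def)
      then show "\<forall>\<^sub>F n in sequentially. \<beta> (?v n) = bn (r n) (?v n)"
        using eventually_ge_at_top[of N]
      proof eventually_elim
        case (elim n)
        have "real n \<le> real (r n)" using seq_suble[OF r, of n] by simp
        then have "\<bar>\<beta> (?v n)\<bar> \<le> real (r n)" using elim N by linarith
        then show ?case by (simp add: bn_def clamp_real_eq)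
      qed
    qed
    moreover have "(\<lambda>n. A' (snd (z (r n) x))) \<longlonglongrightarrow> A' (snd (l x))"
      using A'_continuous g by (auto simp: continuous_on_eq_continuous_at intro: isCont_tendsto_compose)
    ultimately show ?case unfolding P_def P'_def by (intro tendsto_intros v)
  qed
  have P'm: "(\<lambda>x. P' (l x)) \<in> borel_measurable M"
  proof -
    have "(\<lambda>x. \<kappa> * fst (l x) + \<tau> * \<beta> (fst (l x))) \<in> borel_measurable M"
      by (rule measurable_compose[OF L2_measurable[OF L2_fst[OF l]], of "\<lambda>s. \<kappa> * s + \<tau> * \<beta> s"]) measurable
    moreover have "(\<lambda>x. \<tau> *\<^sub>R A' (snd (l x))) \<in> borel_measurable M"
      by (rule measurable_compose[OF L2_measurable[OF L2_snd[OF l]], of "\<lambda>q. \<tau> *\<^sub>R A' q"]) measurable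
    ultimately show ?thesis unfolding P'_def by (rule borel_measurable_Pair)
  qed
  note weak = L2_weak_limit[of "\<lambda>n x. P (r n) (z (r n) x)", OF PL P_bound P'm limP]
  have ELl: "L2_inner \<Omega> (\<lambda>x. P' (l x)) \<phi> = L2_inner \<Omega> W \<phi>" if \<phi>: "\<phi> \<in> S" for \<phi>
    using weak(3)[OF S_L2[OF \<phi>]] EL[OF \<phi>] by (simp add: LIMSEQ_const_iff)
  define v where "v x = fst (l x)" for x
  define g where "g x = snd (l x)" for x
  have p: "H1_pair v g" using lS by (simp add: S_def v_def[abs_def] g_def[abs_def])
  note vL = H1_pairD(1)[OF p] and gL = H1_pairD(2)[OF p]
  have P'eq: "(\<lambda>x. P' (l x)) = (\<lambda>x. (\<kappa> * v x + \<tau> * \<beta> (v x), \<tau> *\<^sub>R A' (g x)))"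
    by (simp add: P'_def v_def g_def)
  have aL: "(\<lambda>x. \<kappa> * v x + \<tau> * \<beta> (v x)) \<in> L2_space \<Omega>"
    using L2_fst[OF weak(1)[OF l]] by (simp add: P'_def v_def)
  have "(\<lambda>x. ((\<kappa> * v x + \<tau> * \<beta> (v x)) - \<kappa> * v x) / \<tau> - C\<psi> * v x + \<psi>' 0) \<in> L2_space \<Omega>"
    by (intro L2_add L2_diff L2_divide L2_mult L2_const aL vL)
  then have \<psi>L: "(\<lambda>x. \<psi>' (v x)) \<in> L2_space \<Omega>" using \<tau> by (simp add: \<beta>_def)
  have "step_solution \<tau> w v g"
    unfolding step_solution_def
  proof (intro conjI p allI impI)
    fix \<phi> k assume q: "H1_pair \<phi> k"
    note \<phi>L = H1_pairD(1)[OF q]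
    note i = L2_mult_integrable[OF \<psi>L \<phi>L] L2_mult_integrable[OF vL \<phi>L] L2_mult_integrable[OF w \<phi>L] L2_integrable[OF \<phi>L]
    show "integrable M (\<lambda>x. \<psi>' (v x) * \<phi> x)" by (rule i(1))
    have e: "L2_inner \<Omega> (\<lambda>x. \<kappa> * v x + \<tau> * \<beta> (v x)) \<phi> + \<tau> * L2_inner \<Omega> (\<lambda>x. A' (g x)) k = L2_inner \<Omega> w0 \<phi>"
      using ELl[OF pair_S[OF q]] unfolding P'eq split[OF aL gL q] Wsplit .
    have "(\<lambda>x. (\<kappa> * v x + \<tau> * \<beta> (v x)) \<bullet> \<phi> x) = (\<lambda>x. v x * \<phi> x + \<tau> * (\<psi>' (v x) * \<phi> x) - \<tau> * \<psi>' 0 * \<phi> x)"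
      by (simp add: \<kappa>_def \<beta>_def algebra_simps)
    then have "L2_inner \<Omega> (\<lambda>x. \<kappa> * v x + \<tau> * \<beta> (v x)) \<phi> = L2_inner \<Omega> v \<phi> + \<tau> * L2_inner \<Omega> (\<lambda>x. \<psi>' (v x)) \<phi> - \<tau> * \<psi>' 0 * (\<integral>x. \<phi> x \<partial>M)"
      unfolding L2_inner_def using i by simp
    moreover have "L2_inner \<Omega> w0 \<phi> = L2_inner \<Omega> w \<phi> - \<tau> * \<psi>' 0 * (\<integral>x. \<phi> x \<partial>M)"
      using i by (simp add: L2_inner_def w0_def left_diff_distrib)
    ultimately show "L2_inner \<Omega> v \<phi> + \<tau> * L2_inner \<Omega> (\<lambda>x. A' (g x)) k + \<tau> * L2_inner \<Omega> (\<lambda>x. \<psi>' (v x)) \<phi> = L2_inner \<Omega> w \<phi>"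
      using e by linarith
  qed
  then show ?thesis by blast
qed

end

subsection \<open>Time grids and step functions\<close>

locale time_partition =
  fixes T :: real and N :: nat and t :: "nat \<Rightarrow> real"
  assumes grid: "time_grid T N t"
begin

lemma N_pos: "N \<ge> 1" and t_0: "t 0 = 0" and t_N: "t N = T"
  using grid by (auto simp: time_grid_def)

lemma t_less: "j \<in> {1..N} \<Longrightarrow> t (j - 1) < t j"
  using grid by (auto simp: time_grid_def)

lemma step_size_pos: "j \<in> {1..N} \<Longrightarrow> step_size t j > 0"
  using t_less by (simp add: step_size_def)

lemma step_size_le_mesh: "j \<in> {1..N} \<Longrightarrow> step_size t j \<le> mesh_size N t"
  unfolding mesh_size_def by (intro Max_ge) auto

lemma t_mono: "i \<le> j \<Longrightarrow> j \<le> N \<Longrightarrow> t i \<le> t j"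
proof (induction j rule: dec_induct)
  case (step j)
  then show ?case using t_less[of "Suc j"] by simp
qed simp

lemma t_bounds: "j \<le> N \<Longrightarrow> 0 \<le> t j" "j \<le> N \<Longrightarrow> t j \<le> T"
  using t_mono[of 0 j] t_mono[of j N] t_0 t_N by auto

lemma T_pos: "T > 0"
  using t_less[of N] t_bounds[of "N - 1"] N_pos t_N by simp

lemma t_in_interval: "j \<in> {1..N} \<Longrightarrow> t j \<in> grid_interval t j"
  using t_less by (simp add: grid_interval_def)

lemma interval_subset: "j \<in> {1..N} \<Longrightarrow> s \<in> grid_interval t j \<Longrightarrow> 0 < s \<and> s \<le> T"
proof -
  assume j: "j \<in> {1..N}" and s: "s \<in> grid_interval t j"
  have "0 \<le> t (j - 1)" "t j \<le> T" using j by (auto intro!: t_bounds)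
  then show ?thesis using s by (auto simp: grid_interval_def)
qed

lemma integrable_interval:
  assumes "j \<in> {1..N}"
  shows "integrable lborel (indicator (grid_interval t j) :: real \<Rightarrow> real)"
  unfolding grid_interval_def using t_less[OF assms]
  by (intro integrable_real_indicator) auto

text \<open>Grid intervals are open on the left and closed on the right, so the first grid point not
  before s carries the index of the interval of s; s = 0 gets the index 0 of the initial
  value.\<close>

definition grid_index :: "real \<Rightarrow> nat" where
  "grid_index s = (LEAST j. s \<le> t j)"

lemma grid_index_eq:
  assumes "j \<in> {1..N}" "s \<in> grid_interval t j"
  shows "grid_index s = j"
  unfolding grid_index_def
proof (rule Least_equality)
  show "s \<le> t j" using assms by (simp add: grid_interval_def)
  fix i assume i: "s \<le> t i"
  show "j \<le> i"
  proof (rule ccontr)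
    assume "\<not> j \<le> i"
    then have "t i \<le> t (j - 1)" using assms by (intro t_mono) auto
    then show False using assms(2) i by (simp add: grid_interval_def)
  qed
qed

lemma indicator_interval:
  assumes "j \<in> {1..N}" "s \<in> grid_interval t j" "i \<in> {1..N}"
  shows "indicator (grid_interval t i) s = (if i = j then 1 else 0 :: real)"
proof (cases "i = j")
  case False
  then have "s \<notin> grid_interval t i"
    using grid_index_eq[OF assms(1,2)] grid_index_eq[OF assms(3)] by metis
  then show ?thesis using False by simp
qed (use assms in simp)

lemma grid_index_t: "j \<le> N \<Longrightarrow> grid_index (t j) = j"
proof (cases "j = 0")
  case True
  then show ?thesis by (simp add: grid_index_def t_0 Least_eq_0)
qed (use grid_index_eq[OF _ t_in_interval, of j] in auto)

lemma grid_cover: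
  assumes "0 < s" "s \<le> T"
  obtains j where "j \<in> {1..N}" "s \<in> grid_interval t j"
proof -
  have ex: "s \<le> t N" using assms t_N by simp
  define j where "j = (LEAST j. s \<le> t j)"
  have sj: "s \<le> t j" unfolding j_def using ex by (rule LeastI)
  have jN: "j \<le> N" unfolding j_def using ex by (rule Least_le)
  have j0: "j \<noteq> 0" using sj assms t_0 by (cases j) auto
  then have "\<not> s \<le> t (j - 1)" unfolding j_def using not_less_Least[of "j - 1"] by (metis diff_less j_def less_one neq0_conv)
  then show ?thesis using that[of j] sj jN j0 by (auto simp: grid_interval_def)
qed

lemma sum_step_size: "m \<le> N \<Longrightarrow> (\<Sum>j=1..m. step_size t j) = t m"
  by (induction m) (auto simp: step_size_def t_0)

text \<open>On the real line the integrand, cut off to the open interval from 0 to T, equals a step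
  function except possibly at the point T. Completeness of Lebesgue measure then supplies its
  measurability, so nothing about \<open>F\<close> is assumed beyond its values on the grid
  intervals.\<close>

lemma integral_step:
  fixes F :: "real \<Rightarrow> real"
  assumes F: "\<And>j s. j \<in> {1..N} \<Longrightarrow> s \<in> grid_interval t j \<Longrightarrow> F s = a j"
  shows "integrable (lebesgue_on {0<..<T}) F"
    and "(\<integral>s. F s \<partial>lebesgue_on {0<..<T}) = (\<Sum>j=1..N. step_size t j * a j)"
proof -
  let ?S = "\<lambda>s. \<Sum>j=1..N. a j * indicator (grid_interval t j) s"
  have Sval: "?S s = a j" if "j \<in> {1..N}" "s \<in> grid_interval t j" for s j
  proof -
    have "?S s = (\<Sum>i=1..N. if i = j then a j else 0)"
    proof (rule sum.cong[OF refl])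
      fix i assume i: "i \<in> {1..N}"
      show "a i * indicator (grid_interval t i) s = (if i = j then a j else 0)"
        using indicator_interval[OF that i] by simp
    qed
    then show ?thesis using that by simp
  qed
  have Si: "integrable lborel ?S"
    by (intro Bochner_Integration.integrable_sum integrable_mult_right integrable_interval)
  then have Sb: "?S \<in> borel_measurable lborel" by auto
  have "AE s in lborel. indicator {0<..<T} s * F s = ?S s"
    using AE_lborel_singleton[of T]
  proof eventually_elim
    case (elim s)
    show ?case
    proof (cases "s \<in> {0<..<T}")
      case True
      then obtain j where "j \<in> {1..N}" "s \<in> grid_interval t j" using grid_cover[of s] by auto
      then show ?thesis using Sval F True by simp
    next
      case False
      have "s \<notin> grid_interval t j" if "j \<in> {1..N}" for j
        using interval_subset[OF that, of s] False elim by auto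
      then show ?thesis using False by simp
    qed
  qed
  then have ae: "AE s in lebesgue. ?S s = indicator {0<..<T} s * F s"
    by (intro AE_completion) (auto elim: eventually_mono)
  have SiL: "integrable lebesgue ?S" using Si Sb by (simp add: integrable_completion)
  have m: "(\<lambda>s. indicator {0<..<T} s * F s) \<in> borel_measurable lebesgue"
    by (rule borel_measurable_AE[OF borel_measurable_integrable[OF SiL] ae])
  have "integrable lebesgue (\<lambda>s. indicator {0<..<T} s * F s)"
    by (rule integrable_cong_AE_imp[OF SiL m]) (use ae in auto)
  then show "integrable (lebesgue_on {0<..<T}) F" by (simp add: integrable_restrict_space)
  have "(\<integral>s. F s \<partial>lebesgue_on {0<..<T}) = (\<integral>s. indicator {0<..<T} s * F s \<partial>lebesgue)"
    by (simp add: integral_restrict_space)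
  also have "\<dots> = (\<integral>s. ?S s \<partial>lebesgue)"
    using ae m SiL by (intro integral_cong_AE) auto
  also have "\<dots> = (\<integral>s. ?S s \<partial>lborel)" using Sb by (simp add: integral_completion)
  also have "\<dots> = (\<Sum>j=1..N. \<integral>s. a j * indicator (grid_interval t j) s \<partial>lborel)"
    by (intro Bochner_Integration.integral_sum integrable_mult_right integrable_interval)
  also have "\<dots> = (\<Sum>j=1..N. step_size t j * a j)"
  proof (rule sum.cong[OF refl])
    fix j assume j: "j \<in> {1..N}"
    then show "(\<integral>s. a j * indicator (grid_interval t j) s \<partial>lborel) = step_size t j * a j"
      using t_less[OF j] by (simp add: grid_interval_def step_size_def)
  qed
  finally show "(\<integral>s. F s \<partial>lebesgue_on {0<..<T}) = (\<Sum>j=1..N. step_size t j * a j)" .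
qed

lemma AE_step:
  assumes "\<And>j s. j \<in> {1..N} \<Longrightarrow> s \<in> grid_interval t j \<Longrightarrow> Q s"
  shows "AE s in lebesgue_on {0<..<T}. Q s"
proof (rule AE_I2)
  fix s assume "s \<in> space (lebesgue_on {0<..<T})"
  then have "0 < s" "s \<le> T" by (auto simp: space_restrict_space)
  then obtain j where "j \<in> {1..N}" "s \<in> grid_interval t j" by (rule grid_cover)
  then show "Q s" by (rule assms)
qed

text \<open>A single simple function with the values \<open>W j\<close> serves as constant
  approximating sequence. Its distance to \<open>w\<close> is required to vanish only in the norm,
  since a step function is constant in time merely for almost every x.\<close>

lemma strongly_measurable_step:
  assumes X: "\<And>j. j \<in> {1..N} \<Longrightarrow> W j \<in> X"
    and w: "\<And>j s. j \<in> {1..N} \<Longrightarrow> s \<in> grid_interval t j \<Longrightarrow> w s \<in> X \<and> nrm (\<lambda>x. W j x - w s x) = 0"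
  shows "strongly_measurable T X nrm w"
  unfolding strongly_measurable_def
proof (intro conjI)
  show "AE s in lebesgue_on {0<..<T}. w s \<in> X" by (rule AE_step) (use w in blast)
  let ?E = "\<lambda>i. grid_interval t (Suc i) \<inter> {0<..<T}"
  \<comment> \<open>Simple functions are indexed from 0 and grid intervals from 1, hence
    \<open>Suc i\<close>. The intersection removes the right end point T of the last
    interval.\<close>
  define sf where "sf = (\<lambda>s x. \<Sum>i<N. indicat_real (?E i) s * W (Suc i) x)"
  have bs: "bochner_simple T X sf"
    unfolding bochner_simple_def
  proof (intro exI[of _ N] exI[of _ ?E] exI[of _ "\<lambda>i. W (Suc i)"] conjI allI impI)
    fix i assume i: "i < N"
    show "W (Suc i) \<in> X" using X[of "Suc i"] i by simp
    show "?E i \<in> sets (lebesgue_on {0<..<T})"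
      by (auto simp: sets_restrict_space grid_interval_def intro!: image_eqI[where x="{t i<..t (Suc i)}"])
  qed (simp add: sf_def)
  have ae: "AE s in lebesgue_on {0<..<T}. nrm (\<lambda>x. sf s x - w s x) = 0"
  proof (rule AE_I2)
    fix s assume "s \<in> space (lebesgue_on {0<..<T})"
    then have s: "0 < s" "s < T" by (auto simp: space_restrict_space)
    obtain j where j: "j \<in> {1..N}" "s \<in> grid_interval t j" using grid_cover[of s] s by auto
    have "sf s x = W j x" for x
    proof -
      have "sf s x = (\<Sum>i<N. if i = j - 1 then W j x else 0)"
        unfolding sf_def
      proof (rule sum.cong[OF refl])
        fix i assume i: "i \<in> {..<N}"
        then have "Suc i \<in> {1..N}" by simp
        then show "indicat_real (?E i) s * W (Suc i) x = (if i = j - 1 then W j x else 0)"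
          using j s indicator_interval[OF j, of "Suc i"] by (auto simp: indicator_inter_arith)
      qed
      also have "\<dots> = W j x" using j by auto
      finally show ?thesis .
    qed
    then show "nrm (\<lambda>x. sf s x - w s x) = 0" using w[OF j] by simp
  qed
  show "\<exists>s. (\<forall>n. bochner_simple T X (s n)) \<and>
      (AE \<tau> in lebesgue_on {0<..<T}. (\<lambda>n. nrm (\<lambda>x. s n \<tau> x - w \<tau> x)) \<longlonglongrightarrow> 0)"
  proof (intro exI[of _ "\<lambda>n. sf"] conjI allI bs)
    show "AE \<tau> in lebesgue_on {0<..<T}. (\<lambda>n. nrm (\<lambda>x. sf \<tau> x - w \<tau> x)) \<longlonglongrightarrow> 0"
      using ae by eventually_elim simp
  qed
qed

lemma backward_difference_eq:
  assumes "j \<in> {1..N}" "s \<in> grid_interval t j"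
  shows "backward_difference N t y s x = (y (t j) x - y (t (j - 1)) x) / step_size t j"
proof -
  have "backward_difference N t y s x = (\<Sum>i=1..N. if i = j then (y (t j) x - y (t (j - 1)) x) / step_size t j else 0)"
    unfolding backward_difference_def
  proof (rule sum.cong[OF refl])
    fix i assume i: "i \<in> {1..N}"
    show "indicat_real (grid_interval t i) s * ((y (t i) x - y (t (i - 1)) x) / step_size t i)
      = (if i = j then (y (t j) x - y (t (j - 1)) x) / step_size t j else 0)"
      using indicator_interval[OF assms i] by simp
  qed
  then show ?thesis using assms by simp
qed

lemma step_functions_AE:
  assumes "w \<in> step_functions T \<Omega> N t X" "j \<in> {1..N}" "s \<in> grid_interval t j"
  shows "AE x in lebesgue_on \<Omega>. w s x = w (t j) x"
proof -
  have "AE x in lebesgue_on \<Omega>. \<forall>j\<in>{1..N}. (\<lambda>s. w s x) constant_on grid_interval t j"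
    using assms(1) by (simp add: step_functions_def)
  then show ?thesis
  proof eventually_elim
    case (elim x)
    then have "(\<lambda>s. w s x) constant_on grid_interval t j" using assms(2) by blast
    then obtain c where c: "\<And>r. r \<in> grid_interval t j \<Longrightarrow> w r x = c"
      unfolding constant_on_def by blast
    show ?case using c[OF assms(3)] c[OF t_in_interval[OF assms(2)]] by simp
  qed
qed

lemma step_functions_X: "w \<in> step_functions T \<Omega> N t X \<Longrightarrow> j \<le> N \<Longrightarrow> w (t j) \<in> X"
  using t_bounds[of j] by (auto simp: step_functions_def)

lemma step_functions_X_interval:
  "w \<in> step_functions T \<Omega> N t X \<Longrightarrow> j \<in> {1..N} \<Longrightarrow> s \<in> grid_interval t j \<Longrightarrow> w s \<in> X"
  using interval_subset[of j s] by (auto simp: step_functions_def)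

end

context bounded_open
begin

lemma L2_inner_cong_AE:
  assumes "v \<in> L2_space \<Omega>" "w \<in> L2_space \<Omega>" "AE x in M. v x = v' x" "AE x in M. w x = w' x"
  shows "L2_inner \<Omega> v w = L2_inner \<Omega> v' w'"
proof -
  have "v' \<in> L2_space \<Omega>" "w' \<in> L2_space \<Omega>" using L2_cong_AE assms by blast+
  then have "integrable M (\<lambda>x. v' x \<bullet> w' x)" by (rule L2_inner_integrable)
  moreover have "integrable M (\<lambda>x. v x \<bullet> w x)" using assms by (intro L2_inner_integrable)
  moreover have "AE x in M. v x \<bullet> w x = v' x \<bullet> w' x" using assms(3,4) by eventually_elim simp
  ultimately show ?thesis unfolding L2_inner_def by (intro integral_cong_AE) auto
qed

lemma L2_norm_cong_AE:
  "v \<in> L2_space \<Omega> \<Longrightarrow> AE x in M. v x = w x \<Longrightarrow> L2_norm \<Omega> v = L2_norm \<Omega> w"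
  unfolding L2_norm_def using L2_inner_cong_AE[of v v w w] by simp

lemma L2_norm_zero_AE:
  assumes "v \<in> L2_space \<Omega>" "AE x in M. v x = 0"
  shows "L2_norm \<Omega> v = 0"
  using L2_norm_cong_AE[OF assms] by (simp add: L2_norm_def L2_inner_def)

lemma H1_norm_cong_AE:
  assumes "v \<in> L2_space \<Omega>" "AE x in M. v x = w x"
  shows "H1_norm \<Omega> v = H1_norm \<Omega> w"
  unfolding H1_norm_def
  using L2_inner_cong_AE[OF assms(1,1) assms(2,2)] weak_gradient_cong_AE[OF assms] by simp

lemma H1_norm_zero_AE:
  assumes "v \<in> L2_space \<Omega>" "AE x in M. v x = 0"
  shows "H1_norm \<Omega> v = 0"
proof -
  have g: "AE x in M. weak_gradient \<Omega> (\<lambda>x. 0) x = 0" by (rule weak_gradient_AE[OF H1_pair_zero])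
  have "weak_gradient \<Omega> (\<lambda>x. 0) \<in> L2_space \<Omega>"
    using H1_pairD(2)[OF H1_pair_weak_gradient[of "\<lambda>x. 0"]] H1_pair_zero by (auto simp: H1_space_iff)
  from L2_inner_cong_AE[OF this this g g]
  show ?thesis using H1_norm_cong_AE[OF assms] by (simp add: H1_norm_def L2_inner_def)
qed

lemma H1_space_L2: "v \<in> H1_space \<Omega> \<Longrightarrow> v \<in> L2_space \<Omega>"
  by (simp add: H1_space_def)

end

subsection \<open>The time-discrete problem\<close>

locale discrete_problem = discrete_step \<Omega> A A' CA CA_bar \<psi> \<psi>' C\<psi> m\<psi> + time_partition T N t
  for \<Omega> :: "'a::euclidean_space set" and A A' CA CA_bar \<psi> \<psi>' C\<psi> m\<psi> T N t +
  fixes y0 :: "'a \<Rightarrow> real" and u :: "real \<Rightarrow> 'a \<Rightarrow> real"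
  assumes mesh: "less_reciprocal (mesh_size N t) C\<psi>"
    and y0_H1: "y0 \<in> H1_space \<Omega>" and u_U: "u \<in> U_tau T \<Omega> N t"
begin

abbreviation "solution \<equiv> discrete_state_solution T \<Omega> A' \<psi>' y0 N t u"

lemma step_size_small: "j \<in> {1..N} \<Longrightarrow> step_size t j * C\<psi> < 1"
proof (cases "C\<psi> = 0")
  case False
  assume j: "j \<in> {1..N}"
  have "mesh_size N t < 1 / C\<psi>" using mesh False by (simp add: less_reciprocal_def)
  then have "step_size t j < 1 / C\<psi>" using step_size_le_mesh[OF j] by linarith
  then show ?thesis using False C\<psi>_nonneg by (simp add: field_simps)
qed simp

lemma u_L2: "j \<le> N \<Longrightarrow> u (t j) \<in> L2_space \<Omega>"
  using step_functions_X[of u] u_U by (auto simp: U_tau_def)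

lemma solution_H1: "solution y \<Longrightarrow> j \<le> N \<Longrightarrow> y (t j) \<in> H1_space \<Omega>"
  using step_functions_X[of y] by (auto simp: discrete_state_solution_def Y_tau_def)

lemma solution_equation:
  assumes "solution y" "j \<in> {1..N}" "\<phi> \<in> H1_space \<Omega>"
  shows "integrable M (\<lambda>x. \<psi>' (y (t j) x) * \<phi> x)"
    and "L2_inner \<Omega> (y (t j)) \<phi>
        + step_size t j * L2_inner \<Omega> (\<lambda>x. A' (weak_gradient \<Omega> (y (t j)) x)) (weak_gradient \<Omega> \<phi>)
        + step_size t j * L2_inner \<Omega> (\<lambda>x. \<psi>' (y (t j) x)) \<phi>
      = step_size t j * L2_inner \<Omega> (u (t j)) \<phi> + L2_inner \<Omega> (y (t (j - 1))) \<phi>"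
  using assms unfolding discrete_state_solution_def by blast+

text \<open>The time-discrete equation is stated with the chosen weak gradient of the test function;
  any other representative agrees with it almost everywhere and gives the same integral.\<close>

lemma solution_step:
  assumes y: "solution y" and j: "j \<in> {1..N}"
  shows "step_solution (step_size t j) (\<lambda>x. step_size t j * u (t j) x + y (t (j - 1)) x)
    (y (t j)) (weak_gradient \<Omega> (y (t j)))"
  unfolding step_solution_def
proof (intro conjI allI impI)
  have jN: "j \<le> N" "j - 1 \<le> N" using j by auto
  show p: "H1_pair (y (t j)) (weak_gradient \<Omega> (y (t j)))"
    by (rule H1_pair_weak_gradient[OF solution_H1[OF y jN(1)]])
  fix \<phi> k assume q: "H1_pair \<phi> k"
  then have \<phi>: "\<phi> \<in> H1_space \<Omega>" by (auto simp: H1_space_iff)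
  note \<phi>L = H1_pairD(1)[OF q]
  show "integrable M (\<lambda>x. \<psi>' (y (t j) x) * \<phi> x)"
    by (rule solution_equation(1)[OF y j \<phi>])
  have "L2_inner \<Omega> (\<lambda>x. A' (weak_gradient \<Omega> (y (t j)) x)) (weak_gradient \<Omega> \<phi>)
      = L2_inner \<Omega> (\<lambda>x. A' (weak_gradient \<Omega> (y (t j)) x)) k"
    by (rule L2_inner_cong_AE[OF A'_L2[OF H1_pairD(2)[OF p]] H1_pairD(2)[OF H1_pair_weak_gradient[OF \<phi>]] _ weak_gradient_AE[OF q]]) simp
  moreover have "L2_inner \<Omega> (\<lambda>x. step_size t j * u (t j) x + y (t (j - 1)) x) \<phi>
      = step_size t j * L2_inner \<Omega> (u (t j)) \<phi> + L2_inner \<Omega> (y (t (j - 1))) \<phi>"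
    using L2_mult_integrable[OF u_L2[OF jN(1)] \<phi>L] L2_mult_integrable[OF H1_space_L2[OF solution_H1[OF y jN(2)]] \<phi>L]
    by (simp add: L2_inner_def distrib_right mult.assoc)
  ultimately show "L2_inner \<Omega> (y (t j)) \<phi> + step_size t j * L2_inner \<Omega> (\<lambda>x. A' (weak_gradient \<Omega> (y (t j)) x)) k
      + step_size t j * L2_inner \<Omega> (\<lambda>x. \<psi>' (y (t j) x)) \<phi>
    = L2_inner \<Omega> (\<lambda>x. step_size t j * u (t j) x + y (t (j - 1)) x) \<phi>"
    using solution_equation(2)[OF y j \<phi>] by simp
qed

lemma solution_exists: "\<exists>y. solution y"
proof -
  have "\<exists>Y. \<forall>n. (Y n \<in> H1_space \<Omega> \<and> (n = 0 \<longrightarrow> Y n = y0)) \<and>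
     (n < N \<longrightarrow> (\<exists>g. step_solution (step_size t (Suc n)) (\<lambda>x. step_size t (Suc n) * u (t (Suc n)) x + Y n x) (Y (Suc n)) g))"
  proof (rule dependent_nat_choice)
    show "\<exists>x. x \<in> H1_space \<Omega> \<and> ((0::nat) = 0 \<longrightarrow> x = y0)" using y0_H1 by blast
    fix x :: "'a \<Rightarrow> real" and n :: nat assume x: "x \<in> H1_space \<Omega> \<and> (n = 0 \<longrightarrow> x = y0)"
    show "\<exists>y. (y \<in> H1_space \<Omega> \<and> (Suc n = 0 \<longrightarrow> y = y0)) \<and>
      (n < N \<longrightarrow> (\<exists>g. step_solution (step_size t (Suc n)) (\<lambda>z. step_size t (Suc n) * u (t (Suc n)) z + x z) y g))"
    proof (cases "n < N")
      case True
      then have j: "Suc n \<in> {1..N}" by simp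
      have "(\<lambda>z. step_size t (Suc n) * u (t (Suc n)) z + x z) \<in> L2_space \<Omega>"
        using True x by (intro L2_add L2_mult u_L2 H1_space_L2) auto
      from step_solution_exists[OF step_size_pos[OF j] step_size_small[OF j] this]
      obtain v g where s: "step_solution (step_size t (Suc n)) (\<lambda>z. step_size t (Suc n) * u (t (Suc n)) z + x z) v g"
        by blast
      have "v \<in> H1_space \<Omega>" using step_solutionD(1)[OF s] H1_space_iff by blast
      with s show ?thesis by blast
    next
      case False
      \<comment> \<open>Past the last grid point the sequence is continued constantly, so that
        dependent choice can run over all natural numbers.\<close>
      then show ?thesis using x by (intro exI[of _ x]) auto
    qed
  qed
  then obtain Y where Y: "\<And>n. Y n \<in> H1_space \<Omega>" "Y 0 = y0"
    and st: "\<And>n. n < N \<Longrightarrow> \<exists>g. step_solution (step_size t (Suc n)) (\<lambda>x. step_size t (Suc n) * u (t (Suc n)) x + Y n x) (Y (Suc n)) g"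
    by metis
  define y where "y s = Y (grid_index s)" for s
  have yt: "y (t j) = Y j" if "j \<le> N" for j using grid_index_t[OF that] by (simp add: y_def)
  have "solution y"
    unfolding discrete_state_solution_def
  proof (intro conjI ballI)
    show "y \<in> Y_tau T \<Omega> N t"
      unfolding Y_tau_def step_functions_def
    proof (intro CollectI conjI ballI AE_I2)
      fix s show "y s \<in> H1_space \<Omega>" by (simp add: y_def Y)
    next
      fix x j assume "j \<in> {1..N}"
      then show "(\<lambda>s. y s x) constant_on grid_interval t j"
        using grid_index_eq by (auto simp: constant_on_def y_def)
    qed
    show "AE x in M. y 0 x = y0 x" using yt[of 0] t_0 Y(2) by simp
    fix j \<phi> assume j: "j \<in> {1..N}" and \<phi>: "\<phi> \<in> H1_space \<Omega>"
    define n where "n = j - 1"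
    have n: "n < N" "j = Suc n" "y (t j) = Y (Suc n)" "y (t (j - 1)) = Y n" using j yt[of j] yt[of "j - 1"] by (auto simp: n_def)
    obtain g where s: "step_solution (step_size t j) (\<lambda>x. step_size t j * u (t j) x + Y n x) (Y j) g"
      using st[OF n(1)] n(2) by auto
    note p = step_solutionD(1)[OF s] and q = H1_pair_weak_gradient[OF \<phi>]
    note \<phi>L = H1_pairD(1)[OF q]
    show "integrable M (\<lambda>x. \<psi>' (y (t j) x) * \<phi> x)" using step_solutionD(2)[OF s q] n by simp
    have ae: "AE x in M. weak_gradient \<Omega> (Y j) x = g x" by (rule weak_gradient_AE[OF p])
    have "L2_inner \<Omega> (\<lambda>x. A' (g x)) (weak_gradient \<Omega> \<phi>) = L2_inner \<Omega> (\<lambda>x. A' (weak_gradient \<Omega> (Y j) x)) (weak_gradient \<Omega> \<phi>)"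
      by (rule L2_inner_cong_AE[OF A'_L2[OF H1_pairD(2)[OF p]] H1_pairD(2)[OF q]]) (use ae in auto)
    moreover have "L2_inner \<Omega> (\<lambda>x. step_size t j * u (t j) x + Y n x) \<phi>
        = step_size t j * L2_inner \<Omega> (u (t j)) \<phi> + L2_inner \<Omega> (Y n) \<phi>"
      using L2_mult_integrable[OF u_L2 \<phi>L, of j] j L2_mult_integrable[OF H1_space_L2[OF Y(1)] \<phi>L, of n]
      by (simp add: L2_inner_def distrib_right mult.assoc)
    ultimately show "L2_inner \<Omega> (y (t j)) \<phi> + step_size t j * L2_inner \<Omega> (\<lambda>x. A' (weak_gradient \<Omega> (y (t j)) x)) (weak_gradient \<Omega> \<phi>)
        + step_size t j * L2_inner \<Omega> (\<lambda>x. \<psi>' (y (t j) x)) \<phi>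
      = step_size t j * L2_inner \<Omega> (u (t j)) \<phi> + L2_inner \<Omega> (y (t (j - 1))) \<phi>"
      using step_solutionD(3)[OF s q] n by simp
  qed
  then show ?thesis by blast
qed

text \<open>Induction over the grid points. The exceptional set can be chosen independently of the
  time s, because finitely many grid values determine a step function for almost every x.\<close>

lemma solution_unique:
  assumes y: "solution y" and z: "solution z"
  shows "AE x in M. \<forall>s\<in>{0..T}. y s x = z s x"
proof -
  have yz: "AE x in M. y (t j) x = z (t j) x" if "j \<le> N" for j
    using that
  proof (induction j)
    case 0
    have "AE x in M. y 0 x = y0 x" "AE x in M. z 0 x = y0 x"
      using y z by (auto simp: discrete_state_solution_def)
    then have "AE x in M. y 0 x = z 0 x" by eventually_elim simp
    then show ?case by (simp add: t_0)
  next
    case (Suc n)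
    then have j: "Suc n \<in> {1..N}" by simp
    have ae: "AE x in M. y (t n) x = z (t n) x" using Suc by simp
    show ?case
    proof (rule step_solution_unique[OF solution_step[OF y j] solution_step[OF z j] _ _ step_size_pos[OF j] step_size_small[OF j]])
      show "(\<lambda>x. step_size t (Suc n) * u (t (Suc n)) x + y (t (Suc n - 1)) x) \<in> L2_space \<Omega>"
        using Suc.prems by (intro L2_add L2_mult u_L2 H1_space_L2 solution_H1[OF y]) auto
      show "AE x in M. step_size t (Suc n) * u (t (Suc n)) x + y (t (Suc n - 1)) x
          = step_size t (Suc n) * u (t (Suc n)) x + z (t (Suc n - 1)) x"
        using ae by eventually_elim simp
    qed
  qed
  have "AE x in M. \<forall>j\<in>{..N}. y (t j) x = z (t j) x"
    using yz by (intro AE_finite_allI) auto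
  moreover have "AE x in M. \<forall>j\<in>{1..N}. (\<lambda>s. y s x) constant_on grid_interval t j"
    "AE x in M. \<forall>j\<in>{1..N}. (\<lambda>s. z s x) constant_on grid_interval t j"
    using y z by (auto simp: discrete_state_solution_def Y_tau_def step_functions_def)
  ultimately show ?thesis
  proof eventually_elim
    case (elim x)
    show ?case
    proof
      fix s assume s: "s \<in> {0..T}"
      show "y s x = z s x"
      proof (cases "s = 0")
        case True
        then show ?thesis using elim(1) t_0 by (metis atMost_iff le0)
      next
        case False
        then obtain j where j: "j \<in> {1..N}" "s \<in> grid_interval t j" using s grid_cover[of s] by auto
        note tj = t_in_interval[OF j(1)]
        have "y s x = y (t j) x" using elim(2) j tj by (metis constant_on_def)
        also have "\<dots> = z (t j) x" using elim(1) j by simp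
        also have "\<dots> = z s x" using elim(3) j tj by (metis constant_on_def)
        finally show ?thesis .
      qed
    qed
  qed
qed

end

subsection \<open>A priori estimates\<close>

lemma square_sum4_le: "(a - b + c - d)\<^sup>2 \<le> 4 * (a\<^sup>2 + b\<^sup>2 + c\<^sup>2 + d\<^sup>2)" for a b c d :: real
  using norm_add_squared_le[of "a - b" "c - d"] norm_diff_squared_le[of a b] norm_diff_squared_le[of c d]
  by (simp add: add_diff_eq)

text \<open>Cauchy-Schwarz with weights sqrt(\<tau> j). The factor that appears is the total time
  and not the number of steps, which keeps the later bounds independent of the grid.\<close>

lemma square_sum_le_weighted:
  fixes \<delta> \<tau> :: "nat \<Rightarrow> real"
  assumes "\<And>j. j \<in> I \<Longrightarrow> \<tau> j > 0"
  shows "(\<Sum>j\<in>I. \<delta> j)\<^sup>2 \<le> (\<Sum>j\<in>I. \<tau> j) * (\<Sum>j\<in>I. (\<delta> j)\<^sup>2 / \<tau> j)"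
proof -
  have "(\<Sum>j\<in>I. sqrt (\<tau> j) * (\<delta> j / sqrt (\<tau> j)))\<^sup>2 \<le> (\<Sum>j\<in>I. (sqrt (\<tau> j))\<^sup>2) * (\<Sum>j\<in>I. (\<delta> j / sqrt (\<tau> j))\<^sup>2)"
    by (rule Cauchy_Schwarz_ineq_sum)
  moreover have "sqrt (\<tau> j) * (\<delta> j / sqrt (\<tau> j)) = \<delta> j" "(sqrt (\<tau> j))\<^sup>2 = \<tau> j"
    "(\<delta> j / sqrt (\<tau> j))\<^sup>2 = (\<delta> j)\<^sup>2 / \<tau> j" if "j \<in> I" for j
    using assms[OF that] by (simp_all add: power_divide)
  ultimately show ?thesis by (simp cong: sum.cong)
qed

context discrete_step
begin

text \<open>The initial energy, plus the most that controls bounded by \<open>cbar\<close> can add,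
  minus a lower bound of the energy: what is left for dissipation and for the gradient.\<close>

definition energy_gap :: "('a \<Rightarrow> real) \<Rightarrow> real \<Rightarrow> real" where
  "energy_gap y0 cbar = total_energy y0 (weak_gradient \<Omega> y0) + cbar\<^sup>2 - (\<integral>x. A 0 + m\<psi> \<partial>M)"

text \<open>Twice the square of the initial state plus twice that of the displacement, the latter
  being at most T times four energy gaps.\<close>

definition L2_bound :: "real \<Rightarrow> ('a \<Rightarrow> real) \<Rightarrow> real \<Rightarrow> real" where
  "L2_bound T y0 cbar = 2 * (\<integral>x. (y0 x)\<^sup>2 \<partial>M) + 8 * T * energy_gap y0 cbar"

text \<open>The sum over the grid of the bounds for single steps: 16 for the controls, 16 * 4 for
  the dissipation, and 20 for the terms that integrate to a factor T.\<close>

definition \<psi>'_bound :: "real \<Rightarrow> ('a \<Rightarrow> real) \<Rightarrow> real \<Rightarrow> real" where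
  "\<psi>'_bound T y0 cbar = 16 * cbar\<^sup>2 + 64 * energy_gap y0 cbar
     + 20 * T * (C\<psi>\<^sup>2 * L2_bound T y0 cbar + (\<integral>x. (\<psi>' 0)\<^sup>2 \<partial>M))"

definition a_priori_bound :: "real \<Rightarrow> ('a \<Rightarrow> real) \<Rightarrow> real \<Rightarrow> real" where
  "a_priori_bound T y0 cbar = sqrt (4 * energy_gap y0 cbar)
     + sqrt (L2_bound T y0 cbar + 2 * energy_gap y0 cbar / CA) + sqrt (\<psi>'_bound T y0 cbar)"

lemma total_energy_ge:
  assumes "H1_pair v g" "integrable M (\<lambda>x. \<psi> (v x))"
  shows "(\<integral>x. A 0 + m\<psi> \<partial>M) + CA / 2 * (\<integral>x. (norm (g x))\<^sup>2 \<partial>M) \<le> total_energy v g"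
proof -
  note i = A_integrable[OF H1_pairD(2)[OF assms(1)]] L2_integrable_sq[OF H1_pairD(2)[OF assms(1)]] assms(2)
  have "(\<integral>x. A 0 + m\<psi> \<partial>M) + CA / 2 * (\<integral>x. (norm (g x))\<^sup>2 \<partial>M) = (\<integral>x. (A 0 + m\<psi>) + CA / 2 * (norm (g x))\<^sup>2 \<partial>M)"
    using i by simp
  also have "\<dots> \<le> (\<integral>x. A (g x) + \<psi> (v x) \<partial>M)"
  proof (rule integral_mono)
    fix x show "(A 0 + m\<psi>) + CA / 2 * (norm (g x))\<^sup>2 \<le> A (g x) + \<psi> (v x)"
      using A_bounds(1)[of "g x"] \<psi>_bound[of "v x"] by simp
  qed (use i in auto)
  also have "\<dots> = total_energy v g" using i by (simp add: total_energy_def)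
  finally show ?thesis .
qed

end

context discrete_problem
begin

text \<open>With the energy bounded below, the summed step estimates control both the dissipation
  and the gradients. The lower bound of the energy does not involve the size of the state, so its
  L^2 norm is recovered from the initial value and the increments.\<close>

theorem a_priori_estimate:
  assumes y: "solution y" and \<psi>0: "integrable M (\<lambda>x. \<psi> (y0 x))"
    and cbar: "bochner_L2_norm T (L2_norm \<Omega>) u \<le> cbar"
  shows "backward_difference N t y \<in> bochner_L2 T (L2_space \<Omega>) (L2_norm \<Omega>)"
    and "y \<in> bochner_Linf T (H1_space \<Omega>) (H1_norm \<Omega>)"
    and "(\<lambda>s x. \<psi>' (y s x)) \<in> bochner_L2 T (L2_space \<Omega>) (L2_norm \<Omega>)"
    and "bochner_L2_norm T (L2_norm \<Omega>) (backward_difference N t y)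
      + bochner_Linf_norm T (H1_norm \<Omega>) y
      + bochner_L2_norm T (L2_norm \<Omega>) (\<lambda>s x. \<psi>' (y s x)) \<le> a_priori_bound T y0 cbar"
proof -
  define \<tau> where "\<tau> = step_size t"
  define g where "g j = weak_gradient \<Omega> (y (t j))" for j
  define \<delta> where "\<delta> j x = y (t j) x - y (t (j - 1)) x" for j x
  define D where "D j = (\<integral>x. (\<delta> j x)\<^sup>2 \<partial>M)" for j
  define U where "U j = (\<integral>x. (u (t j) x)\<^sup>2 \<partial>M)" for j
  define R where "R = energy_gap y0 cbar"
  define Y where "Y = L2_bound T y0 cbar"
  have \<tau>: "\<tau> j > 0" "\<tau> j * C\<psi> < 1" if "j \<in> {1..N}" for j
    using step_size_pos[OF that] step_size_small[OF that] by (auto simp: \<tau>_def)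
  have yH: "y (t j) \<in> H1_space \<Omega>" if "j \<le> N" for j by (rule solution_H1[OF y that])
  have pair: "H1_pair (y (t j)) (g j)" if "j \<le> N" for j
    unfolding g_def by (rule H1_pair_weak_gradient[OF yH[OF that]])
  have yL: "y (t j) \<in> L2_space \<Omega>" if "j \<le> N" for j by (rule H1_pairD(1)[OF pair[OF that]])
  have ysq: "integrable M (\<lambda>x. (y (t j) x)\<^sup>2)" if "j \<le> N" for j using L2_integrable_sq[OF yL[OF that]] by simp
  have \<delta>L: "\<delta> j \<in> L2_space \<Omega>" if "j \<le> N" for j
    unfolding \<delta>_def using that by (intro L2_diff yL) auto
  have \<delta>sq: "integrable M (\<lambda>x. (\<delta> j x)\<^sup>2)" if "j \<le> N" for j using L2_integrable_sq[OF \<delta>L[OF that]] by simp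
  have usq: "integrable M (\<lambda>x. (u (t j) x)\<^sup>2)" if "j \<le> N" for j using L2_integrable_sq[OF u_L2[OF that]] by simp
  have D0: "0 \<le> D j" and U0: "0 \<le> U j" for j by (simp_all add: D_def U_def)
  have yT: "y \<in> step_functions T \<Omega> N t (H1_space \<Omega>)" using y by (simp add: discrete_state_solution_def Y_tau_def)
  have uT: "u \<in> step_functions T \<Omega> N t (L2_space \<Omega>)" using u_U by (simp add: U_tau_def)

  have Usum: "(\<Sum>j=1..N. \<tau> j * U j) \<le> cbar\<^sup>2"
  proof -
    have "(L2_norm \<Omega> (u s))\<^sup>2 = U j" if j: "j \<in> {1..N}" and s: "s \<in> grid_interval t j" for j s
      using L2_norm_cong_AE[OF step_functions_X_interval[OF uT j s] step_functions_AE[OF uT j s]]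
      by (simp add: L2_norm_sq U_def)
    from integral_step(2)[of "\<lambda>s. (L2_norm \<Omega> (u s))\<^sup>2" U, OF this]
    have "bochner_L2_norm T (L2_norm \<Omega>) u = sqrt (\<Sum>j=1..N. \<tau> j * U j)"
      by (simp add: bochner_L2_norm_def \<tau>_def)
    then show ?thesis using cbar by (auto dest: sqrt_le_D)
  qed

  have y0_AE: "AE x in M. y (t 0) x = y0 x" using y by (simp add: discrete_state_solution_def t_0)
  have y0L: "y0 \<in> L2_space \<Omega>" by (rule H1_space_L2[OF y0_H1])
  have \<psi>m: "(\<lambda>x. \<psi> (v x)) \<in> borel_measurable M" if "v \<in> L2_space \<Omega>" for v
    by (rule measurable_compose[OF L2_measurable[OF that] \<psi>_borel])

  \<comment> \<open>Energy inequality up to an arbitrary grid point\<close>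
  have energy: "integrable M (\<lambda>x. \<psi> (y (t m) x)) \<and>
      (\<Sum>j=1..m. D j / (4 * \<tau> j)) + total_energy (y (t m)) (g m)
        \<le> total_energy y0 (weak_gradient \<Omega> y0) + (\<Sum>j=1..m. \<tau> j * U j)" if "m \<le> N" for m
    using that
  proof (induction m)
    case 0
    have ae: "AE x in M. \<psi> (y0 x) = \<psi> (y (t 0) x)" using y0_AE by eventually_elim simp
    have i: "integrable M (\<lambda>x. \<psi> (y (t 0) x))"
      by (rule integrable_cong_AE_imp[OF \<psi>0 \<psi>m[OF yL]]) (use ae in auto)
    have "(\<integral>x. \<psi> (y0 x) \<partial>M) = (\<integral>x. \<psi> (y (t 0) x) \<partial>M)"
      using i \<psi>0 ae by (intro integral_cong_AE) auto
    moreover have "g 0 = weak_gradient \<Omega> y0"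
      unfolding g_def by (rule weak_gradient_cong_AE[OF yL y0_AE]) simp
    ultimately show ?case using i by (simp add: total_energy_def)
  next
    case (Suc m)
    then have j: "Suc m \<in> {1..N}" and m: "m \<le> N" by auto
    have \<psi>i: "integrable M (\<lambda>x. \<psi> (y (t (Suc m - 1)) x))" using Suc by simp
    note est = step_energy_estimate[OF solution_step[OF y j] _ u_L2[OF Suc.prems] step_size_pos[OF j] step_size_small[OF j] \<psi>i,
        of "g m", simplified, OF pair[OF m]]
    have "D (Suc m) / (4 * \<tau> (Suc m)) + total_energy (y (t (Suc m))) (g (Suc m))
        \<le> total_energy (y (t m)) (g m) + \<tau> (Suc m) * U (Suc m)"
      using est(2) by (simp add: D_def \<delta>_def \<tau>_def g_def U_def)
    then show ?case using Suc est(1) by simp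
  qed
  have main: "(\<Sum>j=1..m. D j / (4 * \<tau> j)) + CA / 2 * (\<integral>x. (norm (g m x))\<^sup>2 \<partial>M) \<le> R" if m: "m \<le> N" for m
  proof -
    \<comment> \<open>The hypothesis bounds the control over the whole time interval only; the terms
      after m are nonnegative.\<close>
    have "(\<Sum>j=1..m. \<tau> j * U j) \<le> (\<Sum>j=1..N. \<tau> j * U j)"
      using m U0 \<tau>(1) by (intro sum_mono2) (auto intro: mult_nonneg_nonneg less_imp_le)
    then show ?thesis
      using energy[OF m] total_energy_ge[OF pair[OF m]] Usum by (simp add: R_def energy_gap_def)
  qed
  have DS: "(\<Sum>j=1..m. D j / \<tau> j) \<le> 4 * R" if m: "m \<le> N" for m
  proof -
    have "0 \<le> CA / 2 * (\<integral>x. (norm (g m x))\<^sup>2 \<partial>M)" using CA_pos by simp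
    then have "(\<Sum>j=1..m. D j / (4 * \<tau> j)) \<le> R" using main[OF m] by linarith
    moreover have "(\<Sum>j=1..m. D j / (4 * \<tau> j)) = (\<Sum>j=1..m. D j / \<tau> j) / 4"
      by (simp add: sum_divide_distrib mult.commute)
    ultimately show ?thesis by simp
  qed
  have G: "(\<integral>x. (norm (g m x))\<^sup>2 \<partial>M) \<le> 2 * R / CA" if m: "m \<le> N" for m
  proof -
    have "0 \<le> (\<Sum>j=1..m. D j / (4 * \<tau> j))"
      using D0 \<tau>(1) m by (intro sum_nonneg divide_nonneg_nonneg) (auto intro: less_imp_le)
    then have "CA / 2 * (\<integral>x. (norm (g m x))\<^sup>2 \<partial>M) \<le> R" using main[OF m] by linarith
    then show ?thesis using CA_pos by (simp add: field_simps)
  qed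
  \<comment> \<open>The displacement from the initial state telescopes into increments; weighted
    Cauchy-Schwarz bounds it pointwise by the elapsed time \<open>t m\<close> times the dissipation
    density.\<close>
  have Ysq: "(\<integral>x. (y (t m) x)\<^sup>2 \<partial>M) \<le> Y" if m: "m \<le> N" for m
  proof -
    have tele: "y (t m) x - y (t 0) x = (\<Sum>j=1..m. \<delta> j x)" for x
      by (induction m) (auto simp: \<delta>_def)
    have pos: "\<tau> j > 0" if "j \<in> {1..m}" for j using \<tau>(1) that m by auto
    have i: "integrable M (\<lambda>x. t m * (\<Sum>j=1..m. (\<delta> j x)\<^sup>2 / \<tau> j))"
      using \<delta>sq m by (intro integrable_mult_right Bochner_Integration.integrable_sum integrable_divide) auto
    have "(\<integral>x. (y (t m) x)\<^sup>2 \<partial>M) \<le> (\<integral>x. 2 * (y (t 0) x)\<^sup>2 + 2 * (t m * (\<Sum>j=1..m. (\<delta> j x)\<^sup>2 / \<tau> j)) \<partial>M)"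
    proof (rule integral_mono)
      fix x
      have "(y (t m) x)\<^sup>2 \<le> 2 * (y (t 0) x)\<^sup>2 + 2 * (y (t m) x - y (t 0) x)\<^sup>2"
        using norm_add_squared_le[of "y (t 0) x" "y (t m) x - y (t 0) x"] by simp
      also have "(y (t m) x - y (t 0) x)\<^sup>2 \<le> t m * (\<Sum>j=1..m. (\<delta> j x)\<^sup>2 / \<tau> j)"
        unfolding tele using square_sum_le_weighted[of "{1..m}" \<tau> "\<lambda>j. \<delta> j x", OF pos] sum_step_size[OF m]
        by (simp add: \<tau>_def)
      finally show "(y (t m) x)\<^sup>2 \<le> 2 * (y (t 0) x)\<^sup>2 + 2 * (t m * (\<Sum>j=1..m. (\<delta> j x)\<^sup>2 / \<tau> j))" by simp
    qed (use ysq[OF m] ysq[of 0] i in auto)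
    also have "\<dots> = 2 * (\<integral>x. (y (t 0) x)\<^sup>2 \<partial>M) + 2 * (\<integral>x. t m * (\<Sum>j=1..m. (\<delta> j x)\<^sup>2 / \<tau> j) \<partial>M)"
      using ysq[of 0] i by simp
    also have "(\<integral>x. t m * (\<Sum>j=1..m. (\<delta> j x)\<^sup>2 / \<tau> j) \<partial>M) = t m * (\<Sum>j=1..m. D j / \<tau> j)"
      unfolding D_def using \<delta>sq m by (simp add: Bochner_Integration.integral_sum)
    also have "(\<integral>x. (y (t 0) x)\<^sup>2 \<partial>M) = (\<integral>x. (y0 x)\<^sup>2 \<partial>M)"
      using ysq[of 0] L2_integrable_sq[OF y0L] y0_AE by (intro integral_cong_AE) auto
    also have "t m * (\<Sum>j=1..m. D j / \<tau> j) \<le> T * (4 * R)"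
      using t_bounds[OF m] DS[OF m] T_pos D0 pos
      by (intro mult_mono sum_nonneg divide_nonneg_nonneg) (auto intro: less_imp_le)
    finally show ?thesis by (simp add: Y_def L2_bound_def R_def)
  qed

  \<comment> \<open>The nonlinear term in a single time step\<close>
  have \<psi>'L: "(\<lambda>x. \<psi>' (y (t j) x)) \<in> L2_space \<Omega>"
    and \<psi>'sq: "(\<integral>x. (\<psi>' (y (t j) x))\<^sup>2 \<partial>M) \<le> 16 * U j + 16 * (D j / (\<tau> j)\<^sup>2) + 20 * (C\<psi>\<^sup>2 * Y + (\<integral>x. (\<psi>' 0)\<^sup>2 \<partial>M))"
    if j: "j \<in> {1..N}" for j
  proof -
    have jN: "j \<le> N" "j - 1 \<le> N" using j by auto
    note \<tau>j = \<tau>(1)[OF j]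
    let ?w = "\<lambda>x. step_size t j * u (t j) x + y (t (j - 1)) x"
    have wL: "?w \<in> L2_space \<Omega>" by (intro L2_add L2_mult u_L2 yL jN)
    note s = step_solution_L2[OF solution_step[OF y j] step_size_pos[OF j] wL]
    show "(\<lambda>x. \<psi>' (y (t j) x)) \<in> L2_space \<Omega>" by (rule s(3))
    let ?K = "\<integral>x. (\<psi>' 0)\<^sup>2 \<partial>M" and ?Y = "\<integral>x. (y (t j) x)\<^sup>2 \<partial>M"
    have bsq: "integrable M (\<lambda>x. (\<beta> (y (t j) x))\<^sup>2)" using L2_integrable_sq[OF s(1)] by simp
    have psq: "integrable M (\<lambda>x. (\<psi>' (y (t j) x))\<^sup>2)" using L2_integrable_sq[OF s(3)] by simp
    have "(\<integral>x. (\<beta> (y (t j) x))\<^sup>2 \<partial>M) \<le> (\<integral>x. ((?w x - y (t j) x) / step_size t j + C\<psi> * y (t j) x - \<psi>' 0)\<^sup>2 \<partial>M)"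
      by (rule s(2))
    also have "\<dots> \<le> (\<integral>x. 4 * ((u (t j) x)\<^sup>2 + (\<delta> j x)\<^sup>2 / (\<tau> j)\<^sup>2 + C\<psi>\<^sup>2 * (y (t j) x)\<^sup>2 + (\<psi>' 0)\<^sup>2) \<partial>M)"
    proof (rule integral_mono)
      have "(\<lambda>x. (?w x - y (t j) x) / step_size t j + C\<psi> * y (t j) x - \<psi>' 0) \<in> L2_space \<Omega>"
        by (intro L2_add L2_diff L2_divide L2_mult L2_const wL yL jN)
      from L2_integrable_sq[OF this]
      show "integrable M (\<lambda>x. ((?w x - y (t j) x) / step_size t j + C\<psi> * y (t j) x - \<psi>' 0)\<^sup>2)" by simp
      fix x
      have "(?w x - y (t j) x) / step_size t j = u (t j) x - \<delta> j x / \<tau> j"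
        using \<tau>j by (simp add: \<tau>_def \<delta>_def field_simps)
      then show "((?w x - y (t j) x) / step_size t j + C\<psi> * y (t j) x - \<psi>' 0)\<^sup>2
          \<le> 4 * ((u (t j) x)\<^sup>2 + (\<delta> j x)\<^sup>2 / (\<tau> j)\<^sup>2 + C\<psi>\<^sup>2 * (y (t j) x)\<^sup>2 + (\<psi>' 0)\<^sup>2)"
        using square_sum4_le[of "u (t j) x" "\<delta> j x / \<tau> j" "C\<psi> * y (t j) x" "\<psi>' 0"]
        by (simp add: power_divide power_mult_distrib)
    qed (use usq[OF jN(1)] \<delta>sq[OF jN(1)] ysq[OF jN(1)] in auto)
    also have "\<dots> = 4 * (U j + D j / (\<tau> j)\<^sup>2 + C\<psi>\<^sup>2 * ?Y + ?K)"
      unfolding U_def D_def using usq[OF jN(1)] \<delta>sq[OF jN(1)] ysq[OF jN(1)] by simp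
    finally have B: "(\<integral>x. (\<beta> (y (t j) x))\<^sup>2 \<partial>M) \<le> 4 * (U j + D j / (\<tau> j)\<^sup>2 + C\<psi>\<^sup>2 * ?Y + ?K)" .
    have "(\<integral>x. (\<psi>' (y (t j) x))\<^sup>2 \<partial>M) \<le> (\<integral>x. 4 * ((\<beta> (y (t j) x))\<^sup>2 + C\<psi>\<^sup>2 * (y (t j) x)\<^sup>2 + (\<psi>' 0)\<^sup>2) \<partial>M)"
    proof (rule integral_mono)
      fix x
      show "(\<psi>' (y (t j) x))\<^sup>2 \<le> 4 * ((\<beta> (y (t j) x))\<^sup>2 + C\<psi>\<^sup>2 * (y (t j) x)\<^sup>2 + (\<psi>' 0)\<^sup>2)"
        using square_sum4_le[of "\<beta> (y (t j) x)" "C\<psi> * y (t j) x" "\<psi>' 0" 0]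
        by (simp add: \<beta>_def power_mult_distrib)
    qed (use bsq psq ysq[OF jN(1)] in auto)
    also have "\<dots> = 4 * ((\<integral>x. (\<beta> (y (t j) x))\<^sup>2 \<partial>M) + C\<psi>\<^sup>2 * ?Y + ?K)"
      using bsq ysq[OF jN(1)] by simp
    finally have F: "(\<integral>x. (\<psi>' (y (t j) x))\<^sup>2 \<partial>M) \<le> 4 * ((\<integral>x. (\<beta> (y (t j) x))\<^sup>2 \<partial>M) + C\<psi>\<^sup>2 * ?Y + ?K)" .
    have c: "C\<psi>\<^sup>2 * ?Y \<le> C\<psi>\<^sup>2 * Y" using Ysq[OF jN(1)] by (intro mult_left_mono) auto
    \<comment> \<open>Here c and k enter both estimates: 4 * 4 from the bound of
      \<open>\<beta>\<close> and another 4 from passing to \<open>\<psi>'\<close>, together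
      20.\<close>
    have arith: "p \<le> 16 * q + 16 * e + 20 * (c' + k)" if "p \<le> 4 * (b + c + k)" "b \<le> 4 * (q + e + c + k)" "c \<le> c'"
      for p q e b c c' k :: real using that by (simp add: distrib_left)
    show "(\<integral>x. (\<psi>' (y (t j) x))\<^sup>2 \<partial>M) \<le> 16 * U j + 16 * (D j / (\<tau> j)\<^sup>2) + 20 * (C\<psi>\<^sup>2 * Y + ?K)"
      by (rule arith[OF F B c])
  qed

  \<comment> \<open>Norm of the backward difference quotient\<close>
  have bd: "backward_difference N t y s = (\<lambda>x. \<delta> j x / \<tau> j)" if "j \<in> {1..N}" "s \<in> grid_interval t j" for j s
    by (rule ext) (simp add: backward_difference_eq[OF that] \<delta>_def \<tau>_def)
  have bdL: "(\<lambda>x. \<delta> j x / \<tau> j) \<in> L2_space \<Omega>" if "j \<in> {1..N}" for j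
    using that by (intro L2_divide \<delta>L) auto
  have bd_norm: "(L2_norm \<Omega> (backward_difference N t y s))\<^sup>2 = D j / (\<tau> j)\<^sup>2"
    if "j \<in> {1..N}" "s \<in> grid_interval t j" for j s
    unfolding bd[OF that] L2_norm_sq D_def by (simp add: power_divide)
  show "backward_difference N t y \<in> bochner_L2 T (L2_space \<Omega>) (L2_norm \<Omega>)"
    unfolding bochner_L2_def
  proof (intro CollectI conjI)
    show "strongly_measurable T (L2_space \<Omega>) (L2_norm \<Omega>) (backward_difference N t y)"
      by (rule strongly_measurable_step[where W="\<lambda>j x. \<delta> j x / \<tau> j"])
        (auto simp: bd bdL L2_norm_def L2_inner_def)
    show "integrable (lebesgue_on {0<..<T}) (\<lambda>s. (L2_norm \<Omega> (backward_difference N t y s))\<^sup>2)"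
      by (rule integral_step(1)[OF bd_norm])
  qed
  have n1: "bochner_L2_norm T (L2_norm \<Omega>) (backward_difference N t y) \<le> sqrt (4 * R)"
  proof -
    have "(\<integral>s. (L2_norm \<Omega> (backward_difference N t y s))\<^sup>2 \<partial>lebesgue_on {0<..<T}) = (\<Sum>j=1..N. step_size t j * (D j / (\<tau> j)\<^sup>2))"
      by (rule integral_step(2)[OF bd_norm])
    also have "\<dots> = (\<Sum>j=1..N. D j / \<tau> j)"
      using \<tau>(1) by (intro sum.cong refl) (auto simp: \<tau>_def power2_eq_square)
    also have "\<dots> \<le> 4 * R" by (rule DS) simp
    finally show ?thesis by (simp add: bochner_L2_norm_def)
  qed

  \<comment> \<open>Essential supremum of the H^1 norm\<close>
  have ys: "AE x in M. y s x = y (t j) x" "y s \<in> H1_space \<Omega>" if "j \<in> {1..N}" "s \<in> grid_interval t j" for j s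
    using step_functions_AE[OF yT that] step_functions_X_interval[OF yT that] by auto
  have H1: "H1_norm \<Omega> (y s) = H1_norm \<Omega> (y (t j))" if "j \<in> {1..N}" "s \<in> grid_interval t j" for j s
    by (rule H1_norm_cong_AE[OF H1_space_L2[OF ys(2)[OF that]] ys(1)[OF that]])
  have H1_le: "H1_norm \<Omega> (y (t j)) \<le> sqrt (Y + 2 * R / CA)" if "j \<le> N" for j
  proof -
    have "L2_inner \<Omega> (y (t j)) (y (t j)) + L2_inner \<Omega> (g j) (g j) \<le> Y + 2 * R / CA"
    proof -
      have "L2_inner \<Omega> (y (t j)) (y (t j)) = (\<integral>x. (y (t j) x)\<^sup>2 \<partial>M)"
        by (simp add: L2_inner_def power2_eq_square)
      moreover have "L2_inner \<Omega> (g j) (g j) = (\<integral>x. (norm (g j x))\<^sup>2 \<partial>M)"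
        by (simp add: L2_inner_def power2_norm_eq_inner)
      ultimately show ?thesis using Ysq[OF that] G[OF that] by simp
    qed
    then show ?thesis by (simp add: H1_norm_def g_def)
  qed
  have meas: "(\<lambda>s. ereal (H1_norm \<Omega> (y s))) \<in> borel_measurable (lebesgue_on {0<..<T})"
    by (intro borel_measurable_ereal borel_measurable_integrable[OF integral_step(1)[OF H1]])
  have ess: "esssup (lebesgue_on {0<..<T}) (\<lambda>s. ereal (H1_norm \<Omega> (y s))) \<le> ereal (sqrt (Y + 2 * R / CA))"
    by (rule esssup_I[OF meas], rule AE_step) (use H1 H1_le in auto)
  show "y \<in> bochner_Linf T (H1_space \<Omega>) (H1_norm \<Omega>)"
    unfolding bochner_Linf_def
  proof (intro CollectI conjI)
    show "strongly_measurable T (H1_space \<Omega>) (H1_norm \<Omega>) y"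
    proof (rule strongly_measurable_step[where W="\<lambda>j. y (t j)"])
      show "y (t j) \<in> H1_space \<Omega>" if "j \<in> {1..N}" for j using that by (intro yH) auto
      fix j s assume js: "j \<in> {1..N}" "s \<in> grid_interval t j"
      have "(\<lambda>x. y (t j) x - y s x) \<in> L2_space \<Omega>"
        using js by (intro L2_diff yL H1_space_L2 ys(2)[OF js]) auto
      moreover have "AE x in M. y (t j) x - y s x = 0" using ys(1)[OF js] by eventually_elim simp
      ultimately show "y s \<in> H1_space \<Omega> \<and> H1_norm \<Omega> (\<lambda>x. y (t j) x - y s x) = 0"
        using ys(2)[OF js] H1_norm_zero_AE by blast
    qed
    show "esssup (lebesgue_on {0<..<T}) (\<lambda>s. ereal (H1_norm \<Omega> (y s))) < \<infinity>"
      using ess by (rule le_less_trans) simp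
  qed
  have n2: "bochner_Linf_norm T (H1_norm \<Omega>) y \<le> sqrt (Y + 2 * R / CA)"
  proof -
    have "0 \<le> H1_norm \<Omega> (y (t 0))" by (simp add: H1_norm_def L2_inner_def)
    \<comment> \<open>\<open>real_of_ereal\<close> sends minus infinity to 0, so the case
      distinction on the essential supremum needs a nonnegative bound.\<close>
    then have "0 \<le> sqrt (Y + 2 * R / CA)" using H1_le[of 0] by linarith
    then show ?thesis unfolding bochner_Linf_norm_def using ess
      by (cases "esssup (lebesgue_on {0<..<T}) (\<lambda>s. ereal (H1_norm \<Omega> (y s)))") auto
  qed

  \<comment> \<open>Norm of the nonlinear term over the time interval\<close>
  have \<psi>AE: "AE x in M. \<psi>' (y (t j) x) = \<psi>' (y s x)" if "j \<in> {1..N}" "s \<in> grid_interval t j" for j s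
    using ys(1)[OF that] by eventually_elim simp
  have \<psi>sL: "(\<lambda>x. \<psi>' (y s x)) \<in> L2_space \<Omega>" if "j \<in> {1..N}" "s \<in> grid_interval t j" for j s
    by (rule L2_cong_AE[OF \<psi>'L[OF that(1)] \<psi>AE[OF that]])
  have \<psi>norm: "(L2_norm \<Omega> (\<lambda>x. \<psi>' (y s x)))\<^sup>2 = (\<integral>x. (\<psi>' (y (t j) x))\<^sup>2 \<partial>M)"
    if "j \<in> {1..N}" "s \<in> grid_interval t j" for j s
    using L2_norm_cong_AE[OF \<psi>'L[OF that(1)] \<psi>AE[OF that]] L2_norm_sq[of "\<lambda>x. \<psi>' (y (t j) x)"] by simp
  show "(\<lambda>s x. \<psi>' (y s x)) \<in> bochner_L2 T (L2_space \<Omega>) (L2_norm \<Omega>)"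
    unfolding bochner_L2_def
  proof (intro CollectI conjI)
    show "strongly_measurable T (L2_space \<Omega>) (L2_norm \<Omega>) (\<lambda>s x. \<psi>' (y s x))"
    proof (rule strongly_measurable_step[where W="\<lambda>j x. \<psi>' (y (t j) x)"])
      fix j s assume js: "j \<in> {1..N}" "s \<in> grid_interval t j"
      have "AE x in M. \<psi>' (y (t j) x) - \<psi>' (y s x) = 0" using \<psi>AE[OF js] by eventually_elim simp
      then show "(\<lambda>x. \<psi>' (y s x)) \<in> L2_space \<Omega> \<and> L2_norm \<Omega> (\<lambda>x. \<psi>' (y (t j) x) - \<psi>' (y s x)) = 0"
        using \<psi>sL[OF js] L2_norm_zero_AE[OF L2_diff[OF \<psi>'L[OF js(1)] \<psi>sL[OF js]]] by blast
    qed (rule \<psi>'L)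
    show "integrable (lebesgue_on {0<..<T}) (\<lambda>s. (L2_norm \<Omega> (\<lambda>x. \<psi>' (y s x)))\<^sup>2)"
      by (rule integral_step(1)[OF \<psi>norm])
  qed
  have n3: "bochner_L2_norm T (L2_norm \<Omega>) (\<lambda>s x. \<psi>' (y s x)) \<le> sqrt (\<psi>'_bound T y0 cbar)"
  proof -
    let ?k = "20 * (C\<psi>\<^sup>2 * Y + (\<integral>x. (\<psi>' 0)\<^sup>2 \<partial>M))"
    have "(\<integral>s. (L2_norm \<Omega> (\<lambda>x. \<psi>' (y s x)))\<^sup>2 \<partial>lebesgue_on {0<..<T}) = (\<Sum>j=1..N. step_size t j * (\<integral>x. (\<psi>' (y (t j) x))\<^sup>2 \<partial>M))"
      by (rule integral_step(2)[OF \<psi>norm])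
    also have "\<dots> \<le> (\<Sum>j=1..N. 16 * (\<tau> j * U j) + 16 * (D j / \<tau> j) + step_size t j * ?k)"
    proof (rule sum_mono)
      fix j assume j: "j \<in> {1..N}"
      have "step_size t j * (\<integral>x. (\<psi>' (y (t j) x))\<^sup>2 \<partial>M) \<le> \<tau> j * (16 * U j + 16 * (D j / (\<tau> j)\<^sup>2) + ?k)"
        unfolding \<tau>_def[symmetric] using \<tau>(1)[OF j] by (intro mult_left_mono \<psi>'sq[OF j]) auto
      also have "\<dots> = 16 * (\<tau> j * U j) + 16 * (D j / \<tau> j) + step_size t j * ?k"
        using \<tau>(1)[OF j] unfolding \<tau>_def[symmetric] by (simp add: distrib_left power2_eq_square)
      finally show "step_size t j * (\<integral>x. (\<psi>' (y (t j) x))\<^sup>2 \<partial>M) \<le> 16 * (\<tau> j * U j) + 16 * (D j / \<tau> j) + step_size t j * ?k" .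
    qed
    also have "\<dots> = 16 * (\<Sum>j=1..N. \<tau> j * U j) + 16 * (\<Sum>j=1..N. D j / \<tau> j) + T * ?k"
      using sum_step_size[of N] t_N by (simp add: sum.distrib sum_distrib_left sum_distrib_right[symmetric])
    also have "\<dots> \<le> 16 * cbar\<^sup>2 + 16 * (4 * R) + T * ?k"
      using Usum DS[of N] by simp
    also have "\<dots> = \<psi>'_bound T y0 cbar" by (simp add: \<psi>'_bound_def R_def Y_def)
    finally show ?thesis by (simp add: bochner_L2_norm_def)
  qed
  show "bochner_L2_norm T (L2_norm \<Omega>) (backward_difference N t y)
      + bochner_Linf_norm T (H1_norm \<Omega>) y
      + bochner_L2_norm T (L2_norm \<Omega>) (\<lambda>s x. \<psi>' (y s x)) \<le> a_priori_bound T y0 cbar"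
    using n1 n2 n3 by (simp add: a_priori_bound_def R_def Y_def)
qed

end

text \<open>The bound on the second derivatives says that \<open>f' n\<close> plus C times the
  identity is nondecreasing; this is an inequality between values, so it passes to pointwise limits,
  where no second derivative is available.\<close>

lemma semimonotone_limit:
  fixes \<psi>' :: "real \<Rightarrow> real"
  assumes deriv: "\<And>n x. (f' n has_real_derivative f'' n x) (at x)" and ge: "\<And>n x. f'' n x \<ge> - C"
    and lim: "\<And>x. (\<lambda>n. f' n x) \<longlonglongrightarrow> \<psi>' x"
  shows "(\<psi>' s - \<psi>' t) * (s - t) \<ge> - C * (s - t)\<^sup>2"
proof -
  have le: "f' n a + C * a \<le> f' n b + C * b" if "a \<le> b" for n a b
  proof (rule DERIV_nonneg_imp_nondecreasing[of a b "\<lambda>x. f' n x + C * x", OF that])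
    fix x
    have "((\<lambda>x. f' n x + C * x) has_real_derivative f'' n x + C) (at x)"
      by (auto intro!: derivative_eq_intros deriv)
    moreover have "0 \<le> f'' n x + C" using ge[of n x] by simp
    ultimately show "\<exists>y. ((\<lambda>x. f' n x + C * x) has_real_derivative y) (at x) \<and> 0 \<le> y" by blast
  qed
  have "- C * (s - t)\<^sup>2 \<le> (f' n s - f' n t) * (s - t)" for n
  proof -
    have "0 \<le> ((f' n s + C * s) - (f' n t + C * t)) * (s - t)"
      using le[of s t n] le[of t s n] by (cases "s \<le> t") (auto intro: mult_nonpos_nonpos)
    then show ?thesis by (simp add: algebra_simps power2_eq_square)
  qed
  moreover have "(\<lambda>n. (f' n s - f' n t) * (s - t)) \<longlonglongrightarrow> (\<psi>' s - \<psi>' t) * (s - t)"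
    by (intro tendsto_intros lim)
  ultimately show ?thesis by (intro LIMSEQ_le_const) auto
qed

theorem theorem2p3:
  fixes \<Omega> :: "'a::euclidean_space set"
    and T :: real
    and y0 :: "'a \<Rightarrow> real"
    and A :: "'a \<Rightarrow> real" and A' :: "'a \<Rightarrow> 'a"
    and CA CA_bar :: real
    and \<psi> \<psi>' :: "real \<Rightarrow> real"
    and c C\<psi> :: real
    and Cn :: "nat \<Rightarrow> real"
    and f f' f'' :: "nat \<Rightarrow> real \<Rightarrow> real"
  assumes "bounded_lipschitz_domain \<Omega>"
    and "0 < T"
    and "y0 \<in> H1_space \<Omega>"
    and "\<forall>p. GDERIV A p :> A' p" and "continuous_on UNIV A'"
    and "CA > 0" and "CA_bar > 0"
    and "\<forall>p q. (A' p - A' q) \<bullet> (p - q) \<ge> CA * (norm (p - q))\<^sup>2"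
    and "\<forall>p. norm (A' p) \<le> CA_bar * norm p"
    and "\<forall>x. (\<psi> has_real_derivative \<psi>' x) (at x)" and "continuous_on UNIV \<psi>'"
    and "bdd_below (range \<psi>)"
    and "integrable (lebesgue_on \<Omega>) (\<lambda>x. \<psi> (y0 x))"
    and "c \<ge> 0" and "C\<psi> \<ge> 0" and "\<forall>n. Cn n \<ge> 0"
    and "\<forall>n x. (f n has_real_derivative f' n x) (at x)"
    and "\<forall>n x. (f' n has_real_derivative f'' n x) (at x)"
    and "\<forall>n. continuous_on UNIV (f'' n)"
    and "\<forall>K. compact K \<longrightarrow> uniform_limit K f \<psi> sequentially \<and> uniform_limit K f' \<psi>' sequentially"
    and "\<forall>n x. - c \<le> f n x \<and> f n x \<le> c * (\<psi> x + 1)"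
    and "\<forall>n x. f'' n x \<ge> - C\<psi>"
    and "\<forall>n x. \<bar>f'' n x\<bar> \<le> Cn n"
  shows "(\<forall>N t. time_grid T N t \<and> less_reciprocal (mesh_size N t) C\<psi> \<longrightarrow>
            (\<forall>u\<in>U_tau T \<Omega> N t.
               (\<exists>y. discrete_state_solution T \<Omega> A' \<psi>' y0 N t u y) \<and>
               (\<forall>y z. discrete_state_solution T \<Omega> A' \<psi>' y0 N t u y \<and>
                      discrete_state_solution T \<Omega> A' \<psi>' y0 N t u z \<longrightarrow>
                      (AE x in lebesgue_on \<Omega>. \<forall>s\<in>{0..T}. y s x = z s x)))) \<and>
         (\<forall>cbar\<ge>0. \<exists>C. \<forall>N t u y.
            time_grid T N t \<and> less_reciprocal (mesh_size N t) C\<psi> \<and>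
            u \<in> U_tau T \<Omega> N t \<and> bochner_L2_norm T (L2_norm \<Omega>) u \<le> cbar \<and>
            discrete_state_solution T \<Omega> A' \<psi>' y0 N t u y \<longrightarrow>
              backward_difference N t y \<in> bochner_L2 T (L2_space \<Omega>) (L2_norm \<Omega>) \<and>
              y \<in> bochner_Linf T (H1_space \<Omega>) (H1_norm \<Omega>) \<and>
              (\<lambda>s x. \<psi>' (y s x)) \<in> bochner_L2 T (L2_space \<Omega>) (L2_norm \<Omega>) \<and>
              bochner_L2_norm T (L2_norm \<Omega>) (backward_difference N t y)
                + bochner_Linf_norm T (H1_norm \<Omega>) y
                + bochner_L2_norm T (L2_norm \<Omega>) (\<lambda>s x. \<psi>' (y s x)) \<le> C)"
proof -
  have \<Omega>: "open \<Omega>" "bounded \<Omega>" using assms(1) by (auto simp: bounded_lipschitz_domain_def)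
  obtain m where m: "\<And>s. m \<le> \<psi> s" using assms(12) by (auto simp: bdd_below_def)
  \<comment> \<open>Uniform convergence on the compact set {x} is convergence at the point
    x.\<close>
  have lim: "(\<lambda>n. f' n x) \<longlonglongrightarrow> \<psi>' x" for x
    using assms(20)[rule_format, of "{x}"] by (auto dest: tendsto_uniform_limitI)
  have semi: "(\<psi>' s - \<psi>' r) * (s - r) \<ge> - C\<psi> * (s - r)\<^sup>2" for s r
    by (rule semimonotone_limit[of f' f'', OF _ _ lim]) (use assms in auto)
  interpret discrete_step \<Omega> A A' CA CA_bar \<psi> \<psi>' C\<psi> m
    by unfold_locales (use \<Omega> assms m semi in auto)
  have problem: "discrete_problem \<Omega> A A' CA CA_bar \<psi> \<psi>' C\<psi> m T N t y0 u"
    if "time_grid T N t" "less_reciprocal (mesh_size N t) C\<psi>" "u \<in> U_tau T \<Omega> N t" for N t u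
    using that assms(3) by unfold_locales auto
  show ?thesis
  proof (intro conjI allI impI ballI)
    fix N t u assume "time_grid T N t \<and> less_reciprocal (mesh_size N t) C\<psi>" "u \<in> U_tau T \<Omega> N t"
    then interpret discrete_problem \<Omega> A A' CA CA_bar \<psi> \<psi>' C\<psi> m T N t y0 u by (intro problem) auto
    show "\<exists>y. discrete_state_solution T \<Omega> A' \<psi>' y0 N t u y" by (rule solution_exists)
  next
    fix N t u y z assume "time_grid T N t \<and> less_reciprocal (mesh_size N t) C\<psi>" "u \<in> U_tau T \<Omega> N t"
      and yz: "discrete_state_solution T \<Omega> A' \<psi>' y0 N t u y \<and> discrete_state_solution T \<Omega> A' \<psi>' y0 N t u z"
    then interpret discrete_problem \<Omega> A A' CA CA_bar \<psi> \<psi>' C\<psi> m T N t y0 u by (intro problem) auto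
    show "AE x in lebesgue_on \<Omega>. \<forall>s\<in>{0..T}. y s x = z s x" using yz by (intro solution_unique) auto
  next
    fix cbar :: real
    show "\<exists>C. \<forall>N t u y. time_grid T N t \<and> less_reciprocal (mesh_size N t) C\<psi> \<and>
            u \<in> U_tau T \<Omega> N t \<and> bochner_L2_norm T (L2_norm \<Omega>) u \<le> cbar \<and>
            discrete_state_solution T \<Omega> A' \<psi>' y0 N t u y \<longrightarrow>
              backward_difference N t y \<in> bochner_L2 T (L2_space \<Omega>) (L2_norm \<Omega>) \<and>
              y \<in> bochner_Linf T (H1_space \<Omega>) (H1_norm \<Omega>) \<and>
              (\<lambda>s x. \<psi>' (y s x)) \<in> bochner_L2 T (L2_space \<Omega>) (L2_norm \<Omega>) \<and>
              bochner_L2_norm T (L2_norm \<Omega>) (backward_difference N t y)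
                + bochner_Linf_norm T (H1_norm \<Omega>) y
                + bochner_L2_norm T (L2_norm \<Omega>) (\<lambda>s x. \<psi>' (y s x)) \<le> C"
    \<comment> \<open>The witness is fixed before the grid and the control: besides T,
      \<open>y0\<close> and \<open>cbar\<close> it involves only \<open>A\<close>,
      \<open>\<psi>\<close>, their constants and \<open>\<Omega>\<close>.\<close>
    proof (intro exI[of _ "a_priori_bound T y0 cbar"] allI impI, elim conjE)
      fix N t u y
      assume g: "time_grid T N t" "less_reciprocal (mesh_size N t) C\<psi>" "u \<in> U_tau T \<Omega> N t"
        and u: "bochner_L2_norm T (L2_norm \<Omega>) u \<le> cbar" and y: "discrete_state_solution T \<Omega> A' \<psi>' y0 N t u y"
      interpret dp: discrete_problem \<Omega> A A' CA CA_bar \<psi> \<psi>' C\<psi> m T N t y0 u by (rule problem[OF g])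
      note est = dp.a_priori_estimate[OF y assms(13) u]
      show "backward_difference N t y \<in> bochner_L2 T (L2_space \<Omega>) (L2_norm \<Omega>) \<and>
              y \<in> bochner_Linf T (H1_space \<Omega>) (H1_norm \<Omega>) \<and>
              (\<lambda>s x. \<psi>' (y s x)) \<in> bochner_L2 T (L2_space \<Omega>) (L2_norm \<Omega>) \<and>
              bochner_L2_norm T (L2_norm \<Omega>) (backward_difference N t y)
                + bochner_Linf_norm T (H1_norm \<Omega>) y
                + bochner_L2_norm T (L2_norm \<Omega>) (\<lambda>s x. \<psi>' (y s x)) \<le> a_priori_bound T y0 cbar"
        using est by blast
    qed
  qed
qed

end
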